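(* Let $R$ be a unital commutative ring and $D$ a unital superdialgebra over $R$. The universal central extension of the Leibniz superalgebra $\mathfrak{sl}(2,1,D)$ is $\mathfrak{stl}(2,1,D)$, via the canonical homomorphism $\mathfrak{stl}(2,1,D)\to\mathfrak{sl}(2,1,D)$, $F_{ij}(a)\mapsto E_{ij}(a)$.
   Context: $R$ is a fixed unital commutative ring; $|x|\in\mathbb{Z}_2$ denotes the degree of a homogeneous element, and formulas involving degrees are for homogeneous elements and extended linearly. A superdialgebra $D=D_{\bar 0}\oplus D_{\bar 1}$ is a $\mathbb{Z}_2$-graded $R$-module with two associative $R$-linear operations $\vdash,\dashv\colon D\otimes_R D\to D$, compatible with the grading, such that $a\dashv(b\dashv c)=a\dashv(b\vdash c)$, $(a\vdash b)\dashv c=a\vdash(b\dashv c)$, $(a\dashv b)\vdash c=(a\vdash b)\vdash c$. It is unital if it has a chosen bar-unit, i.e. an (even) element $1$ with $a\dashv 1=a=1\vdash a$ for all $a$. A Leibniz superalgebra $L$ is an $R$-supermodule with an even $R$-linear map $[-,-]\colon L\otimes_R L\to L$ satisfying $[x,[y,z]]=[[x,y],z]-(-1)^{|y||z|}[[x,z],y]$. Its centre $\mathrm{Z}(L)$ is the set of $z$ with $[z,x]=[x,z]=0$ for all $x$. A central extension of $L$ is a surjective homomorphism $\phi\colon M\to L$ with $\mathrm{Ker}\,\phi\subseteq\mathrm{Z}(M)$; a central extension $\mathfrak{u}\colon U\to L$ is universal if for every central extension $\phi\colon M\to L$ there is a unique homomorphism $f\colon U\to M$ with $\mathfrak{u}=\phi\circ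 f$. For non-negative integers $m,n$ with $m+n\ge 3$ put $|i|=\bar 0$ for $1\le i\le m$ and $|i|=\bar 1$ for $m+1\le i\le m+n$. $\mathfrak{gl}(m,n,D)$ is the $R$-module of $(m+n)\times(m+n)$ matrices over $D$, where $E_{ij}(a)$ (the matrix with $a$ in position $(i,j)$ and zeros elsewhere) has degree $|i|+|j|+|a|$, with bracket $[x,y]=x\dashv y-(-1)^{|x||y|}y\vdash x$, where $(x\dashv y)_{ij}=\sum_k x_{ik}\dashv y_{kj}$ and $(x\vdash y)_{ij}=\sum_k x_{ik}\vdash y_{kj}$. $\mathfrak{sl}(m,n,D)=[\mathfrak{gl}(m,n,D),\mathfrak{gl}(m,n,D)]$. The Steinberg Leibniz superalgebra $\mathfrak{stl}(m,n,D)$ is the Leibniz superalgebra over $R$ generated by elements $F_{ij}(a)$, $a\in D_{\bar 0}\cup D_{\bar 1}$, $1\le i\ne j\le m+n$, of degree $|i|+|j|+|a|$, subject to: $a\mapsto F_{ij}(a)$ is $R$-linear; $[F_{ij}(a),F_{kl}(b)]=F_{il}(a\dashv b)$ if $i\ne l$ and $j=k$; $[F_{ij}(a),F_{kl}(b)]=-(-1)^{|F_{ij}(a)||F_{kl}(b)|}F_{kj}(b\vdash a)$ if $i=l$ and $j\ne k$; $[F_{ij}(a),F_{kl}(b)]=0$ if $i\ne l$ and $j\ne k$. *)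

theory Defs
  imports "HOL-Algebra.Module" "HOL-Algebra.AbelCoset" "HOL-Library.Z2"
begin

section \<open>Supermodules over a commutative ring\<close>

text \<open>
  The group of degrees is \<^typ>\<open>bit\<close>, the field with two elements, so that \<open>p + q\<close> and \<open>p * q\<close> are
  the expressions occurring in the sign rule.  The scalars \<open>R\<close> are purely even.
\<close>

record ('r, 'a) supermodule = "('r, 'a) module" +
  hpart :: "bit \<Rightarrow> 'a set"

locale supermodule = module R M
  for R (structure) and M :: "('r, 'a, 'z) supermodule_scheme" (structure) +
  assumes hpart_submodule: "submodule (hpart M p) R M"
    and hpart_sum: "carrier M = hpart M 0 <+>\<^bsub>M\<^esub> hpart M 1"
    and hpart_inter: "hpart M 0 \<inter> hpart M 1 = {\<zero>\<^bsub>M\<^esub>}"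

definition hcomp :: "('r, 'a, 'z) supermodule_scheme \<Rightarrow> bit \<Rightarrow> 'a \<Rightarrow> 'a" where
  "hcomp M p x = (THE y. y \<in> hpart M p \<and> (\<exists>z \<in> hpart M (p + 1). x = y \<oplus>\<^bsub>M\<^esub> z))"

definition sgn_of :: "('r, 'x) ring_scheme \<Rightarrow> bit \<Rightarrow> 'r" where
  "sgn_of R p = (if p = 0 then \<one>\<^bsub>R\<^esub> else \<ominus>\<^bsub>R\<^esub> \<one>\<^bsub>R\<^esub>)"

text \<open>This encodes an even linear map from the tensor square of \<open>M\<close> to \<open>M\<close>.\<close>

definition even_bilinear ::
  "('r, 'x) ring_scheme \<Rightarrow> ('r, 'a, 'z) supermodule_scheme \<Rightarrow> ('a \<Rightarrow> 'a \<Rightarrow> 'a) \<Rightarrow> bool" where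
  "even_bilinear R M f \<longleftrightarrow>
     (\<forall>x \<in> carrier M. \<forall>y \<in> carrier M. f x y \<in> carrier M) \<and>
     (\<forall>x \<in> carrier M. \<forall>y \<in> carrier M. \<forall>z \<in> carrier M.
        f (x \<oplus>\<^bsub>M\<^esub> y) z = f x z \<oplus>\<^bsub>M\<^esub> f y z \<and>
        f z (x \<oplus>\<^bsub>M\<^esub> y) = f z x \<oplus>\<^bsub>M\<^esub> f z y) \<and>
     (\<forall>r \<in> carrier R. \<forall>x \<in> carrier M. \<forall>y \<in> carrier M.
        f (r \<odot>\<^bsub>M\<^esub> x) y = r \<odot>\<^bsub>M\<^esub> f x y \<and>
        f x (r \<odot>\<^bsub>M\<^esub> y) = r \<odot>\<^bsub>M\<^esub> f x y) \<and>
     (\<forall>p q. \<forall>x \<in> hpart M p. \<forall>y \<in> hpart M q. f x y \<in> hpart M (p + q))"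


section \<open>Superdialgebras\<close>

text \<open>
  The inherited multiplication is the left product \<open>\<stileturn>\<close>, the new field is the right product \<open>\<turnstile>\<close>,
  and the inherited field \<^const>\<open>one\<close> is the chosen bar-unit.
\<close>

record ('r, 'a) superdialgebra = "('r, 'a) supermodule" +
  rprod :: "['a, 'a] \<Rightarrow> 'a" (infixl \<open>\<turnstile>\<index>\<close> 70)

abbreviation lprod :: "('r, 'a, 'z) superdialgebra_scheme \<Rightarrow> ['a, 'a] \<Rightarrow> 'a" (infixl \<open>\<stileturn>\<index>\<close> 70) where
  "lprod D \<equiv> monoid.mult D"

locale superdialgebra = supermodule R D
  for R (structure) and D :: "('r, 'a, 'z) superdialgebra_scheme" (structure) +
  assumes lprod_bilinear: "even_bilinear R D (lprod D)"
    and rprod_bilinear: "even_bilinear R D (rprod D)"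
    and lprod_assoc: "\<lbrakk>a \<in> carrier D; b \<in> carrier D; c \<in> carrier D\<rbrakk> \<Longrightarrow>
          (a \<stileturn>\<^bsub>D\<^esub> b) \<stileturn>\<^bsub>D\<^esub> c = a \<stileturn>\<^bsub>D\<^esub> (b \<stileturn>\<^bsub>D\<^esub> c)"
    and rprod_assoc: "\<lbrakk>a \<in> carrier D; b \<in> carrier D; c \<in> carrier D\<rbrakk> \<Longrightarrow>
          (a \<turnstile>\<^bsub>D\<^esub> b) \<turnstile>\<^bsub>D\<^esub> c = a \<turnstile>\<^bsub>D\<^esub> (b \<turnstile>\<^bsub>D\<^esub> c)"
    and lprod_bar: "\<lbrakk>a \<in> carrier D; b \<in> carrier D; c \<in> carrier D\<rbrakk> \<Longrightarrow>
          a \<stileturn>\<^bsub>D\<^esub> (b \<stileturn>\<^bsub>D\<^esub> c) = a \<stileturn>\<^bsub>D\<^esub> (b \<turnstile>\<^bsub>D\<^esub> c)"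
    and inner_assoc: "\<lbrakk>a \<in> carrier D; b \<in> carrier D; c \<in> carrier D\<rbrakk> \<Longrightarrow>
          (a \<turnstile>\<^bsub>D\<^esub> b) \<stileturn>\<^bsub>D\<^esub> c = a \<turnstile>\<^bsub>D\<^esub> (b \<stileturn>\<^bsub>D\<^esub> c)"
    and rprod_bar: "\<lbrakk>a \<in> carrier D; b \<in> carrier D; c \<in> carrier D\<rbrakk> \<Longrightarrow>
          (a \<stileturn>\<^bsub>D\<^esub> b) \<turnstile>\<^bsub>D\<^esub> c = (a \<turnstile>\<^bsub>D\<^esub> b) \<turnstile>\<^bsub>D\<^esub> c"

locale unital_superdialgebra = superdialgebra R D
  for R (structure) and D :: "('r, 'a, 'z) superdialgebra_scheme" (structure) +
  assumes bar_unit_even: "\<one>\<^bsub>D\<^esub> \<in> hpart D 0"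
    and bar_unit_right: "a \<in> carrier D \<Longrightarrow> a \<stileturn>\<^bsub>D\<^esub> \<one>\<^bsub>D\<^esub> = a"
    and bar_unit_left: "a \<in> carrier D \<Longrightarrow> \<one>\<^bsub>D\<^esub> \<turnstile>\<^bsub>D\<^esub> a = a"


section \<open>Leibniz superalgebras and their central extensions\<close>

text \<open>
  The bracket is the inherited multiplication; the inherited field \<^const>\<open>one\<close> carries no meaning.
  The Leibniz identity involves the degrees of \<open>y\<close> and \<open>z\<close> only.
\<close>

abbreviation bracket :: "('r, 'a, 'z) supermodule_scheme \<Rightarrow> 'a \<Rightarrow> 'a \<Rightarrow> 'a" where
  "bracket L \<equiv> monoid.mult L"

locale leibniz_superalgebra = supermodule R L
  for R (structure) and L :: "('r, 'a, 'z) supermodule_scheme" (structure) +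
  assumes bracket_bilinear: "even_bilinear R L (bracket L)"
    and leibniz: "\<lbrakk>x \<in> carrier L; y \<in> hpart L p; z \<in> hpart L q\<rbrakk> \<Longrightarrow>
          bracket L x (bracket L y z) =
            bracket L (bracket L x y) z
              \<ominus>\<^bsub>L\<^esub> sgn_of R (p * q) \<odot>\<^bsub>L\<^esub> bracket L (bracket L x z) y"

definition leibniz_centre :: "('r, 'a, 'z) supermodule_scheme \<Rightarrow> 'a set" where
  "leibniz_centre L =
     {z \<in> carrier L. \<forall>x \<in> carrier L. bracket L z x = \<zero>\<^bsub>L\<^esub> \<and> bracket L x z = \<zero>\<^bsub>L\<^esub>}"

definition leibniz_hom ::
  "('r, 'x) ring_scheme \<Rightarrow> ('r, 'a, 'y) supermodule_scheme \<Rightarrow> ('r, 'b, 'z) supermodule_scheme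
     \<Rightarrow> ('a \<Rightarrow> 'b) set" where
  "leibniz_hom R L M =
     {f \<in> carrier L \<rightarrow> carrier M.
        (\<forall>x \<in> carrier L. \<forall>y \<in> carrier L. f (x \<oplus>\<^bsub>L\<^esub> y) = f x \<oplus>\<^bsub>M\<^esub> f y) \<and>
        (\<forall>r \<in> carrier R. \<forall>x \<in> carrier L. f (r \<odot>\<^bsub>L\<^esub> x) = r \<odot>\<^bsub>M\<^esub> f x) \<and>
        (\<forall>x \<in> carrier L. \<forall>y \<in> carrier L. f (bracket L x y) = bracket M (f x) (f y)) \<and>
        (\<forall>p. f ` hpart L p \<subseteq> hpart M p)}"

definition central_extension ::
  "('r, 'x) ring_scheme \<Rightarrow> ('r, 'a, 'y) supermodule_scheme \<Rightarrow> ('r, 'b, 'z) supermodule_scheme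
     \<Rightarrow> ('a \<Rightarrow> 'b) \<Rightarrow> bool" where
  "central_extension R M L \<phi> \<longleftrightarrow>
     leibniz_superalgebra R M \<and> leibniz_superalgebra R L \<and>
     \<phi> \<in> leibniz_hom R M L \<and> \<phi> ` carrier M = carrier L \<and>
     {x \<in> carrier M. \<phi> x = \<zero>\<^bsub>L\<^esub>} \<subseteq> leibniz_centre M"

text \<open>
  The test extensions have elements in a type passed as a parameter.  A theorem in
  which this type is a free type variable covers all central extensions.  Functions are made
  extensional so that uniqueness refers to values on the carrier.
\<close>

definition universal_central_extension ::
  "'m itself \<Rightarrow> ('r, 'x) ring_scheme \<Rightarrow> ('r, 'a, 'y) supermodule_scheme
     \<Rightarrow> ('r, 'b, 'z) supermodule_scheme \<Rightarrow> ('a \<Rightarrow> 'b) \<Rightarrow> bool" where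
  "universal_central_extension T R U L u \<longleftrightarrow>
     central_extension R U L u \<and>
     (\<forall>(M :: ('r, 'm) supermodule) \<phi>. central_extension R M L \<phi> \<longrightarrow>
        (\<exists>!f. f \<in> leibniz_hom R U M \<and> f \<in> extensional (carrier U) \<and>
              (\<forall>x \<in> carrier U. u x = \<phi> (f x))))"


section \<open>The Leibniz superalgebras \<open>gl(m,n,D)\<close> and \<open>sl(m,n,D)\<close>\<close>

definition idx_deg :: "nat \<Rightarrow> nat \<Rightarrow> bit" where
  "idx_deg m i = (if i \<le> m then 0 else 1)"

text \<open>
  Matrices are functions on pairs of natural numbers, with entries in \<open>D\<close> and zero outside of
  the index range.
\<close>

definition mat_carrier ::
  "('r, 'd, 'z) superdialgebra_scheme \<Rightarrow> nat \<Rightarrow> nat \<Rightarrow> (nat \<Rightarrow> nat \<Rightarrow> 'd) set" where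
  "mat_carrier D m n =
     {x. (\<forall>i j. x i j \<in> carrier D) \<and>
         (\<forall>i j. \<not> (i \<in> {1..m+n} \<and> j \<in> {1..m+n}) \<longrightarrow> x i j = \<zero>\<^bsub>D\<^esub>)}"

definition mat_superdialgebra ::
  "('r, 'd, 'z) superdialgebra_scheme \<Rightarrow> nat \<Rightarrow> nat \<Rightarrow> ('r, nat \<Rightarrow> nat \<Rightarrow> 'd) superdialgebra" where
  "mat_superdialgebra D m n =
     \<lparr>carrier = mat_carrier D m n,
      monoid.mult = (\<lambda>x y i j. \<Oplus>\<^bsub>D\<^esub>k\<in>{1..m+n}. x i k \<stileturn>\<^bsub>D\<^esub> y k j),
      one = (\<lambda>i j. if i = j \<and> i \<in> {1..m+n} then \<one>\<^bsub>D\<^esub> else \<zero>\<^bsub>D\<^esub>),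
      ring.zero = (\<lambda>i j. \<zero>\<^bsub>D\<^esub>),
      add = (\<lambda>x y i j. x i j \<oplus>\<^bsub>D\<^esub> y i j),
      smult = (\<lambda>r x i j. r \<odot>\<^bsub>D\<^esub> x i j),
      hpart = (\<lambda>p. {x \<in> mat_carrier D m n.
                      \<forall>i\<in>{1..m+n}. \<forall>j\<in>{1..m+n}.
                        x i j \<in> hpart D (idx_deg m i + idx_deg m j + p)}),
      rprod = (\<lambda>x y i j. \<Oplus>\<^bsub>D\<^esub>k\<in>{1..m+n}. x i k \<turnstile>\<^bsub>D\<^esub> y k j)\<rparr>"

text \<open>
  The bracket \<open>x \<stileturn> y - (-1)\<^bsup>|x||y|\<^esup> y \<turnstile> x\<close> on a superdialgebra, extended linearly from homogeneous
  elements.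
\<close>

definition super_commutator ::
  "('r, 'x) ring_scheme \<Rightarrow> ('r, 'a, 'z) superdialgebra_scheme \<Rightarrow> 'a \<Rightarrow> 'a \<Rightarrow> 'a" where
  "super_commutator R A x y =
     (\<Oplus>\<^bsub>A\<^esub>p\<in>UNIV. \<Oplus>\<^bsub>A\<^esub>q\<in>UNIV.
        hcomp A p x \<stileturn>\<^bsub>A\<^esub> hcomp A q y
          \<ominus>\<^bsub>A\<^esub> sgn_of R (p * q) \<odot>\<^bsub>A\<^esub> (hcomp A q y \<turnstile>\<^bsub>A\<^esub> hcomp A p x))"

definition leibniz_of ::
  "('r, 'x) ring_scheme \<Rightarrow> ('r, 'a, 'z) superdialgebra_scheme \<Rightarrow> ('r, 'a) supermodule" where
  "leibniz_of R A =
     \<lparr>carrier = carrier A, monoid.mult = super_commutator R A, one = undefined,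
      ring.zero = \<zero>\<^bsub>A\<^esub>, add = add A, smult = smult A, hpart = hpart A\<rparr>"

definition gl ::
  "('r, 'x) ring_scheme \<Rightarrow> nat \<Rightarrow> nat \<Rightarrow> ('r, 'd, 'z) superdialgebra_scheme
     \<Rightarrow> ('r, nat \<Rightarrow> nat \<Rightarrow> 'd) supermodule" where
  "gl R m n D = leibniz_of R (mat_superdialgebra D m n)"

text \<open>\<open>[L, L]\<close> is the submodule spanned by the brackets.\<close>

definition derived_set ::
  "('r, 'x) ring_scheme \<Rightarrow> ('r, 'a, 'z) supermodule_scheme \<Rightarrow> 'a set" where
  "derived_set R L =
     \<Inter>{N. submodule N R L \<and> (\<forall>x \<in> carrier L. \<forall>y \<in> carrier L. bracket L x y \<in> N)}"

definition sl ::
  "('r, 'x) ring_scheme \<Rightarrow> nat \<Rightarrow> nat \<Rightarrow> ('r, 'd, 'z) superdialgebra_scheme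
     \<Rightarrow> ('r, nat \<Rightarrow> nat \<Rightarrow> 'd) supermodule" where
  "sl R m n D =
     (gl R m n D)
       \<lparr>carrier := derived_set R (gl R m n D),
        hpart := (\<lambda>p. hpart (gl R m n D) p \<inter> derived_set R (gl R m n D))\<rparr>"

definition mat_unit ::
  "('r, 'd, 'z) superdialgebra_scheme \<Rightarrow> nat \<Rightarrow> nat \<Rightarrow> 'd \<Rightarrow> nat \<Rightarrow> nat \<Rightarrow> 'd" where
  "mat_unit D i j a = (\<lambda>k l. if k = i \<and> l = j then a else \<zero>\<^bsub>D\<^esub>)"


section \<open>Leibniz superalgebras given by generators and relations\<close>

datatype ('r, 'g) lterm =
    Gen 'g
  | Zero
  | Add "('r, 'g) lterm" "('r, 'g) lterm"
  | Smul 'r "('r, 'g) lterm"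
  | Brk "('r, 'g) lterm" "('r, 'g) lterm"

text \<open>
  \<open>G p\<close> is the set of generators of degree \<open>p\<close>.  A generator may lie in both sets; it then has to be
  killed by the relations (below this concerns the generators \<open>F\<^sub>i\<^sub>j(0)\<close>).
\<close>

inductive_set lterms :: "('r, 'x) ring_scheme \<Rightarrow> (bit \<Rightarrow> 'g set) \<Rightarrow> ('r, 'g) lterm set"
  for R :: "('r, 'x) ring_scheme" and G :: "bit \<Rightarrow> 'g set" where
  "g \<in> G p \<Longrightarrow> Gen g \<in> lterms R G"
| "Zero \<in> lterms R G"
| "\<lbrakk>s \<in> lterms R G; t \<in> lterms R G\<rbrakk> \<Longrightarrow> Add s t \<in> lterms R G"
| "\<lbrakk>r \<in> carrier R; t \<in> lterms R G\<rbrakk> \<Longrightarrow> Smul r t \<in> lterms R G"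
| "\<lbrakk>s \<in> lterms R G; t \<in> lterms R G\<rbrakk> \<Longrightarrow> Brk s t \<in> lterms R G"

inductive hom_lterm ::
  "('r, 'x) ring_scheme \<Rightarrow> (bit \<Rightarrow> 'g set) \<Rightarrow> bit \<Rightarrow> ('r, 'g) lterm \<Rightarrow> bool"
  for R :: "('r, 'x) ring_scheme" and G :: "bit \<Rightarrow> 'g set" where
  "g \<in> G p \<Longrightarrow> hom_lterm R G p (Gen g)"
| "hom_lterm R G p Zero"
| "\<lbrakk>hom_lterm R G p s; hom_lterm R G p t\<rbrakk> \<Longrightarrow> hom_lterm R G p (Add s t)"
| "\<lbrakk>r \<in> carrier R; hom_lterm R G p t\<rbrakk> \<Longrightarrow> hom_lterm R G p (Smul r t)"
| "\<lbrakk>hom_lterm R G p s; hom_lterm R G q t\<rbrakk> \<Longrightarrow> hom_lterm R G (p + q) (Brk s t)"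

text \<open>
  The congruence on terms generated by the relations \<open>E\<close> and the axioms of Leibniz superalgebras.
\<close>

inductive lcong ::
  "('r, 'x) ring_scheme \<Rightarrow> (bit \<Rightarrow> 'g set) \<Rightarrow> (('r, 'g) lterm \<times> ('r, 'g) lterm) set
     \<Rightarrow> ('r, 'g) lterm \<Rightarrow> ('r, 'g) lterm \<Rightarrow> bool"
  for R :: "('r, 'x) ring_scheme" and G :: "bit \<Rightarrow> 'g set"
    and E :: "(('r, 'g) lterm \<times> ('r, 'g) lterm) set" where
  rel: "\<lbrakk>(s, t) \<in> E; s \<in> lterms R G; t \<in> lterms R G\<rbrakk> \<Longrightarrow> lcong R G E s t"
| refl: "s \<in> lterms R G \<Longrightarrow> lcong R G E s s"
| sym: "lcong R G E s t \<Longrightarrow> lcong R G E t s"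
| trans: "\<lbrakk>lcong R G E s t; lcong R G E t u\<rbrakk> \<Longrightarrow> lcong R G E s u"
| cong_Add: "\<lbrakk>lcong R G E s s'; lcong R G E t t'\<rbrakk> \<Longrightarrow> lcong R G E (Add s t) (Add s' t')"
| cong_Smul: "\<lbrakk>r \<in> carrier R; lcong R G E t t'\<rbrakk> \<Longrightarrow> lcong R G E (Smul r t) (Smul r t')"
| cong_Brk: "\<lbrakk>lcong R G E s s'; lcong R G E t t'\<rbrakk> \<Longrightarrow> lcong R G E (Brk s t) (Brk s' t')"
| add_assoc: "\<lbrakk>s \<in> lterms R G; t \<in> lterms R G; u \<in> lterms R G\<rbrakk> \<Longrightarrow>
    lcong R G E (Add (Add s t) u) (Add s (Add t u))"
| add_comm: "\<lbrakk>s \<in> lterms R G; t \<in> lterms R G\<rbrakk> \<Longrightarrow> lcong R G E (Add s t) (Add t s)"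
| add_zero: "s \<in> lterms R G \<Longrightarrow> lcong R G E (Add Zero s) s"
| add_neg: "s \<in> lterms R G \<Longrightarrow> lcong R G E (Add (Smul (\<ominus>\<^bsub>R\<^esub> \<one>\<^bsub>R\<^esub>) s) s) Zero"
| smul_add_left: "\<lbrakk>a \<in> carrier R; b \<in> carrier R; s \<in> lterms R G\<rbrakk> \<Longrightarrow>
    lcong R G E (Smul (a \<oplus>\<^bsub>R\<^esub> b) s) (Add (Smul a s) (Smul b s))"
| smul_add_right: "\<lbrakk>a \<in> carrier R; s \<in> lterms R G; t \<in> lterms R G\<rbrakk> \<Longrightarrow>
    lcong R G E (Smul a (Add s t)) (Add (Smul a s) (Smul a t))"
| smul_mult: "\<lbrakk>a \<in> carrier R; b \<in> carrier R; s \<in> lterms R G\<rbrakk> \<Longrightarrow>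
    lcong R G E (Smul (a \<otimes>\<^bsub>R\<^esub> b) s) (Smul a (Smul b s))"
| smul_one: "s \<in> lterms R G \<Longrightarrow> lcong R G E (Smul \<one>\<^bsub>R\<^esub> s) s"
| brk_add_left: "\<lbrakk>s \<in> lterms R G; t \<in> lterms R G; u \<in> lterms R G\<rbrakk> \<Longrightarrow>
    lcong R G E (Brk (Add s t) u) (Add (Brk s u) (Brk t u))"
| brk_add_right: "\<lbrakk>s \<in> lterms R G; t \<in> lterms R G; u \<in> lterms R G\<rbrakk> \<Longrightarrow>
    lcong R G E (Brk u (Add s t)) (Add (Brk u s) (Brk u t))"
| brk_smul_left: "\<lbrakk>a \<in> carrier R; s \<in> lterms R G; t \<in> lterms R G\<rbrakk> \<Longrightarrow>
    lcong R G E (Brk (Smul a s) t) (Smul a (Brk s t))"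
| brk_smul_right: "\<lbrakk>a \<in> carrier R; s \<in> lterms R G; t \<in> lterms R G\<rbrakk> \<Longrightarrow>
    lcong R G E (Brk s (Smul a t)) (Smul a (Brk s t))"
| leibniz: "\<lbrakk>s \<in> lterms R G; hom_lterm R G p t; hom_lterm R G q u\<rbrakk> \<Longrightarrow>
    lcong R G E (Brk s (Brk t u))
      (Add (Brk (Brk s t) u) (Smul (\<ominus>\<^bsub>R\<^esub> sgn_of R (p * q)) (Brk (Brk s u) t)))"

definition lclass ::
  "('r, 'x) ring_scheme \<Rightarrow> (bit \<Rightarrow> 'g set) \<Rightarrow> (('r, 'g) lterm \<times> ('r, 'g) lterm) set
     \<Rightarrow> ('r, 'g) lterm \<Rightarrow> ('r, 'g) lterm set" where
  "lclass R G E t = {s. lcong R G E t s}"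

text \<open>The quotient of the set of terms by the congruence, with the induced operations.\<close>

definition presented_leibniz ::
  "('r, 'x) ring_scheme \<Rightarrow> (bit \<Rightarrow> 'g set) \<Rightarrow> (('r, 'g) lterm \<times> ('r, 'g) lterm) set
     \<Rightarrow> ('r, ('r, 'g) lterm set) supermodule" where
  "presented_leibniz R G E =
     \<lparr>carrier = lclass R G E ` lterms R G,
      monoid.mult = (\<lambda>A B. \<Union>s\<in>A. \<Union>t\<in>B. lclass R G E (Brk s t)),
      one = undefined,
      ring.zero = lclass R G E Zero,
      add = (\<lambda>A B. \<Union>s\<in>A. \<Union>t\<in>B. lclass R G E (Add s t)),
      smult = (\<lambda>r A. \<Union>t\<in>A. lclass R G E (Smul r t)),
      hpart = (\<lambda>p. lclass R G E ` {t. hom_lterm R G p t})\<rparr>"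


section \<open>The Steinberg Leibniz superalgebra\<close>

text \<open>The triple \<open>(i, j, a)\<close> stands for the generator \<open>F\<^sub>i\<^sub>j(a)\<close>.\<close>

definition stl_gens ::
  "nat \<Rightarrow> nat \<Rightarrow> ('r, 'd, 'z) superdialgebra_scheme \<Rightarrow> bit \<Rightarrow> (nat \<times> nat \<times> 'd) set" where
  "stl_gens m n D p =
     {(i, j, a). i \<in> {1..m+n} \<and> j \<in> {1..m+n} \<and> i \<noteq> j \<and>
                 a \<in> hpart D (idx_deg m i + idx_deg m j + p)}"

inductive_set stl_rels ::
  "('r, 'x) ring_scheme \<Rightarrow> nat \<Rightarrow> nat \<Rightarrow> ('r, 'd, 'z) superdialgebra_scheme
     \<Rightarrow> (('r, nat \<times> nat \<times> 'd) lterm \<times> ('r, nat \<times> nat \<times> 'd) lterm) set"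
  for R :: "('r, 'x) ring_scheme" and m n :: nat and D :: "('r, 'd, 'z) superdialgebra_scheme" where
  F_add: "\<lbrakk>(i, j, a) \<in> stl_gens m n D p; (i, j, b) \<in> stl_gens m n D p\<rbrakk> \<Longrightarrow>
    (Gen (i, j, a \<oplus>\<^bsub>D\<^esub> b), Add (Gen (i, j, a)) (Gen (i, j, b))) \<in> stl_rels R m n D"
| F_smul: "\<lbrakk>r \<in> carrier R; (i, j, a) \<in> stl_gens m n D p\<rbrakk> \<Longrightarrow>
    (Gen (i, j, r \<odot>\<^bsub>D\<^esub> a), Smul r (Gen (i, j, a))) \<in> stl_rels R m n D"
| F_left: "\<lbrakk>(i, j, a) \<in> stl_gens m n D p; (k, l, b) \<in> stl_gens m n D q; i \<noteq> l; j = k\<rbrakk> \<Longrightarrow>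
    (Brk (Gen (i, j, a)) (Gen (k, l, b)), Gen (i, l, a \<stileturn>\<^bsub>D\<^esub> b)) \<in> stl_rels R m n D"
| F_right: "\<lbrakk>(i, j, a) \<in> stl_gens m n D p; (k, l, b) \<in> stl_gens m n D q; i = l; j \<noteq> k\<rbrakk> \<Longrightarrow>
    (Brk (Gen (i, j, a)) (Gen (k, l, b)),
     Smul (\<ominus>\<^bsub>R\<^esub> sgn_of R (p * q)) (Gen (k, j, b \<turnstile>\<^bsub>D\<^esub> a))) \<in> stl_rels R m n D"
| F_zero: "\<lbrakk>(i, j, a) \<in> stl_gens m n D p; (k, l, b) \<in> stl_gens m n D q; i \<noteq> l; j \<noteq> k\<rbrakk> \<Longrightarrow>
    (Brk (Gen (i, j, a)) (Gen (k, l, b)), Zero) \<in> stl_rels R m n D"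

definition stl ::
  "('r, 'x) ring_scheme \<Rightarrow> nat \<Rightarrow> nat \<Rightarrow> ('r, 'd, 'z) superdialgebra_scheme
     \<Rightarrow> ('r, ('r, nat \<times> nat \<times> 'd) lterm set) supermodule" where
  "stl R m n D = presented_leibniz R (stl_gens m n D) (stl_rels R m n D)"

definition stl_F ::
  "('r, 'x) ring_scheme \<Rightarrow> nat \<Rightarrow> nat \<Rightarrow> ('r, 'd, 'z) superdialgebra_scheme
     \<Rightarrow> nat \<Rightarrow> nat \<Rightarrow> 'd \<Rightarrow> ('r, nat \<times> nat \<times> 'd) lterm set" where
  "stl_F R m n D i j a = lclass R (stl_gens m n D) (stl_rels R m n D) (Gen (i, j, a))"

definition canonical_hom ::
  "('r, 'x) ring_scheme \<Rightarrow> nat \<Rightarrow> nat \<Rightarrow> ('r, 'd, 'z) superdialgebra_scheme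
     \<Rightarrow> (('r, nat \<times> nat \<times> 'd) lterm set \<Rightarrow> nat \<Rightarrow> nat \<Rightarrow> 'd) \<Rightarrow> bool" where
  "canonical_hom R m n D \<phi> \<longleftrightarrow>
     \<phi> \<in> leibniz_hom R (stl R m n D) (sl R m n D) \<and>
     (\<forall>i \<in> {1..m+n}. \<forall>j \<in> {1..m+n}. \<forall>a \<in> hpart D 0 \<union> hpart D 1.
        i \<noteq> j \<longrightarrow> \<phi> (stl_F R m n D i j a) = mat_unit D i j a)"

end

theory Submission
  imports Defs
begin

text \<open>
  \<^bold>\<open>The map is a central extension.\<close>  The superalgebra \<open>stl(m,n,D)\<close> with \<open>m + n \<ge> 3\<close> is the sum of the
  root spaces \<open>F\<^sub>i\<^sub>j(D)\<close> and of a part \<open>H\<close> of weight zero: by the Leibniz identity every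
  element is a combination of iterated right multiplications by generators, and the relations
  keep such products inside \<open>H + \<Sum> F\<^sub>i\<^sub>j(D)\<close> as soon as the brackets \<open>[F\<^sub>i\<^sub>j(a), F\<^sub>j\<^sub>i(b)]\<close> preserve each root
  space (\<open>opposite_bracket_in_H\<close>, \<open>minus_proj_in_H\<close>).  On each root space the canonical map \<open>\<phi>\<close> is
  injective.  An element of its kernel thus lies in \<open>H\<close>, so it brackets \<open>F\<^sub>i\<^sub>j(a)\<close> into a root space on which \<open>\<phi>\<close> is
  injective, while the image under \<open>\<phi>\<close> is zero; hence it annihilates all generators and is central
  (\<open>kernel_central\<close>).  The image of \<open>\<phi>\<close> contains all brackets of matrices because
  \<open>[E\<^sub>j\<^sub>i(a), E\<^sub>i\<^sub>j(b)]\<close> and \<open>[E\<^sub>j\<^sub>i(a \<stileturn> b), E\<^sub>i\<^sub>j(1)]\<close> differ by \<open>[E\<^sub>i\<^sub>i(a), E\<^sub>i\<^sub>i(b)]\<close> up to sign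
  (\<open>diagonal_in_N\<close>).

  \<^bold>\<open>It is universal.\<close>  Let \<open>\<psi>: M \<rightarrow> sl(2,1,D)\<close> be a central extension.  Brackets in \<open>M\<close> depend only on
  the images of their arguments (\<open>bracket_cong\<close>), which gives uniqueness at once, since every
  generator is a bracket \<open>F\<^sub>i\<^sub>j(a) = [F\<^sub>i\<^sub>k(a), F\<^sub>k\<^sub>j(1)]\<close>.  For existence, the even elements
  \<open>U\<^sub>k = E\<^sub>k\<^sub>k(1) + E\<^sub>3\<^sub>3(1) = [E\<^sub>k\<^sub>3(1), E\<^sub>3\<^sub>k(1)]\<close>, \<open>k = 1, 2\<close>, act from the right on \<open>E\<^sub>i\<^sub>j(a)\<close> by scalars in \<open>{0, 1, -1}\<close>, the bar-unit
  laws being exactly what makes right actions diagonal.  Right bracketing with a lift of \<open>U\<^sub>k\<close> is a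
  derivation of \<open>M\<close>, so the bracket \<open>z\<close> in \<open>M\<close> of lifts of \<open>E\<^sub>i\<^sub>j(a)\<close> and \<open>E\<^sub>k\<^sub>l(b)\<close> is again a weight vector, even if it lies in the
  kernel of \<open>\<psi>\<close> (\<open>bracket_weight\<close>).  If its weight is \<open>1\<close> or \<open>-1\<close>, then up to sign \<open>z\<close> is the bracket of
  itself with the lift of \<open>U\<^sub>k\<close>, and that is determined by \<open>\<psi> z\<close> (\<open>bracket_recover\<close>).  This
  gives canonical lifts of the \<open>E\<^sub>i\<^sub>j(a)\<close>, and all Steinberg relations between them hold in \<open>M\<close> because they hold in
  \<open>sl\<close>: for \<open>m = 2\<close>, \<open>n = 1\<close> each sum of two roots that is nonzero and not twice a root takes the value \<open>1\<close> or \<open>-1\<close> on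
  \<open>U\<^sub>1\<close> or \<open>U\<^sub>2\<close> (\<open>wt_sum_square\<close>).  The remaining relation \<open>[F\<^sub>i\<^sub>j(a), F\<^sub>i\<^sub>j(b)] = 0\<close> follows by
  writing the second factor as a bracket (\<open>gen_lift_same\<close>).

  \<^bold>\<open>The presentation.\<close>  Terms modulo a congruence form a Leibniz superalgebra only if even and odd
  parts meet in zero, which is not visible from the congruence.  It follows by projecting terms to
  their formal components, a map that respects the congruence (\<open>part_cong\<close>).
\<close>

section \<open>Homogeneous components and signs\<close>

text \<open>Degrees are computed with as elements of a ring; the default rules would turn sums and products
  into bitwise operations.\<close>

declare add_bit_eq_xor [simp del] mult_bit_eq_and [simp del]

lemma bit_add_self [simp]: "p + p = (0 :: bit)"
  by (cases p) simp_all

lemma bit_add_self_left [simp]: "p + (p + q) = (q :: bit)"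
  by (simp flip: add.assoc)

lemma UNIV_bit: "(UNIV :: bit set) = {0, 1}"
  by (auto intro: bit.exhaust)

context cring
begin

lemma sgn_of_closed [simp]: "sgn_of R p \<in> carrier R"
  by (simp add: sgn_of_def)

lemma sgn_of_0 [simp]: "sgn_of R 0 = \<one>"
  and sgn_of_1 [simp]: "sgn_of R 1 = \<ominus> \<one>"
  by (simp_all add: sgn_of_def)

end

lemma (in abelian_group) a_inv_zero [simp]: "\<ominus> \<zero> = \<zero>"
  by (rule add.inv_equality) simp_all

text \<open>These rules make the normaliser for rings available in the additive group of a module.\<close>

lemmas (in abelian_group) abelian_group_simprules
  [algebra abelian_group "zero G" "add G" "a_inv G" "a_minus G"] =
  a_closed zero_closed a_inv_closed minus_closed
  a_assoc l_zero l_neg a_comm minus_eq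
  r_zero r_neg r_neg2 r_neg1 minus_add minus_minus a_inv_zero a_lcomm

lemma (in abelian_group) diff_diff_cancel:
  assumes "x \<in> carrier G" "y \<in> carrier G" "z \<in> carrier G"
  shows "(x \<ominus> y) \<ominus> (x \<ominus> z) = z \<ominus> y"
proof -
  have "(x \<ominus> y) \<ominus> (x \<ominus> z) = (x \<oplus> \<ominus> x) \<oplus> (z \<ominus> y)"
    using assms by (simp add: minus_eq minus_add a_ac)
  then show ?thesis using assms by (simp add: r_neg)
qed

lemma supermoduleI:
  fixes M :: "('r, 'a, 'z) supermodule_scheme"
  assumes "module R M"
    and "\<And>p. submodule (hpart M p) R M"
    and "\<And>x. x \<in> carrier M \<Longrightarrow> \<exists>y \<in> hpart M 0. \<exists>z \<in> hpart M 1. x = y \<oplus>\<^bsub>M\<^esub> z"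
    and "\<And>x. \<lbrakk>x \<in> hpart M 0; x \<in> hpart M 1\<rbrakk> \<Longrightarrow> x = \<zero>\<^bsub>M\<^esub>"
  shows "supermodule R M"
proof -
  interpret module R M by fact
  have *: "\<And>p x. x \<in> hpart M p \<Longrightarrow> x \<in> carrier M" "\<And>p. \<zero>\<^bsub>M\<^esub> \<in> hpart M p"
    using submoduleE(1)[OF assms(2)] subgroup.one_closed[OF submodule.axioms(1)[OF assms(2)]]
    by auto
  show ?thesis
  proof (intro supermodule.intro supermodule_axioms.intro module_axioms assms(2))
    show "carrier M = hpart M 0 <+>\<^bsub>M\<^esub> hpart M 1"
      using assms(3) * by (auto simp: set_add_def' intro!: M.a_closed)
    show "hpart M 0 \<inter> hpart M 1 = {\<zero>\<^bsub>M\<^esub>}"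
      using assms(4) * by auto
  qed
qed

context supermodule
begin

lemma hpart_closed: "x \<in> hpart M p \<Longrightarrow> x \<in> carrier M"
  using submoduleE(1)[OF hpart_submodule] by auto

lemma hpart_zero [simp]: "\<zero>\<^bsub>M\<^esub> \<in> hpart M p"
  using subgroup.one_closed[OF submodule.axioms(1)[OF hpart_submodule]] by simp

lemma hpart_add: "\<lbrakk>x \<in> hpart M p; y \<in> hpart M p\<rbrakk> \<Longrightarrow> x \<oplus>\<^bsub>M\<^esub> y \<in> hpart M p"
  by (rule submoduleE(5)[OF hpart_submodule])

lemma hpart_inv: "x \<in> hpart M p \<Longrightarrow> \<ominus>\<^bsub>M\<^esub> x \<in> hpart M p"
  by (rule submoduleE(6)[OF hpart_submodule])

lemma hpart_minus: "\<lbrakk>x \<in> hpart M p; y \<in> hpart M p\<rbrakk> \<Longrightarrow> x \<ominus>\<^bsub>M\<^esub> y \<in> hpart M p"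
  by (simp add: a_minus_def hpart_add hpart_inv)

lemma hpart_smult: "\<lbrakk>r \<in> carrier R; x \<in> hpart M p\<rbrakk> \<Longrightarrow> r \<odot>\<^bsub>M\<^esub> x \<in> hpart M p"
  by (rule submoduleE(4)[OF hpart_submodule])

lemma hpart_decomp:
  assumes "x \<in> carrier M"
  obtains y z where "y \<in> hpart M p" "z \<in> hpart M (p + 1)" "x = y \<oplus>\<^bsub>M\<^esub> z"
proof -
  from assms obtain u v where uv: "u \<in> hpart M 0" "v \<in> hpart M 1" "x = u \<oplus>\<^bsub>M\<^esub> v"
    unfolding hpart_sum by (auto simp: set_add_def')
  show thesis
  proof (cases p rule: bit.exhaust[case_names zero one])
    case zero
    then show ?thesis using that[of u v] uv by simp
  next
    case one
    then show ?thesis using that[of v u] uv by (simp add: M.a_comm hpart_closed)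
  qed
qed

lemma hpart_disjoint:
  assumes "x \<in> hpart M p" "x \<in> hpart M q" "p \<noteq> q"
  shows "x = \<zero>\<^bsub>M\<^esub>"
proof -
  have "x \<in> hpart M 0 \<inter> hpart M 1"
    using assms by (cases p; cases q) auto
  then show ?thesis unfolding hpart_inter by simp
qed

lemma hcomp_eqI:
  assumes "y \<in> hpart M p" "z \<in> hpart M (p + 1)"
  shows "hcomp M p (y \<oplus>\<^bsub>M\<^esub> z) = y"
  unfolding hcomp_def
proof (rule the_equality)
  show "y \<in> hpart M p \<and> (\<exists>w \<in> hpart M (p + 1). y \<oplus>\<^bsub>M\<^esub> z = y \<oplus>\<^bsub>M\<^esub> w)"
    using assms by auto
next
  fix y' assume "y' \<in> hpart M p \<and> (\<exists>w \<in> hpart M (p + 1). y \<oplus>\<^bsub>M\<^esub> z = y' \<oplus>\<^bsub>M\<^esub> w)"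
  then obtain w where y': "y' \<in> hpart M p" and w: "w \<in> hpart M (p + 1)"
    and e: "y \<oplus>\<^bsub>M\<^esub> z = y' \<oplus>\<^bsub>M\<^esub> w" by auto
  note cl = assms[THEN hpart_closed] y'[THEN hpart_closed] w[THEN hpart_closed]
  have eq: "y \<ominus>\<^bsub>M\<^esub> y' = w \<ominus>\<^bsub>M\<^esub> z"
  proof -
    have "y \<ominus>\<^bsub>M\<^esub> y' = (y \<oplus>\<^bsub>M\<^esub> z) \<ominus>\<^bsub>M\<^esub> (y' \<oplus>\<^bsub>M\<^esub> z)"
      using cl by algebra
    also have "\<dots> = (y' \<oplus>\<^bsub>M\<^esub> w) \<ominus>\<^bsub>M\<^esub> (y' \<oplus>\<^bsub>M\<^esub> z)" unfolding e ..
    also have "\<dots> = w \<ominus>\<^bsub>M\<^esub> z"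
      using cl by algebra
    finally show ?thesis .
  qed
  have "y \<ominus>\<^bsub>M\<^esub> y' \<in> hpart M p" using assms y' by (simp add: hpart_minus)
  moreover have "y \<ominus>\<^bsub>M\<^esub> y' \<in> hpart M (p + 1)" unfolding eq using assms w by (simp add: hpart_minus)
  ultimately have "y \<ominus>\<^bsub>M\<^esub> y' = \<zero>\<^bsub>M\<^esub>" by (rule hpart_disjoint) (cases p; simp)
  then show "y' = y" using cl by (metis M.add.inv_closed M.minus_equality M.minus_eq M.minus_minus)
qed

lemma hcomp_hpart: "x \<in> hpart M q \<Longrightarrow> hcomp M p x = (if p = q then x else \<zero>\<^bsub>M\<^esub>)"
  using hcomp_eqI[of x p "\<zero>\<^bsub>M\<^esub>"] hcomp_eqI[of "\<zero>\<^bsub>M\<^esub>" p x]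
  by (cases p; cases q) (simp_all add: hpart_closed)

lemma hcomp_in [simp, intro]: "x \<in> carrier M \<Longrightarrow> hcomp M p x \<in> hpart M p"
  by (metis hcomp_eqI hpart_decomp)

lemma hcomp_closed [simp]: "x \<in> carrier M \<Longrightarrow> hcomp M p x \<in> carrier M"
  by (rule hpart_closed) (rule hcomp_in)

lemma hcomp_sum: "x \<in> carrier M \<Longrightarrow> hcomp M 0 x \<oplus>\<^bsub>M\<^esub> hcomp M 1 x = x"
proof -
  assume x: "x \<in> carrier M"
  obtain y z where yz: "y \<in> hpart M 0" "z \<in> hpart M 1" "x = y \<oplus>\<^bsub>M\<^esub> z"
    using hpart_decomp[OF x, of 0] by auto
  have "hcomp M 0 x = y" using yz hcomp_eqI[of y 0 z] by simp
  moreover have "hcomp M 1 x = z"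
    using yz hcomp_eqI[of z 1 y] by (simp add: M.a_comm hpart_closed)
  ultimately show ?thesis using yz by simp
qed

lemma hcomp_add:
  assumes "x \<in> carrier M" "y \<in> carrier M"
  shows "hcomp M p (x \<oplus>\<^bsub>M\<^esub> y) = hcomp M p x \<oplus>\<^bsub>M\<^esub> hcomp M p y"
proof -
  obtain x1 x2 where x: "x1 \<in> hpart M p" "x2 \<in> hpart M (p + 1)" "x = x1 \<oplus>\<^bsub>M\<^esub> x2"
    using assms hpart_decomp by metis
  obtain y1 y2 where y: "y1 \<in> hpart M p" "y2 \<in> hpart M (p + 1)" "y = y1 \<oplus>\<^bsub>M\<^esub> y2"
    using assms hpart_decomp by metis
  have "x \<oplus>\<^bsub>M\<^esub> y = (x1 \<oplus>\<^bsub>M\<^esub> y1) \<oplus>\<^bsub>M\<^esub> (x2 \<oplus>\<^bsub>M\<^esub> y2)"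
    using x y by (simp add: M.a_ac hpart_closed)
  then show ?thesis using x y by (simp add: hcomp_eqI hpart_add)
qed

lemma hcomp_smult:
  assumes "r \<in> carrier R" "x \<in> carrier M"
  shows "hcomp M p (r \<odot>\<^bsub>M\<^esub> x) = r \<odot>\<^bsub>M\<^esub> hcomp M p x"
proof -
  obtain x1 x2 where x: "x1 \<in> hpart M p" "x2 \<in> hpart M (p + 1)" "x = x1 \<oplus>\<^bsub>M\<^esub> x2"
    using assms hpart_decomp by metis
  have "r \<odot>\<^bsub>M\<^esub> x = r \<odot>\<^bsub>M\<^esub> x1 \<oplus>\<^bsub>M\<^esub> r \<odot>\<^bsub>M\<^esub> x2"
    using x assms by (simp add: smult_r_distr hpart_closed)
  then show ?thesis using x assms by (simp add: hcomp_eqI hpart_smult)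
qed

lemma homogeneous_induct [consumes 1, case_names hom add]:
  assumes "x \<in> carrier M"
    and "\<And>p x. x \<in> hpart M p \<Longrightarrow> P x"
    and "\<And>x y. \<lbrakk>x \<in> carrier M; y \<in> carrier M; P x; P y\<rbrakk> \<Longrightarrow> P (x \<oplus>\<^bsub>M\<^esub> y)"
  shows "P x"
proof -
  have "P (hcomp M 0 x \<oplus>\<^bsub>M\<^esub> hcomp M 1 x)"
    using assms(1) by (intro assms(3) assms(2)[OF hcomp_in] hcomp_closed)
  then show ?thesis by (simp add: hcomp_sum assms(1))
qed

lemma smult_neg_one: "x \<in> carrier M \<Longrightarrow> (\<ominus> \<one>) \<odot>\<^bsub>M\<^esub> x = \<ominus>\<^bsub>M\<^esub> x"
  by (simp add: smult_l_minus)

text \<open>A subset closed under addition and scalars is a submodule, because \<open>- x = (-1) x\<close>.\<close>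

lemma submoduleI':
  assumes "H \<subseteq> carrier M" "\<zero>\<^bsub>M\<^esub> \<in> H"
    and "\<And>a b. \<lbrakk>a \<in> H; b \<in> H\<rbrakk> \<Longrightarrow> a \<oplus>\<^bsub>M\<^esub> b \<in> H"
    and "\<And>a x. \<lbrakk>a \<in> carrier R; x \<in> H\<rbrakk> \<Longrightarrow> a \<odot>\<^bsub>M\<^esub> x \<in> H"
  shows "submodule H R M"
  using assms assms(4)[of "\<ominus> \<one>"] by (intro submoduleI) (auto simp: smult_neg_one subset_iff)

end

section \<open>Even bilinear products\<close>

lemma even_bilinearI:
  assumes "\<And>x y. \<lbrakk>x \<in> carrier M; y \<in> carrier M\<rbrakk> \<Longrightarrow> f x y \<in> carrier M"
    and "\<And>x y z. \<lbrakk>x \<in> carrier M; y \<in> carrier M; z \<in> carrier M\<rbrakk> \<Longrightarrow> f (x \<oplus>\<^bsub>M\<^esub> y) z = f x z \<oplus>\<^bsub>M\<^esub> f y z"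
    and "\<And>x y z. \<lbrakk>x \<in> carrier M; y \<in> carrier M; z \<in> carrier M\<rbrakk> \<Longrightarrow> f z (x \<oplus>\<^bsub>M\<^esub> y) = f z x \<oplus>\<^bsub>M\<^esub> f z y"
    and "\<And>r x y. \<lbrakk>r \<in> carrier R; x \<in> carrier M; y \<in> carrier M\<rbrakk> \<Longrightarrow> f (r \<odot>\<^bsub>M\<^esub> x) y = r \<odot>\<^bsub>M\<^esub> f x y"
    and "\<And>r x y. \<lbrakk>r \<in> carrier R; x \<in> carrier M; y \<in> carrier M\<rbrakk> \<Longrightarrow> f x (r \<odot>\<^bsub>M\<^esub> y) = r \<odot>\<^bsub>M\<^esub> f x y"
    and "\<And>p q x y. \<lbrakk>x \<in> hpart M p; y \<in> hpart M q\<rbrakk> \<Longrightarrow> f x y \<in> hpart M (p + q)"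
  shows "even_bilinear R M f"
  using assms unfolding even_bilinear_def by simp

locale even_bilinear_map = supermodule R M
  for R (structure) and M :: "('r, 'a, 'z) supermodule_scheme" (structure) +
  fixes f :: "'a \<Rightarrow> 'a \<Rightarrow> 'a"
  assumes bilinear: "even_bilinear R M f"
begin

lemma closed [simp, intro]: "\<lbrakk>x \<in> carrier M; y \<in> carrier M\<rbrakk> \<Longrightarrow> f x y \<in> carrier M"
  and add_l: "\<lbrakk>x \<in> carrier M; y \<in> carrier M; z \<in> carrier M\<rbrakk> \<Longrightarrow> f (x \<oplus>\<^bsub>M\<^esub> y) z = f x z \<oplus>\<^bsub>M\<^esub> f y z"
  and add_r: "\<lbrakk>x \<in> carrier M; y \<in> carrier M; z \<in> carrier M\<rbrakk> \<Longrightarrow> f z (x \<oplus>\<^bsub>M\<^esub> y) = f z x \<oplus>\<^bsub>M\<^esub> f z y"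
  and smult_l: "\<lbrakk>r \<in> carrier R; x \<in> carrier M; y \<in> carrier M\<rbrakk> \<Longrightarrow> f (r \<odot>\<^bsub>M\<^esub> x) y = r \<odot>\<^bsub>M\<^esub> f x y"
  and smult_r: "\<lbrakk>r \<in> carrier R; x \<in> carrier M; y \<in> carrier M\<rbrakk> \<Longrightarrow> f x (r \<odot>\<^bsub>M\<^esub> y) = r \<odot>\<^bsub>M\<^esub> f x y"
  and hpart: "\<lbrakk>x \<in> hpart M p; y \<in> hpart M q\<rbrakk> \<Longrightarrow> f x y \<in> hpart M (p + q)"
  using bilinear unfolding even_bilinear_def by blast+

lemma zero_l [simp]: "y \<in> carrier M \<Longrightarrow> f \<zero>\<^bsub>M\<^esub> y = \<zero>\<^bsub>M\<^esub>"
  using smult_l[of \<zero> "\<zero>\<^bsub>M\<^esub>" y] by simp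

lemma zero_r [simp]: "y \<in> carrier M \<Longrightarrow> f y \<zero>\<^bsub>M\<^esub> = \<zero>\<^bsub>M\<^esub>"
  using smult_r[of \<zero> y "\<zero>\<^bsub>M\<^esub>"] by simp

lemma inv_l: "\<lbrakk>x \<in> carrier M; y \<in> carrier M\<rbrakk> \<Longrightarrow> f (\<ominus>\<^bsub>M\<^esub> x) y = \<ominus>\<^bsub>M\<^esub> f x y"
  using smult_l[of "\<ominus> \<one>" x y] by (simp add: smult_neg_one)

lemma inv_r: "\<lbrakk>x \<in> carrier M; y \<in> carrier M\<rbrakk> \<Longrightarrow> f x (\<ominus>\<^bsub>M\<^esub> y) = \<ominus>\<^bsub>M\<^esub> f x y"
  using smult_r[of "\<ominus> \<one>" x y] by (simp add: smult_neg_one)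

lemma minus_l: "\<lbrakk>x \<in> carrier M; y \<in> carrier M; z \<in> carrier M\<rbrakk> \<Longrightarrow> f (x \<ominus>\<^bsub>M\<^esub> y) z = f x z \<ominus>\<^bsub>M\<^esub> f y z"
  by (simp add: M.minus_eq add_l inv_l)

lemma minus_r: "\<lbrakk>x \<in> carrier M; y \<in> carrier M; z \<in> carrier M\<rbrakk> \<Longrightarrow> f z (x \<ominus>\<^bsub>M\<^esub> y) = f z x \<ominus>\<^bsub>M\<^esub> f z y"
  by (simp add: M.minus_eq add_r inv_r)

lemma finsum_l:
  assumes "finite I" "\<And>i. i \<in> I \<Longrightarrow> g i \<in> carrier M" "y \<in> carrier M"
  shows "f (\<Oplus>\<^bsub>M\<^esub>i\<in>I. g i) y = (\<Oplus>\<^bsub>M\<^esub>i\<in>I. f (g i) y)"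
  using assms by (induction I rule: finite_induct) (simp_all add: M.finsum_insert M.finsum_empty M.finsum_closed Pi_def add_l)

lemma finsum_r:
  assumes "finite I" "\<And>i. i \<in> I \<Longrightarrow> g i \<in> carrier M" "y \<in> carrier M"
  shows "f y (\<Oplus>\<^bsub>M\<^esub>i\<in>I. g i) = (\<Oplus>\<^bsub>M\<^esub>i\<in>I. f y (g i))"
  using assms by (induction I rule: finite_induct) (simp_all add: M.finsum_insert M.finsum_empty M.finsum_closed Pi_def add_r)

end

sublocale superdialgebra \<subseteq> l: even_bilinear_map R D "lprod D"
  by unfold_locales (rule lprod_bilinear)

sublocale superdialgebra \<subseteq> r: even_bilinear_map R D "rprod D"
  by unfold_locales (rule rprod_bilinear)

sublocale leibniz_superalgebra \<subseteq> brk: even_bilinear_map R L "bracket L"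
  by unfold_locales (rule bracket_bilinear)

section \<open>The Leibniz superalgebra of a superdialgebra\<close>

context superdialgebra
begin

text \<open>The summand of the super commutator for arguments of degrees \<open>p\<close> and \<open>q\<close>; as a formula in all elements it
  is bilinear.\<close>

definition scomm :: "bit \<Rightarrow> bit \<Rightarrow> 'a \<Rightarrow> 'a \<Rightarrow> 'a" where
  "scomm p q x y = x \<stileturn>\<^bsub>D\<^esub> y \<ominus>\<^bsub>D\<^esub> sgn_of R (p * q) \<odot>\<^bsub>D\<^esub> (y \<turnstile>\<^bsub>D\<^esub> x)"

lemma scomm_closed [simp]: "\<lbrakk>x \<in> carrier D; y \<in> carrier D\<rbrakk> \<Longrightarrow> scomm p q x y \<in> carrier D"
  by (simp add: scomm_def)

lemma scomm_hpart: "\<lbrakk>x \<in> hpart D p; y \<in> hpart D q\<rbrakk> \<Longrightarrow> scomm p q x y \<in> hpart D (p + q)"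
  unfolding scomm_def
  by (intro hpart_minus hpart_smult l.hpart) (auto simp: add.commute[of p q] intro: r.hpart)

lemma scomm_add_l:
  assumes "x \<in> carrier D" "x' \<in> carrier D" "y \<in> carrier D"
  shows "scomm p q (x \<oplus>\<^bsub>D\<^esub> x') y = scomm p q x y \<oplus>\<^bsub>D\<^esub> scomm p q x' y"
  using assms by (simp add: scomm_def l.add_l r.add_r smult_r_distr M.minus_eq M.minus_add M.a_ac)

lemma scomm_add_r:
  assumes "x \<in> carrier D" "x' \<in> carrier D" "y \<in> carrier D"
  shows "scomm p q y (x \<oplus>\<^bsub>D\<^esub> x') = scomm p q y x \<oplus>\<^bsub>D\<^esub> scomm p q y x'"
  using assms by (simp add: scomm_def l.add_r r.add_l smult_r_distr M.minus_eq M.minus_add M.a_ac)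

lemma smult_commute:
  "\<lbrakk>r \<in> carrier R; s \<in> carrier R; x \<in> carrier D\<rbrakk> \<Longrightarrow> r \<odot>\<^bsub>D\<^esub> (s \<odot>\<^bsub>D\<^esub> x) = s \<odot>\<^bsub>D\<^esub> (r \<odot>\<^bsub>D\<^esub> x)"
  by (metis R.m_comm smult_assoc1)

lemma scomm_smult_l:
  assumes "r \<in> carrier R" "x \<in> carrier D" "y \<in> carrier D"
  shows "scomm p q (r \<odot>\<^bsub>D\<^esub> x) y = r \<odot>\<^bsub>D\<^esub> scomm p q x y"
  using assms
  by (simp add: scomm_def l.smult_l r.smult_r smult_r_distr M.minus_eq smult_r_minus smult_commute)

lemma scomm_smult_r:
  assumes "r \<in> carrier R" "x \<in> carrier D" "y \<in> carrier D"
  shows "scomm p q y (r \<odot>\<^bsub>D\<^esub> x) = r \<odot>\<^bsub>D\<^esub> scomm p q y x"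
  using assms
  by (simp add: scomm_def l.smult_r r.smult_l smult_r_distr M.minus_eq smult_r_minus smult_commute)

lemma scomm_zero [simp]:
  "x \<in> carrier D \<Longrightarrow> scomm p q \<zero>\<^bsub>D\<^esub> x = \<zero>\<^bsub>D\<^esub>" "x \<in> carrier D \<Longrightarrow> scomm p q x \<zero>\<^bsub>D\<^esub> = \<zero>\<^bsub>D\<^esub>"
  by (simp_all add: scomm_def M.minus_eq)

lemma super_commutator_expand:
  assumes "x \<in> carrier D" "y \<in> carrier D"
  shows "super_commutator R D x y =
    scomm 0 0 (hcomp D 0 x) (hcomp D 0 y) \<oplus>\<^bsub>D\<^esub> scomm 0 1 (hcomp D 0 x) (hcomp D 1 y) \<oplus>\<^bsub>D\<^esub>
    (scomm 1 0 (hcomp D 1 x) (hcomp D 0 y) \<oplus>\<^bsub>D\<^esub> scomm 1 1 (hcomp D 1 x) (hcomp D 1 y))"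
  using assms
  by (simp add: super_commutator_def flip: scomm_def)
     (simp add: UNIV_bit M.finsum_insert M.finsum_empty Pi_def M.a_ac)

lemma super_commutator_homogeneous:
  assumes "x \<in> hpart D p" "y \<in> hpart D q"
  shows "super_commutator R D x y = scomm p q x y"
  using assms
  by (cases p; cases q; simp add: super_commutator_expand hpart_closed hcomp_hpart[OF assms(1)] hcomp_hpart[OF assms(2)])

lemma super_commutator_closed:
  "\<lbrakk>x \<in> carrier D; y \<in> carrier D\<rbrakk> \<Longrightarrow> super_commutator R D x y \<in> carrier D"
  by (simp add: super_commutator_expand)

lemma super_commutator_bilinear: "even_bilinear R D (super_commutator R D)"
proof (rule even_bilinearI)
  fix x y z assume xyz: "x \<in> carrier D" "y \<in> carrier D" "z \<in> carrier D"
  have c: "\<And>p u. u \<in> {x, y, z} \<Longrightarrow> hcomp D p u \<in> carrier D" using xyz by auto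
  have s: "\<And>p q p' q' u v. \<lbrakk>u \<in> {x, y, z}; v \<in> {x, y, z}\<rbrakk> \<Longrightarrow> scomm p q (hcomp D p' u) (hcomp D q' v) \<in> carrier D"
    using c by auto
  show "super_commutator R D (x \<oplus>\<^bsub>D\<^esub> y) z = super_commutator R D x z \<oplus>\<^bsub>D\<^esub> super_commutator R D y z"
    using xyz c s by (simp add: super_commutator_expand hcomp_add scomm_add_l) (simp add: M.a_ac)
  show "super_commutator R D z (x \<oplus>\<^bsub>D\<^esub> y) = super_commutator R D z x \<oplus>\<^bsub>D\<^esub> super_commutator R D z y"
    using xyz c s by (simp add: super_commutator_expand hcomp_add scomm_add_r) (simp add: M.a_ac)
next
  fix p q x y assume "x \<in> hpart D p" "y \<in> hpart D q"
  then show "super_commutator R D x y \<in> hpart D (p + q)"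
    by (simp add: super_commutator_homogeneous scomm_hpart)
qed (simp_all add: super_commutator_closed super_commutator_expand hcomp_smult
      scomm_smult_l scomm_smult_r smult_r_distr)

text \<open>
  On homogeneous elements the Leibniz identity expands into products of three factors; the five
  dialgebra axioms bring each of them into one of the forms \<open>a \<stileturn> (b \<stileturn> c)\<close>, \<open>a \<turnstile> (b \<stileturn> c)\<close> and
  \<open>a \<turnstile> (b \<turnstile> c)\<close>, and the rest is a check of signs.
\<close>

lemma scomm_leibniz:
  assumes "x \<in> carrier D" "y \<in> carrier D" "z \<in> carrier D"
  shows "scomm s (p + q) x (scomm p q y z) =
     scomm (s + p) q (scomm s p x y) z \<ominus>\<^bsub>D\<^esub> sgn_of R (p * q) \<odot>\<^bsub>D\<^esub> scomm (s + q) p (scomm s q x z) y"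
proof -
  have forms: "a \<stileturn>\<^bsub>D\<^esub> (b \<stileturn>\<^bsub>D\<^esub> c) \<in> carrier D \<and> a \<turnstile>\<^bsub>D\<^esub> (b \<stileturn>\<^bsub>D\<^esub> c) \<in> carrier D \<and>
      a \<turnstile>\<^bsub>D\<^esub> (b \<turnstile>\<^bsub>D\<^esub> c) \<in> carrier D"
    if "a \<in> carrier D" "b \<in> carrier D" "c \<in> carrier D" for a b c
    using that by auto
  note forms' = forms[OF assms] forms[OF assms(1,3,2)] forms[OF assms(2,1,3)]
    forms[OF assms(2,3,1)] forms[OF assms(3,1,2)] forms[OF assms(3,2,1)]
  note [simp] = assms l.minus_l l.minus_r r.minus_l r.minus_r lprod_assoc rprod_assoc
      lprod_bar[symmetric] inner_assoc rprod_bar smult_neg_one l.inv_l l.inv_r r.inv_l r.inv_r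
  show ?thesis
    unfolding scomm_def
    by (cases s; cases p; cases q; simp; insert forms'; algebra)
qed

lemma super_commutator_leibniz:
  assumes "x \<in> carrier D" "y \<in> hpart D p" "z \<in> hpart D q"
  shows "super_commutator R D x (super_commutator R D y z) =
     super_commutator R D (super_commutator R D x y) z
       \<ominus>\<^bsub>D\<^esub> sgn_of R (p * q) \<odot>\<^bsub>D\<^esub> super_commutator R D (super_commutator R D x z) y"
proof -
  interpret c: even_bilinear_map R D "super_commutator R D"
    by unfold_locales (rule super_commutator_bilinear)
  have yz: "y \<in> carrier D" "z \<in> carrier D" using assms hpart_closed by auto
  from assms(1) show ?thesis
  proof (induction rule: homogeneous_induct)
    case (hom s x)
    then show ?case
      using scomm_leibniz[of x y z s p q] assms yz
        super_commutator_homogeneous[OF hom scomm_hpart[OF assms(2,3)]]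
        super_commutator_homogeneous[OF scomm_hpart[OF hom assms(2)] assms(3)]
        super_commutator_homogeneous[OF scomm_hpart[OF hom assms(3)] assms(2)]
      by (simp add: super_commutator_homogeneous[OF hom assms(2)] super_commutator_homogeneous[OF hom assms(3)]
          super_commutator_homogeneous[OF assms(2,3)] hpart_closed[OF hom])
  next
    case (add u v)
    then show ?case using yz
      by (simp add: c.add_l smult_r_distr M.minus_eq M.minus_add M.a_ac)
  qed
qed

lemma leibniz_of_leibniz_superalgebra: "leibniz_superalgebra R (leibniz_of R D)"
proof -
  have "abelian_group (leibniz_of R D)"
    using M.a_inv_closed M.l_neg by (intro abelian_groupI) (auto simp: leibniz_of_def M.a_ac)
  then have mod: "module R (leibniz_of R D)"
    by (intro moduleI R.is_cring)
       (simp_all add: leibniz_of_def smult_l_distr smult_r_distr smult_assoc1)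
  interpret L: module R "leibniz_of R D" by (rule mod)
  have inv: "\<ominus>\<^bsub>leibniz_of R D\<^esub> x = \<ominus>\<^bsub>D\<^esub> x" if "x \<in> carrier D" for x
    using that by (intro L.minus_equality) (simp_all add: leibniz_of_def M.l_neg)
  have "supermodule R (leibniz_of R D)"
  proof (intro supermoduleI mod)
    fix p show "submodule (hpart (leibniz_of R D) p) R (leibniz_of R D)"
      by (intro L.submoduleI)
        (auto simp: leibniz_of_def hpart_closed hpart_add hpart_smult hpart_inv inv[unfolded leibniz_of_def])
  next
    fix x assume "x \<in> carrier (leibniz_of R D)"
    then show "\<exists>y\<in>hpart (leibniz_of R D) 0. \<exists>z\<in>hpart (leibniz_of R D) 1. x = y \<oplus>\<^bsub>leibniz_of R D\<^esub> z"
      by (intro bexI[of _ "hcomp D 0 x"] bexI[of _ "hcomp D 1 x"]) (auto simp: leibniz_of_def hcomp_sum)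
  next
    fix x assume "x \<in> hpart (leibniz_of R D) 0" "x \<in> hpart (leibniz_of R D) 1"
    then show "x = \<zero>\<^bsub>leibniz_of R D\<^esub>"
      using hpart_disjoint[of x 0 1] by (simp add: leibniz_of_def)
  qed
  moreover have "even_bilinear R (leibniz_of R D) (bracket (leibniz_of R D))"
    using super_commutator_bilinear by (simp add: even_bilinear_def leibniz_of_def)
  moreover have "leibniz_superalgebra_axioms R (leibniz_of R D)"
    if "even_bilinear R (leibniz_of R D) (bracket (leibniz_of R D))"
    using that super_commutator_leibniz
    by (intro leibniz_superalgebra_axioms.intro)
      (simp_all add: a_minus_def inv[unfolded leibniz_of_def] leibniz_of_def super_commutator_closed hpart_closed)
  ultimately show ?thesis
    by (simp add: leibniz_superalgebra_def)
qed

end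

section \<open>Graded subalgebras and the derived subalgebra\<close>

context leibniz_superalgebra
begin

text \<open>Gradedness of the submodule is what makes the parts \<open>hpart L p \<inter> N\<close> span \<open>N\<close>.\<close>

lemma graded_subalgebra:
  assumes N: "submodule N R L"
    and graded: "\<And>x. x \<in> N \<Longrightarrow> hcomp L 0 x \<in> N \<and> hcomp L 1 x \<in> N"
    and brk: "\<And>x y. \<lbrakk>x \<in> N; y \<in> N\<rbrakk> \<Longrightarrow> bracket L x y \<in> N"
  shows "leibniz_superalgebra R (L\<lparr>carrier := N, hpart := \<lambda>p. hpart L p \<inter> N\<rparr>)" (is "leibniz_superalgebra R ?N")
proof -
  have NL: "x \<in> N \<Longrightarrow> x \<in> carrier L" for x using submoduleE(1)[OF N] by auto
  have "module R (L\<lparr>carrier := N\<rparr>)"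
    using N module_axioms by (rule submodule.submodule_is_module)
  then have ag: "abelian_group (L\<lparr>carrier := N\<rparr>)" by (simp add: module_def)
  have "abelian_group ?N"
    using abelian_groupE[OF ag]
    by (intro abelian_groupI) simp_all
  then have mod: "module R ?N"
    by (intro moduleI R.is_cring) (simp_all add: submoduleE(4)[OF N] NL smult_l_distr smult_r_distr smult_assoc1)
  interpret N: module R ?N by (rule mod)
  have inv: "\<ominus>\<^bsub>?N\<^esub> x = \<ominus>\<^bsub>L\<^esub> x" if "x \<in> N" for x
    using that NL submoduleE(3)[OF N]
    by (intro N.minus_equality) (simp_all add: M.l_neg)
  have "supermodule R ?N"
  proof (intro supermoduleI mod)
    fix p show "submodule (hpart ?N p) R ?N"
      using NL submoduleE[OF N] subgroup.one_closed[OF submodule.axioms(1)[OF N]]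
      by (intro N.submoduleI) (auto simp: hpart_add hpart_smult inv hpart_inv)
  next
    fix x assume "x \<in> carrier ?N"
    then show "\<exists>y\<in>hpart ?N 0. \<exists>z\<in>hpart ?N 1. x = y \<oplus>\<^bsub>?N\<^esub> z"
      using graded[of x] NL
      by (intro bexI[of _ "hcomp L 0 x"] bexI[of _ "hcomp L 1 x"]) (auto simp: hcomp_sum)
  next
    fix x assume "x \<in> hpart ?N 0" "x \<in> hpart ?N 1"
    then show "x = \<zero>\<^bsub>?N\<^esub>" using hpart_disjoint[of x 0 1] by simp
  qed
  moreover have "even_bilinear R ?N (bracket ?N)"
    using NL brk by (intro even_bilinearI)
      (auto simp: brk.add_l brk.add_r brk.smult_l brk.smult_r brk.hpart)
  ultimately show ?thesis
    using leibniz NL submoduleE[OF N] brk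
    by (auto intro!: leibniz_superalgebra.intro leibniz_superalgebra_axioms.intro
        simp: a_minus_def inv)
qed

lemma derived_set_submodule: "submodule (derived_set R L) R L"
proof -
  define F where "F = {N. submodule N R L \<and> (\<forall>x \<in> carrier L. \<forall>y \<in> carrier L. bracket L x y \<in> N)}"
  have F: "submodule N R L" if "N \<in> F" for N using that by (simp add: F_def)
  have c: "carrier L \<in> F" by (simp add: F_def carrier_is_submodule)
  have "submodule (\<Inter>F) R L"
    using submoduleE[OF F] subgroup.one_closed[OF submodule.axioms(1)[OF F]] c
    by (intro submoduleI') auto
  then show ?thesis by (simp add: derived_set_def F_def)
qed

lemma derived_set_bracket: "\<lbrakk>x \<in> carrier L; y \<in> carrier L\<rbrakk> \<Longrightarrow> bracket L x y \<in> derived_set R L"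
  by (simp add: derived_set_def)

lemma derived_set_least:
  assumes "submodule N R L" "\<And>x y. \<lbrakk>x \<in> carrier L; y \<in> carrier L\<rbrakk> \<Longrightarrow> bracket L x y \<in> N"
  shows "derived_set R L \<subseteq> N"
  using assms by (auto simp: derived_set_def)

lemma derived_set_closed: "x \<in> derived_set R L \<Longrightarrow> x \<in> carrier L"
  using submoduleE(1)[OF derived_set_submodule] by auto

text \<open>
  The elements of the derived subalgebra with components in it form a submodule.  It contains the brackets
  of homogeneous elements, which are homogeneous themselves, and so by bilinearity all brackets.
\<close>

lemma derived_set_graded:
  assumes "x \<in> derived_set R L"
  shows "hcomp L 0 x \<in> derived_set R L \<and> hcomp L 1 x \<in> derived_set R L"
proof -
  let ?N = "{x \<in> derived_set R L. \<forall>p. hcomp L p x \<in> derived_set R L}"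
  note sub = submoduleE[OF derived_set_submodule]
    subgroup.one_closed[OF submodule.axioms(1)[OF derived_set_submodule]]
  have N: "submodule ?N R L"
    using sub derived_set_closed hcomp_hpart[OF hpart_zero, of _ 0]
    by (intro submoduleI') (auto simp: hcomp_add hcomp_smult)
  have homogeneous: "bracket L x y \<in> ?N" if "x \<in> hpart L p" "y \<in> hpart L q" for x y p q
    using that brk.hpart[OF that] sub
    by (auto simp: hcomp_hpart derived_set_bracket hpart_closed)
  have "bracket L x y \<in> ?N" if x: "x \<in> carrier L" and y: "y \<in> carrier L" for x y
    using x
  proof (induction rule: homogeneous_induct)
    case (hom p x)
    from y show ?case
    proof (induction rule: homogeneous_induct)
      case (add u v)
      then show ?case using submoduleE(5)[OF N] hom by (simp add: brk.add_r hpart_closed)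
    qed (use hom homogeneous in blast)
  next
    case (add u v)
    then show ?case using submoduleE(5)[OF N] y by (simp add: brk.add_l)
  qed
  then have "derived_set R L \<subseteq> ?N" by (intro derived_set_least N)
  then show ?thesis using assms by auto
qed

lemma derived_subalgebra:
  "leibniz_superalgebra R (L\<lparr>carrier := derived_set R L, hpart := \<lambda>p. hpart L p \<inter> derived_set R L\<rparr>)"
  by (intro graded_subalgebra derived_set_submodule derived_set_graded derived_set_bracket derived_set_closed)

end

section \<open>Matrices over a superdialgebra\<close>

lemma (in abelian_monoid) finsum_swap:
  assumes "finite A" "finite B" "\<And>i j. \<lbrakk>i \<in> A; j \<in> B\<rbrakk> \<Longrightarrow> f i j \<in> carrier G"
  shows "(\<Oplus>i\<in>A. \<Oplus>j\<in>B. f i j) = (\<Oplus>j\<in>B. \<Oplus>i\<in>A. f i j)"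
  using assms
proof (induction A rule: finite_induct)
  case empty
  then show ?case by (simp add: finsum_empty finsum_zero)
next
  case (insert a A)
  then have "(\<Oplus>i\<in>insert a A. \<Oplus>j\<in>B. f i j) = (\<Oplus>j\<in>B. f a j) \<oplus> (\<Oplus>j\<in>B. \<Oplus>i\<in>A. f i j)"
    by (simp add: finsum_insert finsum_closed Pi_def)
  also have "\<dots> = (\<Oplus>j\<in>B. f a j \<oplus> (\<Oplus>i\<in>A. f i j))"
    using insert by (simp add: finsum_addf finsum_closed Pi_def)
  also have "\<dots> = (\<Oplus>j\<in>B. \<Oplus>i\<in>insert a A. f i j)"
    using insert by (intro finsum_cong') (simp_all add: finsum_insert finsum_closed Pi_def)
  finally show ?case .
qed

lemma (in supermodule) hpart_finsum:
  assumes "finite A" "\<And>i. i \<in> A \<Longrightarrow> f i \<in> hpart M p"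
  shows "(\<Oplus>\<^bsub>M\<^esub>i\<in>A. f i) \<in> hpart M p"
  using assms
proof (induction A rule: finite_induct)
  case (insert a A)
  have "f a \<in> carrier M" "f \<in> A \<rightarrow> carrier M" using insert.prems hpart_closed by auto
  then show ?case using insert by (simp add: M.finsum_insert hpart_add)
qed (simp add: M.finsum_empty)

context superdialgebra
begin

definition matmul :: "nat \<Rightarrow> ('a \<Rightarrow> 'a \<Rightarrow> 'a) \<Rightarrow> (nat \<Rightarrow> nat \<Rightarrow> 'a) \<Rightarrow> (nat \<Rightarrow> nat \<Rightarrow> 'a) \<Rightarrow> nat \<Rightarrow> nat \<Rightarrow> 'a" where
  "matmul N f x y = (\<lambda>i j. \<Oplus>\<^bsub>D\<^esub>k\<in>{1..N}. f (x i k) (y k j))"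

lemma mat_superdialgebra_simps [simp]:
  "carrier (mat_superdialgebra D m n) = mat_carrier D m n"
  "x \<stileturn>\<^bsub>mat_superdialgebra D m n\<^esub> y = matmul (m + n) (lprod D) x y"
  "x \<turnstile>\<^bsub>mat_superdialgebra D m n\<^esub> y = matmul (m + n) (rprod D) x y"
  "\<zero>\<^bsub>mat_superdialgebra D m n\<^esub> = (\<lambda>i j. \<zero>\<^bsub>D\<^esub>)"
  "x \<oplus>\<^bsub>mat_superdialgebra D m n\<^esub> y = (\<lambda>i j. x i j \<oplus>\<^bsub>D\<^esub> y i j)"
  "r \<odot>\<^bsub>mat_superdialgebra D m n\<^esub> x = (\<lambda>i j. r \<odot>\<^bsub>D\<^esub> x i j)"
  by (simp_all add: mat_superdialgebra_def matmul_def)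

lemma mat_hpart: "x \<in> hpart (mat_superdialgebra D m n) p \<longleftrightarrow> x \<in> mat_carrier D m n \<and>
    (\<forall>i\<in>{1..m+n}. \<forall>j\<in>{1..m+n}. x i j \<in> hpart D (idx_deg m i + idx_deg m j + p))"
  by (simp add: mat_superdialgebra_def)

lemma mat_carrierI:
  assumes "\<And>i j. x i j \<in> carrier D" "\<And>i j. \<not> (i \<in> {1..m+n} \<and> j \<in> {1..m+n}) \<Longrightarrow> x i j = \<zero>\<^bsub>D\<^esub>"
  shows "x \<in> mat_carrier D m n"
  using assms unfolding mat_carrier_def by blast

lemma mat_entry [simp]: "x \<in> mat_carrier D m n \<Longrightarrow> x i j \<in> carrier D"
  by (simp add: mat_carrier_def)

lemma mat_outside: "\<lbrakk>x \<in> mat_carrier D m n; \<not> (i \<in> {1..m+n} \<and> j \<in> {1..m+n})\<rbrakk> \<Longrightarrow> x i j = \<zero>\<^bsub>D\<^esub>"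
  unfolding mat_carrier_def by blast

lemma mat_nonzero:
  "\<lbrakk>x \<in> mat_carrier D m n; x i j \<noteq> \<zero>\<^bsub>D\<^esub>\<rbrakk> \<Longrightarrow> Suc 0 \<le> i \<and> i \<le> m + n \<and> Suc 0 \<le> j \<and> j \<le> m + n"
  using mat_outside[of x m n i j] by auto

lemma mat_carrier_closed:
  "(\<lambda>i j. \<zero>\<^bsub>D\<^esub>) \<in> mat_carrier D m n"
  "\<lbrakk>x \<in> mat_carrier D m n; y \<in> mat_carrier D m n\<rbrakk> \<Longrightarrow> (\<lambda>i j. x i j \<oplus>\<^bsub>D\<^esub> y i j) \<in> mat_carrier D m n"
  "x \<in> mat_carrier D m n \<Longrightarrow> (\<lambda>i j. \<ominus>\<^bsub>D\<^esub> x i j) \<in> mat_carrier D m n"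
  "\<lbrakk>r \<in> carrier R; x \<in> mat_carrier D m n\<rbrakk> \<Longrightarrow> (\<lambda>i j. r \<odot>\<^bsub>D\<^esub> x i j) \<in> mat_carrier D m n"
  "x \<in> mat_carrier D m n \<Longrightarrow> (\<lambda>i j. hcomp D (f i j) (x i j)) \<in> mat_carrier D m n"
  by (rule mat_carrierI; simp add: mat_outside hcomp_hpart[OF hpart_zero, of _ 0])+

lemma mat_module: "module R (mat_superdialgebra D m n)"
proof (intro moduleI R.is_cring abelian_groupI)
  fix x assume x: "x \<in> carrier (mat_superdialgebra D m n)"
  then show "\<exists>y\<in>carrier (mat_superdialgebra D m n).
      y \<oplus>\<^bsub>mat_superdialgebra D m n\<^esub> x = \<zero>\<^bsub>mat_superdialgebra D m n\<^esub>"
    by (intro bexI[of _ "\<lambda>i j. \<ominus>\<^bsub>D\<^esub> x i j"]) (auto simp: M.l_neg mat_carrier_closed)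
qed (auto simp: mat_outside M.a_ac smult_l_distr smult_r_distr smult_assoc1 mat_carrier_closed)

lemma mat_inv:
  assumes "x \<in> mat_carrier D m n"
  shows "\<ominus>\<^bsub>mat_superdialgebra D m n\<^esub> x = (\<lambda>i j. \<ominus>\<^bsub>D\<^esub> x i j)"
proof -
  interpret A: module R "mat_superdialgebra D m n" by (rule mat_module)
  show ?thesis
    using assms by (intro A.minus_equality) (auto simp: M.l_neg mat_carrier_closed)
qed

lemma mat_supermodule: "supermodule R (mat_superdialgebra D m n)"
proof (rule supermoduleI)
  interpret A: module R "mat_superdialgebra D m n" by (rule mat_module)
  show "module R (mat_superdialgebra D m n)" by (rule mat_module)
  show "submodule (hpart (mat_superdialgebra D m n) p) R (mat_superdialgebra D m n)" for p
    by (rule A.submoduleI)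
       (auto simp: mat_hpart mat_inv hpart_add hpart_smult hpart_inv mat_carrier_closed)
next
  fix x assume x: "x \<in> carrier (mat_superdialgebra D m n)"
  define y where "y p = (\<lambda>i j. hcomp D (idx_deg m i + idx_deg m j + p) (x i j))" for p
  have y: "y p \<in> hpart (mat_superdialgebra D m n) p" for p
    using x unfolding mat_hpart y_def by (auto simp: mat_carrier_closed)
  have "hcomp D p a \<oplus>\<^bsub>D\<^esub> hcomp D (p + 1) a = a" if "a \<in> carrier D" for p a
    using that hcomp_sum[OF that] by (cases p) (simp_all add: M.a_comm)
  then have "x = y 0 \<oplus>\<^bsub>mat_superdialgebra D m n\<^esub> y 1"
    using x by (simp add: y_def fun_eq_iff)
  with y show "\<exists>y\<in>hpart (mat_superdialgebra D m n) 0. \<exists>z\<in>hpart (mat_superdialgebra D m n) 1.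
      x = y \<oplus>\<^bsub>mat_superdialgebra D m n\<^esub> z" by blast
next
  fix x assume x: "x \<in> hpart (mat_superdialgebra D m n) 0" "x \<in> hpart (mat_superdialgebra D m n) 1"
  have "x i j = \<zero>\<^bsub>D\<^esub>" for i j
  proof (cases "i \<in> {1..m+n} \<and> j \<in> {1..m+n}")
    case True
    have "p \<noteq> p + 1" for p :: bit by (cases p) simp_all
    then show ?thesis
      using x True
        hpart_disjoint[of "x i j" "idx_deg m i + idx_deg m j" "idx_deg m i + idx_deg m j + 1"]
      by (simp add: mat_hpart)
  next
    case False
    then show ?thesis using x mat_outside by (auto simp: mat_hpart)
  qed
  then show "x = \<zero>\<^bsub>mat_superdialgebra D m n\<^esub>" by (simp add: fun_eq_iff)
qed

lemma matmul_closed: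
  assumes f: "even_bilinear R D f" and x: "x \<in> mat_carrier D m n" and y: "y \<in> mat_carrier D m n"
  shows "matmul (m + n) f x y \<in> mat_carrier D m n"
proof -
  interpret f: even_bilinear_map R D f by unfold_locales (rule f)
  show ?thesis
  proof (rule mat_carrierI)
    fix i j
    show "matmul (m + n) f x y i j \<in> carrier D"
      unfolding matmul_def using x y by (simp add: M.finsum_closed Pi_def)
    assume "\<not> (i \<in> {1..m+n} \<and> j \<in> {1..m+n})"
    then have "f (x i k) (y k j) = \<zero>\<^bsub>D\<^esub>" for k
      using x y mat_outside[OF x, of i k] mat_outside[OF y, of k j] by (cases "i \<in> {1..m+n}") auto
    then show "matmul (m + n) f x y i j = \<zero>\<^bsub>D\<^esub>" unfolding matmul_def by (simp add: M.finsum_zero)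
  qed
qed

lemma matmul_bilinear:
  assumes f: "even_bilinear R D f"
  shows "even_bilinear R (mat_superdialgebra D m n) (matmul (m + n) f)"
proof -
  interpret f: even_bilinear_map R D f by unfold_locales (rule f)
  show ?thesis
  proof (rule even_bilinearI)
    fix p q x y
    assume x: "x \<in> hpart (mat_superdialgebra D m n) p" and y: "y \<in> hpart (mat_superdialgebra D m n) q"
    have "f (x i k) (y k j) \<in> hpart D (idx_deg m i + idx_deg m j + (p + q))"
      if "i \<in> {1..m+n}" "j \<in> {1..m+n}" "k \<in> {1..m+n}" for i j k
    proof -
      have "f (x i k) (y k j) \<in> hpart D (idx_deg m i + idx_deg m k + p + (idx_deg m k + idx_deg m j + q))"
        using that x y by (intro f.hpart) (auto simp: mat_hpart)
      moreover have "idx_deg m i + idx_deg m k + p + (idx_deg m k + idx_deg m j + q) =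
          idx_deg m i + idx_deg m j + (p + q)" by (simp add: ac_simps)
      ultimately show ?thesis by simp
    qed
    then show "matmul (m + n) f x y \<in> hpart (mat_superdialgebra D m n) (p + q)"
      using x y matmul_closed[OF f] by (auto simp: mat_hpart matmul_def intro!: hpart_finsum)
  qed (auto simp: matmul_closed[OF f], simp_all add: matmul_def fun_eq_iff f.add_l f.add_r f.smult_l f.smult_r
      M.finsum_addf Pi_def finsum_smult_ldistr)
qed

text \<open>
  All associativity-like axioms of a superdialgebra have the form \<open>f (g a b) c = f' a (g' b c)\<close> for products
  \<open>f\<close>, \<open>g\<close>, \<open>f'\<close>, \<open>g'\<close>, apart from the two bar axioms, so that one exchange of sums transfers them to matrices.
\<close>

lemma matmul_assoc:
  assumes f: "even_bilinear R D f" "even_bilinear R D g" "even_bilinear R D f'" "even_bilinear R D g'"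
    and e: "\<And>a b c. \<lbrakk>a \<in> carrier D; b \<in> carrier D; c \<in> carrier D\<rbrakk> \<Longrightarrow> f (g a b) c = f' a (g' b c)"
    and c: "x \<in> mat_carrier D m n" "y \<in> mat_carrier D m n" "z \<in> mat_carrier D m n"
  shows "matmul N f (matmul N g x y) z = matmul N f' x (matmul N g' y z)"
proof -
  interpret f: even_bilinear_map R D f by unfold_locales (rule f)
  interpret g: even_bilinear_map R D g by unfold_locales (rule f)
  interpret f': even_bilinear_map R D f' by unfold_locales (rule f)
  interpret g': even_bilinear_map R D g' by unfold_locales (rule f)
  show ?thesis
  proof (intro ext)
    fix i j
    have "matmul N f (matmul N g x y) z i j = (\<Oplus>\<^bsub>D\<^esub>k\<in>{1..N}. \<Oplus>\<^bsub>D\<^esub>l\<in>{1..N}. f (g (x i l) (y l k)) (z k j))"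
      using c by (simp add: matmul_def f.finsum_l)
    also have "\<dots> = (\<Oplus>\<^bsub>D\<^esub>l\<in>{1..N}. \<Oplus>\<^bsub>D\<^esub>k\<in>{1..N}. f' (x i l) (g' (y l k) (z k j)))"
      using c by (subst M.finsum_swap) (simp_all add: e)
    also have "\<dots> = matmul N f' x (matmul N g' y z) i j"
      using c by (simp add: matmul_def f'.finsum_r)
    finally show "matmul N f (matmul N g x y) z i j = matmul N f' x (matmul N g' y z) i j" .
  qed
qed

lemma matmul_bar_right:
  assumes f: "even_bilinear R D f" "even_bilinear R D g" "even_bilinear R D g'"
    and e: "\<And>a b c. \<lbrakk>a \<in> carrier D; b \<in> carrier D; c \<in> carrier D\<rbrakk> \<Longrightarrow> f a (g b c) = f a (g' b c)"
    and c: "x \<in> mat_carrier D m n" "y \<in> mat_carrier D m n" "z \<in> mat_carrier D m n"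
  shows "matmul N f x (matmul N g y z) = matmul N f x (matmul N g' y z)"
proof -
  interpret f: even_bilinear_map R D f by unfold_locales (rule f)
  interpret g: even_bilinear_map R D g by unfold_locales (rule f)
  interpret g': even_bilinear_map R D g' by unfold_locales (rule f)
  show ?thesis using c by (simp add: matmul_def fun_eq_iff f.finsum_r e)
qed

lemma matmul_bar_left:
  assumes f: "even_bilinear R D f" "even_bilinear R D g" "even_bilinear R D g'"
    and e: "\<And>a b c. \<lbrakk>a \<in> carrier D; b \<in> carrier D; c \<in> carrier D\<rbrakk> \<Longrightarrow> f (g a b) c = f (g' a b) c"
    and c: "x \<in> mat_carrier D m n" "y \<in> mat_carrier D m n" "z \<in> mat_carrier D m n"
  shows "matmul N f (matmul N g x y) z = matmul N f (matmul N g' x y) z"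
proof -
  interpret f: even_bilinear_map R D f by unfold_locales (rule f)
  interpret g: even_bilinear_map R D g by unfold_locales (rule f)
  interpret g': even_bilinear_map R D g' by unfold_locales (rule f)
  show ?thesis using c by (simp add: matmul_def fun_eq_iff f.finsum_l e)
qed

lemma mat_superdialgebra: "superdialgebra R (mat_superdialgebra D m n)"
proof -
  have l: "lprod (mat_superdialgebra D m n) = matmul (m + n) (lprod D)"
    and r: "rprod (mat_superdialgebra D m n) = matmul (m + n) (rprod D)"
    by (intro ext, simp)+
  note b = lprod_bilinear rprod_bilinear
  show ?thesis
    apply (intro superdialgebra.intro superdialgebra_axioms.intro mat_supermodule)
    unfolding l r mat_superdialgebra_simps
    by (rule matmul_bilinear matmul_assoc matmul_bar_right matmul_bar_left b lprod_assoc rprod_assoc lprod_bar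
        inner_assoc rprod_bar | assumption)+
qed

lemma gl_leibniz: "leibniz_superalgebra R (gl R m n D)"
  unfolding gl_def by (rule superdialgebra.leibniz_of_leibniz_superalgebra[OF mat_superdialgebra])

lemma sl_leibniz: "leibniz_superalgebra R (sl R m n D)"
  unfolding sl_def by (rule leibniz_superalgebra.derived_subalgebra[OF gl_leibniz])

lemma matmul_mat_unit:
  assumes f: "even_bilinear R D f" and a: "a \<in> carrier D" "b \<in> carrier D" and j: "j \<in> {1..N}"
  shows "matmul N f (mat_unit D i j a) (mat_unit D k l b) =
    (if j = k then mat_unit D i l (f a b) else (\<lambda>_ _. \<zero>\<^bsub>D\<^esub>))"
proof (intro ext)
  interpret f: even_bilinear_map R D f by unfold_locales (rule f)
  fix u v
  have "matmul N f (mat_unit D i j a) (mat_unit D k l b) u v =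
      (\<Oplus>\<^bsub>D\<^esub>r\<in>{1..N}. if j = r then (if j = k \<and> u = i \<and> v = l then f a b else \<zero>\<^bsub>D\<^esub>) else \<zero>\<^bsub>D\<^esub>)"
    unfolding matmul_def mat_unit_def using a by (intro M.finsum_cong') auto
  also have "\<dots> = (if j = k \<and> u = i \<and> v = l then f a b else \<zero>\<^bsub>D\<^esub>)"
    using a j by (intro M.finsum_singleton[of j "{1..N}" "\<lambda>_. if j = k \<and> u = i \<and> v = l then f a b else \<zero>\<^bsub>D\<^esub>"]) auto
  finally show "matmul N f (mat_unit D i j a) (mat_unit D k l b) u v =
    (if j = k then mat_unit D i l (f a b) else (\<lambda>_ _. \<zero>\<^bsub>D\<^esub>)) u v"
    by (simp add: mat_unit_def)
qed

end

section \<open>Brackets of matrix units\<close>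

text \<open>The condition on \<open>m + n\<close> provides a third index next to any two.\<close>

locale steinberg = unital_superdialgebra R D
  for R (structure) and D :: "('r, 'a, 'z) superdialgebra_scheme" (structure) +
  fixes m n :: nat
  assumes rank: "3 \<le> m + n"
begin

abbreviation "G \<equiv> gl R m n D"
abbreviation "S \<equiv> sl R m n D"
abbreviation "I \<equiv> {1..m + n}"
abbreviation "E \<equiv> mat_unit D"
abbreviation "dg \<equiv> idx_deg m"

sublocale G: leibniz_superalgebra R G by (rule gl_leibniz)
sublocale S: leibniz_superalgebra R S by (rule sl_leibniz)

lemma G_simps [simp]:
  "carrier G = mat_carrier D m n"
  "\<zero>\<^bsub>G\<^esub> = (\<lambda>i j. \<zero>\<^bsub>D\<^esub>)"
  "x \<oplus>\<^bsub>G\<^esub> y = (\<lambda>i j. x i j \<oplus>\<^bsub>D\<^esub> y i j)"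
  "r \<odot>\<^bsub>G\<^esub> x = (\<lambda>i j. r \<odot>\<^bsub>D\<^esub> x i j)"
  by (simp_all add: gl_def leibniz_of_def)

lemma G_inv [simp]:
  assumes "x \<in> mat_carrier D m n"
  shows "\<ominus>\<^bsub>G\<^esub> x = (\<lambda>i j. \<ominus>\<^bsub>D\<^esub> x i j)"
  using assms by (intro G.M.minus_equality) (auto simp: M.l_neg mat_carrier_closed)

lemma S_simps [simp]:
  "carrier S = derived_set R G"
  "\<zero>\<^bsub>S\<^esub> = \<zero>\<^bsub>G\<^esub>"
  "x \<oplus>\<^bsub>S\<^esub> y = x \<oplus>\<^bsub>G\<^esub> y"
  "r \<odot>\<^bsub>S\<^esub> x = r \<odot>\<^bsub>G\<^esub> x"
  "bracket S x y = bracket G x y"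
  "hpart S p = hpart G p \<inter> derived_set R G"
  by (simp_all add: sl_def)

lemma one_closed [simp]: "\<one>\<^bsub>D\<^esub> \<in> carrier D"
  using bar_unit_even hpart_closed by blast

lemma E_closed [simp]: "\<lbrakk>a \<in> carrier D; i \<in> I; j \<in> I\<rbrakk> \<Longrightarrow> E i j a \<in> mat_carrier D m n"
  by (rule mat_carrierI) (auto simp: mat_unit_def)

lemma E_hpart: "\<lbrakk>a \<in> hpart D p; i \<in> I; j \<in> I; p = dg i + dg j + q\<rbrakk> \<Longrightarrow> E i j a \<in> hpart G q"
  using E_closed[of a i j] hpart_closed[of a p]
  by (auto simp: gl_def leibniz_of_def mat_hpart mat_unit_def)

lemma E_add: "\<lbrakk>a \<in> carrier D; b \<in> carrier D\<rbrakk> \<Longrightarrow> E i j (a \<oplus>\<^bsub>D\<^esub> b) = E i j a \<oplus>\<^bsub>G\<^esub> E i j b"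
  by (auto simp: mat_unit_def fun_eq_iff)

lemma E_smult: "\<lbrakk>r \<in> carrier R; a \<in> carrier D\<rbrakk> \<Longrightarrow> E i j (r \<odot>\<^bsub>D\<^esub> a) = r \<odot>\<^bsub>G\<^esub> E i j a"
  by (auto simp: mat_unit_def fun_eq_iff)

text \<open>Here \<open>p\<close> and \<open>q\<close> are the degrees of the matrices, not of the entries, because the sign of the bracket
  depends on the former.\<close>

lemma bracket_E:
  assumes "a \<in> hpart D (dg i + dg j + p)" "b \<in> hpart D (dg k + dg l + q)" "i \<in> I" "j \<in> I" "k \<in> I" "l \<in> I"
  shows "bracket G (E i j a) (E k l b) =
    (if j = k then E i l (a \<stileturn>\<^bsub>D\<^esub> b) else \<zero>\<^bsub>G\<^esub>) \<ominus>\<^bsub>G\<^esub>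
    (if l = i then sgn_of R (p * q) \<odot>\<^bsub>G\<^esub> E k j (b \<turnstile>\<^bsub>D\<^esub> a) else \<zero>\<^bsub>G\<^esub>)"
proof -
  interpret A: superdialgebra R "mat_superdialgebra D m n" by (rule mat_superdialgebra)
  have c: "a \<in> carrier D" "b \<in> carrier D" using assms hpart_closed by auto
  have inv: "x \<ominus>\<^bsub>mat_superdialgebra D m n\<^esub> y = x \<ominus>\<^bsub>G\<^esub> y" if "y \<in> mat_carrier D m n" for x y
    using that by (simp add: a_minus_def mat_inv)
  have h: "E i j a \<in> hpart (mat_superdialgebra D m n) p" "E k l b \<in> hpart (mat_superdialgebra D m n) q"
    using assms E_hpart[OF assms(1,3,4)] E_hpart[OF assms(2,5,6)] by (auto simp: gl_def leibniz_of_def)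
  have "bracket G (E i j a) (E k l b) = super_commutator R (mat_superdialgebra D m n) (E i j a) (E k l b)"
    by (simp add: gl_def leibniz_of_def)
  also have "\<dots> = A.scomm p q (E i j a) (E k l b)"
    by (rule A.super_commutator_homogeneous[OF h])
  also have "\<dots> = (if j = k then E i l (a \<stileturn>\<^bsub>D\<^esub> b) else \<zero>\<^bsub>G\<^esub>) \<ominus>\<^bsub>G\<^esub>
    (if l = i then sgn_of R (p * q) \<odot>\<^bsub>G\<^esub> E k j (b \<turnstile>\<^bsub>D\<^esub> a) else \<zero>\<^bsub>G\<^esub>)"
    using assms c
    by (simp add: A.scomm_def matmul_mat_unit lprod_bilinear rprod_bilinear inv mat_carrier_closed)
  finally show ?thesis .
qed

text \<open>A matrix is built up entry by entry, and each entry from its two components.\<close>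

lemma gl_induct [consumes 1, case_names unit add zero]:
  assumes "x \<in> carrier G"
    and unit: "\<And>p i j a. \<lbrakk>i \<in> I; j \<in> I; a \<in> hpart D (dg i + dg j + p)\<rbrakk> \<Longrightarrow> P (E i j a)"
    and add: "\<And>x y. \<lbrakk>x \<in> carrier G; y \<in> carrier G; P x; P y\<rbrakk> \<Longrightarrow> P (x \<oplus>\<^bsub>G\<^esub> y)"
    and zero: "P \<zero>\<^bsub>G\<^esub>"
  shows "P x"
proof -
  define r where "r A = (\<lambda>i j. if (i, j) \<in> A then x i j else \<zero>\<^bsub>D\<^esub>)" for A
  have rc: "r A \<in> carrier G" for A
    using assms(1) by (auto simp: r_def intro!: mat_carrierI dest: mat_nonzero split: if_splits)
  have E: "P (E i j a)" if "a \<in> carrier D" and ij: "i \<in> I" "j \<in> I" for i j a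
    using that(1)
  proof (induction rule: homogeneous_induct)
    case (hom p x)
    then show ?case using ij by (intro unit[of i j x "dg i + dg j + p"]) simp_all
  next
    case (add x y)
    then show ?case using ij by (simp add: E_add del: G_simps) (intro assms(3), simp_all)
  qed
  have "P (r A)" if "finite A" "A \<subseteq> I \<times> I" for A
    using that
  proof (induction A rule: finite_induct)
    case empty
    then show ?case using zero by (simp add: r_def)
  next
    case (insert ij A)
    obtain i j where ij: "ij = (i, j)" by force
    have "r (insert ij A) = r A \<oplus>\<^bsub>G\<^esub> E i j (x i j)"
      using insert(2) assms(1) by (auto simp: r_def ij mat_unit_def fun_eq_iff)
    then show ?case
      using insert ij assms(1) rc by (auto intro!: add E simp del: G_simps(3))
  qed
  then have "P (r (I \<times> I))" by simp
  moreover have "r (I \<times> I) = x"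
    using assms(1) by (auto simp: r_def fun_eq_iff mat_outside)
  ultimately show ?thesis by simp
qed

declare G_simps [simp del] G_inv [simp del] E_closed [simp del]

lemma E_closed' [simp]: "\<lbrakk>a \<in> carrier D; i \<in> I; j \<in> I\<rbrakk> \<Longrightarrow> E i j a \<in> carrier G"
  unfolding G_simps by (rule E_closed)

end

section \<open>Leibniz superalgebras given by generators and relations\<close>

primrec leval ::
  "('r, 'b, 'z) supermodule_scheme \<Rightarrow> ('g \<Rightarrow> 'b) \<Rightarrow> ('r, 'g) lterm \<Rightarrow> 'b" where
  "leval M g (Gen x) = g x"
| "leval M g Zero = \<zero>\<^bsub>M\<^esub>"
| "leval M g (Add s t) = leval M g s \<oplus>\<^bsub>M\<^esub> leval M g t"
| "leval M g (Smul r t) = r \<odot>\<^bsub>M\<^esub> leval M g t"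
| "leval M g (Brk s t) = bracket M (leval M g s) (leval M g t)"

text \<open>
  The component of degree \<open>p\<close> of a term, on the level of terms.  A generator to which both degrees are
  assigned is its own component in both degrees.
\<close>

primrec lcomp :: "(bit \<Rightarrow> 'g set) \<Rightarrow> bit \<Rightarrow> ('r, 'g) lterm \<Rightarrow> ('r, 'g) lterm" where
  "lcomp G p (Gen g) = (if g \<in> G p then Gen g else Zero)"
| "lcomp G p Zero = Zero"
| "lcomp G p (Add s t) = Add (lcomp G p s) (lcomp G p t)"
| "lcomp G p (Smul r t) = Smul r (lcomp G p t)"
| "lcomp G p (Brk s t) =
     Add (Brk (lcomp G 0 s) (lcomp G p t)) (Brk (lcomp G 1 s) (lcomp G (p + 1) t))"

locale leibniz_terms = R?: cring R
  for R :: "('r, 'x) ring_scheme" (structure) +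
  fixes Gn :: "bit \<Rightarrow> 'g set" and Rel :: "(('r, 'g) lterm \<times> ('r, 'g) lterm) set"
begin

abbreviation "Tm \<equiv> lterms R Gn"
abbreviation "cl \<equiv> lclass R Gn Rel"
abbreviation "Q \<equiv> presented_leibniz R Gn Rel"
abbreviation "hom_tm \<equiv> hom_lterm R Gn"

lemma hom_lterm_lterms: "hom_tm p t \<Longrightarrow> t \<in> Tm"
  by (induction rule: hom_lterm.induct) (auto intro: lterms.intros)

lemma lcong_lterms: "lcong R Gn Rel s t \<Longrightarrow> s \<in> Tm \<and> t \<in> Tm"
  by (induction rule: lcong.induct) (simp_all add: lterms.intros hom_lterm_lterms)

lemma lclass_eqI: "lcong R Gn Rel s t \<Longrightarrow> cl s = cl t"
  unfolding lclass_def by (auto intro: lcong.sym lcong.trans)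

lemma lclass_eq_iff: "s \<in> Tm \<Longrightarrow> cl s = cl t \<longleftrightarrow> lcong R Gn Rel s t"
  using lclass_eqI unfolding lclass_def by (blast intro: lcong.refl lcong.sym)

lemma lclass_memD: "u \<in> cl t \<Longrightarrow> lcong R Gn Rel t u"
  by (simp add: lclass_def)

lemma lclass_self: "t \<in> Tm \<Longrightarrow> t \<in> cl t"
  by (simp add: lclass_def lcong.refl)

lemma Q_carrier: "carrier Q = cl ` Tm"
  and Q_zero: "\<zero>\<^bsub>Q\<^esub> = cl Zero"
  and Q_hpart: "hpart Q p = cl ` {t. hom_tm p t}"
  by (simp_all add: presented_leibniz_def)

lemma UN_lclass:
  assumes "t \<in> Tm" "\<And>u. lcong R Gn Rel t u \<Longrightarrow> F u = F t"
  shows "(\<Union>u\<in>cl t. F u) = F t"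
proof -
  have "F u = F t" if "u \<in> cl t" for u using that assms(2) lclass_memD by blast
  then show ?thesis using lclass_self[OF assms(1)] by blast
qed

lemma Q_add: "\<lbrakk>s \<in> Tm; t \<in> Tm\<rbrakk> \<Longrightarrow> cl s \<oplus>\<^bsub>Q\<^esub> cl t = cl (Add s t)"
  unfolding presented_leibniz_def ring.simps
  by (simp add: UN_lclass lclass_eqI lcong.cong_Add lcong.refl lcong.sym lcong_lterms)

lemma Q_smult: "\<lbrakk>r \<in> carrier R; t \<in> Tm\<rbrakk> \<Longrightarrow> r \<odot>\<^bsub>Q\<^esub> cl t = cl (Smul r t)"
  unfolding presented_leibniz_def module.simps
  by (simp add: UN_lclass lclass_eqI lcong.cong_Smul lcong.sym)

lemma Q_brk: "\<lbrakk>s \<in> Tm; t \<in> Tm\<rbrakk> \<Longrightarrow> bracket Q (cl s) (cl t) = cl (Brk s t)"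
  unfolding presented_leibniz_def monoid.simps
  by (simp add: UN_lclass lclass_eqI lcong.cong_Brk lcong.refl lcong.sym lcong_lterms)

lemma cl_closed [simp]: "t \<in> Tm \<Longrightarrow> cl t \<in> carrier Q"
  by (simp add: Q_carrier)

lemma Q_module: "module R Q"
proof (intro moduleI R.is_cring abelian_groupI)
  show "x \<oplus>\<^bsub>Q\<^esub> y = y \<oplus>\<^bsub>Q\<^esub> x" if "x \<in> carrier Q" "y \<in> carrier Q" for x y
    using that by (auto simp: Q_carrier Q_add lclass_eqI[OF lcong.add_comm])
  fix x assume "x \<in> carrier Q"
  then obtain t where t: "t \<in> Tm" "x = cl t" by (auto simp: Q_carrier)
  then show "\<exists>y\<in>carrier Q. y \<oplus>\<^bsub>Q\<^esub> x = \<zero>\<^bsub>Q\<^esub>"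
    by (intro bexI[of _ "cl (Smul (\<ominus> \<one>) t)"])
      (simp_all add: Q_add Q_zero lterms.intros lclass_eqI lcong.add_neg)
qed (auto simp: Q_carrier Q_zero Q_add Q_smult lterms.intros
    lclass_eqI[OF lcong.add_assoc] lclass_eqI[OF lcong.add_zero]
    lclass_eqI[OF lcong.smul_add_left] lclass_eqI[OF lcong.smul_add_right]
    lclass_eqI[OF lcong.smul_mult] lclass_eqI[OF lcong.smul_one])

sublocale Q: module R Q by (rule Q_module)

lemma cl_Zero: "cl Zero = \<zero>\<^bsub>Q\<^esub>"
  by (simp add: Q_zero)

lemma cl_Add: "\<lbrakk>s \<in> Tm; t \<in> Tm\<rbrakk> \<Longrightarrow> cl (Add s t) = cl s \<oplus>\<^bsub>Q\<^esub> cl t"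
  by (simp add: Q_add)

lemma cl_Smul: "\<lbrakk>r \<in> carrier R; t \<in> Tm\<rbrakk> \<Longrightarrow> cl (Smul r t) = r \<odot>\<^bsub>Q\<^esub> cl t"
  by (simp add: Q_smult)

lemma cl_Brk: "\<lbrakk>s \<in> Tm; t \<in> Tm\<rbrakk> \<Longrightarrow> cl (Brk s t) = bracket Q (cl s) (cl t)"
  by (simp add: Q_brk)

lemma Q_brk_closed [simp]:
  "\<lbrakk>x \<in> carrier Q; y \<in> carrier Q\<rbrakk> \<Longrightarrow> bracket Q x y \<in> carrier Q"
  by (auto simp: Q_carrier Q_brk lterms.intros)

lemma Q_brk_add:
  assumes "x \<in> carrier Q" "y \<in> carrier Q" "z \<in> carrier Q"
  shows "bracket Q (x \<oplus>\<^bsub>Q\<^esub> y) z = bracket Q x z \<oplus>\<^bsub>Q\<^esub> bracket Q y z"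
    and "bracket Q z (x \<oplus>\<^bsub>Q\<^esub> y) = bracket Q z x \<oplus>\<^bsub>Q\<^esub> bracket Q z y"
  using assms by (auto simp: Q_carrier Q_brk Q_add lterms.intros
      lclass_eqI[OF lcong.brk_add_left] lclass_eqI[OF lcong.brk_add_right])

lemma Q_brk_smult:
  assumes "r \<in> carrier R" "x \<in> carrier Q" "y \<in> carrier Q"
  shows "bracket Q (r \<odot>\<^bsub>Q\<^esub> x) y = r \<odot>\<^bsub>Q\<^esub> bracket Q x y"
    and "bracket Q x (r \<odot>\<^bsub>Q\<^esub> y) = r \<odot>\<^bsub>Q\<^esub> bracket Q x y"
  using assms by (auto simp: Q_carrier Q_brk Q_smult lterms.intros
      lclass_eqI[OF lcong.brk_smul_left] lclass_eqI[OF lcong.brk_smul_right])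

lemma Q_brk_zero [simp]:
  assumes "x \<in> carrier Q"
  shows "bracket Q \<zero>\<^bsub>Q\<^esub> x = \<zero>\<^bsub>Q\<^esub>" and "bracket Q x \<zero>\<^bsub>Q\<^esub> = \<zero>\<^bsub>Q\<^esub>"
  using Q_brk_smult[of \<zero> "\<zero>\<^bsub>Q\<^esub>" x] Q_brk_smult[of \<zero> x "\<zero>\<^bsub>Q\<^esub>"] assms by simp_all

lemma Q_leibniz:
  assumes "x \<in> carrier Q" "y \<in> hpart Q p" "z \<in> hpart Q q"
  shows "bracket Q x (bracket Q y z) =
    bracket Q (bracket Q x y) z \<ominus>\<^bsub>Q\<^esub> sgn_of R (p * q) \<odot>\<^bsub>Q\<^esub> bracket Q (bracket Q x z) y"
proof -
  obtain s t u where st: "x = cl s" "y = cl t" "z = cl u" "s \<in> Tm" "hom_tm p t" "hom_tm q u"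
    using assms by (auto simp: Q_carrier Q_hpart)
  note tm = st(4) st(5,6)[THEN hom_lterm_lterms]
  have "cl (Brk s (Brk t u)) = cl (Add (Brk (Brk s t) u) (Smul (\<ominus> sgn_of R (p * q)) (Brk (Brk s u) t)))"
    by (intro lclass_eqI lcong.leibniz st)
  then show ?thesis
    using tm by (simp add: st(1-3) cl_Brk cl_Add cl_Smul lterms.intros Q.smult_l_minus Q.M.minus_eq)
qed

end

section \<open>Homomorphisms\<close>

lemma leibniz_homD:
  assumes "f \<in> leibniz_hom R L M"
  shows leibniz_hom_closed: "x \<in> carrier L \<Longrightarrow> f x \<in> carrier M"
    and leibniz_hom_add: "\<lbrakk>x \<in> carrier L; y \<in> carrier L\<rbrakk> \<Longrightarrow> f (x \<oplus>\<^bsub>L\<^esub> y) = f x \<oplus>\<^bsub>M\<^esub> f y"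
    and leibniz_hom_smult: "\<lbrakk>r \<in> carrier R; x \<in> carrier L\<rbrakk> \<Longrightarrow> f (r \<odot>\<^bsub>L\<^esub> x) = r \<odot>\<^bsub>M\<^esub> f x"
    and leibniz_hom_bracket: "\<lbrakk>x \<in> carrier L; y \<in> carrier L\<rbrakk> \<Longrightarrow> f (bracket L x y) = bracket M (f x) (f y)"
    and leibniz_hom_hpart: "x \<in> hpart L p \<Longrightarrow> f x \<in> hpart M p"
  using assms unfolding leibniz_hom_def by (auto simp: image_subset_iff)

lemma leibniz_hom_zero:
  assumes f: "f \<in> leibniz_hom R L M" and "supermodule R L" "supermodule R M"
  shows "f \<zero>\<^bsub>L\<^esub> = \<zero>\<^bsub>M\<^esub>"
proof -
  interpret L: supermodule R L by fact
  interpret M: supermodule R M by fact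
  have "f (\<zero>\<^bsub>R\<^esub> \<odot>\<^bsub>L\<^esub> \<zero>\<^bsub>L\<^esub>) = \<zero>\<^bsub>R\<^esub> \<odot>\<^bsub>M\<^esub> f \<zero>\<^bsub>L\<^esub>" by (intro leibniz_hom_smult[OF f]) auto
  then show ?thesis using leibniz_hom_closed[OF f, of "\<zero>\<^bsub>L\<^esub>"] by simp
qed

lemma leibniz_hom_inv:
  assumes f: "f \<in> leibniz_hom R L M" and "supermodule R L" "supermodule R M" and x: "x \<in> carrier L"
  shows "f (\<ominus>\<^bsub>L\<^esub> x) = \<ominus>\<^bsub>M\<^esub> f x"
proof -
  interpret L: supermodule R L by fact
  interpret M: supermodule R M by fact
  have "f ((\<ominus>\<^bsub>R\<^esub> \<one>\<^bsub>R\<^esub>) \<odot>\<^bsub>L\<^esub> x) = (\<ominus>\<^bsub>R\<^esub> \<one>\<^bsub>R\<^esub>) \<odot>\<^bsub>M\<^esub> f x"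
    using x by (intro leibniz_hom_smult[OF f]) auto
  then show ?thesis using x leibniz_hom_closed[OF f x] by (simp add: L.smult_neg_one M.smult_neg_one)
qed

lemma (in leibniz_superalgebra) restrict_hom:
  assumes f: "f \<in> leibniz_hom R L M"
  shows "restrict f (carrier L) \<in> leibniz_hom R L M"
  unfolding leibniz_hom_def using leibniz_homD[OF f] by (auto simp: hpart_closed)

section \<open>The grading of a presented Leibniz superalgebra\<close>

text \<open>
  The congruence does not mention components, so that the quotient splits into its even and its
  odd part has to be proved.  The map \<^const>\<open>lcomp\<close> takes the component of a term formally; it
  respects the congruence as soon as the relations are homogeneous and a generator
  to which both degrees are assigned is congruent to zero.
\<close>

locale leibniz_presentation = leibniz_terms +
  assumes rel_homogeneous: "\<And>s t. \<lbrakk>(s, t) \<in> Rel; s \<in> Tm; t \<in> Tm\<rbrakk> \<Longrightarrow> \<exists>p. hom_tm p s \<and> hom_tm p t"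
    and gen_both_zero: "\<And>x. \<lbrakk>x \<in> Gn 0; x \<in> Gn 1\<rbrakk> \<Longrightarrow> cl (Gen x) = \<zero>\<^bsub>Q\<^esub>"
begin

lemma hom_lcomp: "t \<in> Tm \<Longrightarrow> hom_tm p (lcomp Gn p t)"
proof (induction t arbitrary: p rule: lterms.induct)
  case (5 s t)
  have "hom_tm (0 + p) (Brk (lcomp Gn 0 s) (lcomp Gn p t))" by (intro hom_lterm.intros 5)
  moreover have "hom_tm (1 + (p + 1)) (Brk (lcomp Gn 1 s) (lcomp Gn (p + 1) t))" by (intro hom_lterm.intros 5)
  ultimately show ?case by (simp add: ac_simps hom_lterm.intros)
qed (auto intro: hom_lterm.intros)

lemma lcomp_lterms: "t \<in> Tm \<Longrightarrow> lcomp Gn p t \<in> Tm"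
  by (rule hom_lterm_lterms) (rule hom_lcomp)

abbreviation "part p t \<equiv> cl (lcomp Gn p t)"

lemma part_closed [simp]: "t \<in> Tm \<Longrightarrow> part p t \<in> carrier Q"
  by (simp add: lcomp_lterms)

lemma part_Zero: "part p Zero = \<zero>\<^bsub>Q\<^esub>"
  by (simp add: cl_Zero)

lemma part_Add: "\<lbrakk>s \<in> Tm; t \<in> Tm\<rbrakk> \<Longrightarrow> part p (Add s t) = part p s \<oplus>\<^bsub>Q\<^esub> part p t"
  by (simp add: cl_Add lcomp_lterms)

lemma part_Smul: "\<lbrakk>r \<in> carrier R; t \<in> Tm\<rbrakk> \<Longrightarrow> part p (Smul r t) = r \<odot>\<^bsub>Q\<^esub> part p t"
  by (simp add: cl_Smul lcomp_lterms)

lemma part_Brk: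
  assumes "s \<in> Tm" "t \<in> Tm"
  shows "part p (Brk s t) =
    bracket Q (part 0 s) (part p t) \<oplus>\<^bsub>Q\<^esub> bracket Q (part 1 s) (part (p + 1) t)"
  using assms by (simp add: cl_Add cl_Brk lcomp_lterms lterms.intros)

lemmas part_simps = part_Zero part_Add part_Smul part_Brk

declare lcomp.simps [simp del]

lemma part_homogeneous: "hom_tm p t \<Longrightarrow> part q t = (if p = q then cl t else \<zero>\<^bsub>Q\<^esub>)"
proof (induction arbitrary: q rule: hom_lterm.induct)
  case (1 x p)
  then show ?case using gen_both_zero[of x] by (cases p; cases q) (auto simp: cl_Zero lcomp.simps)
next
  case (5 p s q' t)
  note tm = 5(1,2)[THEN hom_lterm_lterms]
  show ?case using 5(3,4) tm
    by (cases p; cases q; cases q') (simp_all add: part_simps cl_Brk)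
qed (auto simp: cl_Zero part_simps cl_Add cl_Smul hom_lterm_lterms)

lemma part_Brk_homogeneous:
  assumes "s \<in> Tm" "hom_tm p t"
  shows "part q (Brk s t) = bracket Q (part (q + p) s) (cl t)"
  using assms hom_lterm_lterms[OF assms(2)]
  by (cases p; cases q) (simp_all add: part_simps part_homogeneous[OF assms(2)])

text \<open>
  Both sides of a relation are homogeneous of the same degree.  The only other clause that needs an
  argument is the Leibniz identity: its second and third entry are homogeneous, so that
  the component of each side is the same side with the first entry replaced by one of its components, and the Leibniz identity of the quotient applies.
\<close>

lemma part_cong: "lcong R Gn Rel s t \<Longrightarrow> part p s = part p t"
proof (induction arbitrary: p rule: lcong.induct)
  case (rel s t)
  then obtain q where "hom_tm q s" "hom_tm q t" using rel_homogeneous by blast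
  moreover have "cl s = cl t" using rel by (intro lclass_eqI lcong.rel)
  ultimately show ?case by (simp add: part_homogeneous)
next
  case (leibniz s a t b u)
  note tm = leibniz(1) leibniz(2,3)[THEN hom_lterm_lterms]
  have "hom_tm (a + b) (Brk t u)" using leibniz by (intro hom_lterm.intros)
  note 1 = part_Brk_homogeneous[OF tm(1) this]
  note 2 = part_Brk_homogeneous[OF lterms.intros(5)[OF tm(1,2)] leibniz(3)]
    part_Brk_homogeneous[OF tm(1) leibniz(2)]
    part_Brk_homogeneous[OF lterms.intros(5)[OF tm(1,3)] leibniz(2)]
    part_Brk_homogeneous[OF tm(1) leibniz(3)]
  have h: "cl t \<in> hpart Q a" "cl u \<in> hpart Q b" using leibniz by (auto simp: Q_hpart)
  have "part p (Brk s (Brk t u)) = bracket Q (part (p + a + b) s) (bracket Q (cl t) (cl u))"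
    using tm by (simp add: 1 cl_Brk add.assoc)
  also have "\<dots> = bracket Q (bracket Q (part (p + a + b) s) (cl t)) (cl u) \<ominus>\<^bsub>Q\<^esub>
       sgn_of R (a * b) \<odot>\<^bsub>Q\<^esub> bracket Q (bracket Q (part (p + a + b) s) (cl u)) (cl t)"
    using tm h by (intro Q_leibniz) simp_all
  also have "\<dots> = part p (Add (Brk (Brk s t) u) (Smul (\<ominus> sgn_of R (a * b)) (Brk (Brk s u) t)))"
    using tm by (simp add: part_Add part_Smul lterms.intros 2 Q.smult_l_minus Q.M.minus_eq ac_simps)
  finally show ?case .
next
  case (cong_Brk s s' t t')
  then show ?case using cong_Brk.hyps[THEN lcong_lterms] by (simp add: part_simps)
next
  case (cong_Add s s' t t')
  then show ?case using cong_Add.hyps[THEN lcong_lterms] by (simp add: part_simps)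
next
  case (cong_Smul r t t')
  then show ?case using cong_Smul.hyps(2)[THEN lcong_lterms] by (simp add: part_simps)
qed (simp_all add: part_simps lterms.intros Q.M.a_ac Q.smult_l_distr Q.smult_r_distr
    Q.smult_assoc1 Q_brk_add Q_brk_smult Q.smult_l_minus Q.M.r_neg)

lemma part_sum: "t \<in> Tm \<Longrightarrow> part 0 t \<oplus>\<^bsub>Q\<^esub> part 1 t = cl t"
proof (induction rule: lterms.induct)
  case (1 x p)
  then show ?case
    using part_homogeneous[OF hom_lterm.intros(1)[of x Gn p]] by (cases p) (simp_all add: lterms.intros)
next
  case (5 s t)
  have "cl (Brk s t) = bracket Q (part 0 s \<oplus>\<^bsub>Q\<^esub> part 1 s) (part 0 t \<oplus>\<^bsub>Q\<^esub> part 1 t)"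
    using 5 by (simp add: cl_Brk)
  then show ?case
    using 5(1,2) by (simp add: part_simps Q_brk_add Q.M.a_ac)
next
  case (3 s t)
  have "part 0 (Add s t) \<oplus>\<^bsub>Q\<^esub> part 1 (Add s t) = (part 0 s \<oplus>\<^bsub>Q\<^esub> part 1 s) \<oplus>\<^bsub>Q\<^esub> (part 0 t \<oplus>\<^bsub>Q\<^esub> part 1 t)"
    using 3(1,2) by (simp add: part_simps Q.M.a_ac)
  then show ?case using 3 by (simp add: cl_Add)
qed (simp_all add: part_simps cl_Smul cl_Zero Q.smult_r_distr[symmetric])

lemma presented_leibniz_superalgebra: "leibniz_superalgebra R Q"
proof (intro leibniz_superalgebra.intro leibniz_superalgebra_axioms.intro supermoduleI Q_module Q_leibniz)
  have h: "x \<in> carrier Q" if "x \<in> hpart Q p" for x p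
    using that hom_lterm_lterms by (auto simp: Q_hpart)
  have hp: "cl t \<in> hpart Q p" if "hom_tm p t" for p t
    using that by (simp add: Q_hpart)
  have hpE: "\<exists>t. hom_tm p t \<and> x = cl t" if "x \<in> hpart Q p" for x p
    using that unfolding Q_hpart by blast
  show "submodule (hpart Q p) R Q" for p
  proof (rule Q.submoduleI)
    fix x assume x: "x \<in> hpart Q p"
    then obtain t where t: "hom_tm p t" "x = cl t" by (auto simp: Q_hpart)
    have "\<ominus>\<^bsub>Q\<^esub> x = cl (Smul (\<ominus> \<one>) t)"
      using t by (simp add: cl_Smul hom_lterm_lterms Q.smult_l_minus)
    moreover have "hom_tm p (Smul (\<ominus> \<one>) t)" using t by (intro hom_lterm.intros) auto
    ultimately show "\<ominus>\<^bsub>Q\<^esub> x \<in> hpart Q p" by (auto simp: Q_hpart)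
  next
    show "hpart Q p \<subseteq> carrier Q" using h by blast
    show "\<zero>\<^bsub>Q\<^esub> \<in> hpart Q p"
      unfolding Q_zero by (intro hp hom_lterm.intros)
  next
    fix x y assume "x \<in> hpart Q p" "y \<in> hpart Q p"
    then obtain s t where "hom_tm p s" "hom_tm p t" "x = cl s" "y = cl t" by (metis hpE)
    then show "x \<oplus>\<^bsub>Q\<^esub> y \<in> hpart Q p"
      by (simp add: Q_add hom_lterm_lterms hp hom_lterm.intros)
  next
    fix r x assume "r \<in> carrier R" "x \<in> hpart Q p"
    then obtain t where "r \<in> carrier R" "hom_tm p t" "x = cl t" by (metis hpE)
    then show "r \<odot>\<^bsub>Q\<^esub> x \<in> hpart Q p"
      by (simp add: Q_smult hom_lterm_lterms hp hom_lterm.intros)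
  qed
  show "\<exists>y\<in>hpart Q 0. \<exists>z\<in>hpart Q 1. x = y \<oplus>\<^bsub>Q\<^esub> z" if x: "x \<in> carrier Q" for x
  proof -
    obtain t where t: "t \<in> Tm" "x = cl t" using x unfolding Q_carrier by blast
    then show ?thesis using part_sum[OF t(1)] hom_lcomp[OF t(1)]
      by (intro bexI[of _ "part 0 t"] bexI[of _ "part 1 t"]) (simp_all add: hp)
  qed
  show "x = \<zero>\<^bsub>Q\<^esub>" if x: "x \<in> hpart Q 0" "x \<in> hpart Q 1" for x
  proof -
    obtain s where s: "hom_tm 0 s" "x = cl s" using x(1) hpE by blast
    obtain t where t: "hom_tm 1 t" "x = cl t" using x(2) hpE by blast
    note st = s(1) t(1) s(2) t(2)
    have "part 0 s = part 0 t"
      using st lclass_eq_iff[of s t] by (intro part_cong) (simp add: hom_lterm_lterms[OF st(1)])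
    then show ?thesis using st by (simp add: part_homogeneous)
  qed
  show "even_bilinear R Q (bracket Q)"
  proof (rule even_bilinearI)
    fix p q x y assume "x \<in> hpart Q p" "y \<in> hpart Q q"
    then obtain s t where "hom_tm p s" "hom_tm q t" "x = cl s" "y = cl t" by (metis hpE)
    then show "bracket Q x y \<in> hpart Q (p + q)"
      by (simp add: Q_brk hom_lterm_lterms hp hom_lterm.intros)
  qed (simp_all add: Q_brk_add Q_brk_smult)
qed

lemma presented_homogeneous_induct [consumes 1, case_names gen zero add smult bracket]:
  assumes "x \<in> hpart Q p"
    and gen: "\<And>g p. g \<in> Gn p \<Longrightarrow> P p (cl (Gen g))"
    and zero: "\<And>p. P p \<zero>\<^bsub>Q\<^esub>"
    and add: "\<And>p x y. \<lbrakk>x \<in> hpart Q p; y \<in> hpart Q p; P p x; P p y\<rbrakk> \<Longrightarrow> P p (x \<oplus>\<^bsub>Q\<^esub> y)"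
    and smult: "\<And>p r x. \<lbrakk>r \<in> carrier R; x \<in> hpart Q p; P p x\<rbrakk> \<Longrightarrow> P p (r \<odot>\<^bsub>Q\<^esub> x)"
    and bracket: "\<And>p q x y. \<lbrakk>x \<in> hpart Q p; y \<in> hpart Q q; P p x; P q y\<rbrakk> \<Longrightarrow> P (p + q) (bracket Q x y)"
  shows "P p x"
proof -
  have hp: "cl t \<in> hpart Q p" if "hom_tm p t" for p t
    using that by (simp add: Q_hpart)
  have "P p (cl t)" if "hom_tm p t" for p t
    using that by (induction rule: hom_lterm.induct)
      (simp_all add: gen zero add smult bracket hp hom_lterm_lterms cl_Zero cl_Add cl_Smul cl_Brk)
  then show ?thesis using assms(1) unfolding Q_hpart by blast
qed

text \<open>
  By the Leibniz identity, a bracket with a bracket is a combination of iterated right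
  multiplications.  A submodule that contains the generators and is closed under right
  multiplication by generators is therefore everything.
\<close>

lemma presented_right_span:
  assumes W: "submodule W R Q"
    and gen: "\<And>g p. g \<in> Gn p \<Longrightarrow> cl (Gen g) \<in> W"
    and right: "\<And>w g p. \<lbrakk>w \<in> W; g \<in> Gn p\<rbrakk> \<Longrightarrow> bracket Q w (cl (Gen g)) \<in> W"
  shows "carrier Q \<subseteq> W"
proof -
  interpret L: leibniz_superalgebra R Q by (rule presented_leibniz_superalgebra)
  note sub = Q.submoduleE[OF W] subgroup.one_closed[OF submodule.axioms(1)[OF W], simplified]
  have cW: "w \<in> carrier Q" if "w \<in> W" for w using that sub(1) by blast
  have rhom: "\<forall>w \<in> W. bracket Q w x \<in> W" if "x \<in> hpart Q p" for x p
    using that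
  proof (induction rule: presented_homogeneous_induct)
    case (bracket p q x y)
    show ?case
    proof
      fix w assume "w \<in> W"
      then show "bracket Q w (bracket Q x y) \<in> W"
        using bracket by (simp add: L.leibniz[OF cW] Q.M.minus_eq sub)
    qed
  qed (auto simp: right cW sub L.brk.add_r L.brk.smult_r L.hpart_closed)
  have r: "\<forall>w \<in> W. bracket Q w x \<in> W" if "x \<in> carrier Q" for x
    using that
  proof (induction rule: L.homogeneous_induct)
    case (hom p x)
    then show ?case by (rule rhom)
  qed (simp add: L.brk.add_r sub cW)
  have "cl t \<in> W" if "t \<in> Tm" for t
    using that by (induction rule: lterms.induct) (simp_all add: gen sub r cl_Zero cl_Add cl_Smul cl_Brk)
  then show ?thesis by (auto simp: Q_carrier)
qed

lemma presented_hom_exists: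
  assumes M: "leibniz_superalgebra R M"
    and g: "\<And>x p. x \<in> Gn p \<Longrightarrow> g x \<in> hpart M p"
    and rel: "\<And>s t. \<lbrakk>(s, t) \<in> Rel; s \<in> Tm; t \<in> Tm\<rbrakk> \<Longrightarrow> leval M g s = leval M g t"
  obtains f where "f \<in> leibniz_hom R Q M" "\<And>x p. x \<in> Gn p \<Longrightarrow> f (cl (Gen x)) = g x"
proof -
  interpret M: leibniz_superalgebra R M by fact
  have hp: "leval M g t \<in> hpart M p" if "hom_tm p t" for p t
    using that by (induction rule: hom_lterm.induct) (simp_all add: g M.hpart_add M.hpart_smult M.brk.hpart)
  have tm: "leval M g t \<in> carrier M" if "t \<in> Tm" for t
    using that
  proof (induction rule: lterms.induct)
    case (1 x p)
    then show ?case using M.hpart_closed[OF g] by simp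
  qed simp_all
  have cong: "leval M g s = leval M g t" if "lcong R Gn Rel s t" for s t
    using that
  proof (induction rule: lcong.induct)
    case (leibniz s p t q u)
    then show ?case using M.leibniz[OF tm[OF leibniz(1)] hp[OF leibniz(2)] hp[OF leibniz(3)]]
      by (simp add: tm hom_lterm_lterms M.smult_l_minus M.M.minus_eq)
  next
    case (rel s t)
    then show ?case by (rule assms(3))
  qed (simp_all add: tm M.M.a_ac M.smult_l_distr M.smult_r_distr
    M.smult_assoc1 M.brk.add_l M.brk.add_r M.brk.smult_l M.brk.smult_r M.smult_l_minus M.M.r_neg)
  define f where "f A = leval M g (SOME t. t \<in> A)" for A
  have f: "f (cl t) = leval M g t" if "t \<in> Tm" for t
    unfolding f_def by (rule someI2[of "\<lambda>u. u \<in> cl t", OF lclass_self[OF that]]) (metis cong lclass_memD)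
  show thesis
  proof (rule that)
    show "f \<in> leibniz_hom R Q M"
      unfolding leibniz_hom_def
    proof (intro CollectI conjI ballI allI)
      show "f \<in> carrier Q \<rightarrow> carrier M" by (auto simp: Q_carrier f tm)
      show "f ` hpart Q p \<subseteq> hpart M p" for p
        using f hp hom_lterm_lterms by (auto simp: Q_hpart)
      fix x y assume "x \<in> carrier Q" "y \<in> carrier Q"
      then obtain s t where "s \<in> Tm" "t \<in> Tm" "x = cl s" "y = cl t" by (auto simp: Q_carrier)
      then show "f (x \<oplus>\<^bsub>Q\<^esub> y) = f x \<oplus>\<^bsub>M\<^esub> f y" "f (bracket Q x y) = bracket M (f x) (f y)"
        by (simp_all add: Q_add Q_brk f lterms.intros)
    next
      fix r x assume "r \<in> carrier R" "x \<in> carrier Q"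
      then show "f (r \<odot>\<^bsub>Q\<^esub> x) = r \<odot>\<^bsub>M\<^esub> f x"
        by (auto simp: Q_carrier Q_smult f lterms.intros)
    qed
    show "f (cl (Gen x)) = g x" if "x \<in> Gn p" for x p
      using that by (simp add: f lterms.intros)
  qed
qed

lemma presented_hom_unique:
  assumes M: "leibniz_superalgebra R M"
    and f: "f \<in> leibniz_hom R Q M" and f': "f' \<in> leibniz_hom R Q M"
    and gen: "\<And>x p. x \<in> Gn p \<Longrightarrow> f (cl (Gen x)) = f' (cl (Gen x))"
    and "x \<in> carrier Q"
  shows "f x = f' x"
proof -
  interpret M: leibniz_superalgebra R M by fact
  have "supermodule R Q" by (rule leibniz_superalgebra.axioms(1)[OF presented_leibniz_superalgebra])
  note z = leibniz_hom_zero[OF _ this M.supermodule_axioms]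
  have "f (cl t) = f' (cl t)" if "t \<in> Tm" for t
    using that
  proof (induction rule: lterms.induct)
    case (1 g p) then show ?case by (rule gen)
  next
    case 2 then show ?case using z[OF f] z[OF f'] by (simp add: cl_Zero)
  next
    case (3 s t) then show ?case using leibniz_hom_add[OF f] leibniz_hom_add[OF f'] by (simp add: cl_Add)
  next
    case (4 r t) then show ?case using leibniz_hom_smult[OF f] leibniz_hom_smult[OF f'] by (simp add: cl_Smul)
  next
    case (5 s t) then show ?case using leibniz_hom_bracket[OF f] leibniz_hom_bracket[OF f'] by (simp add: cl_Brk)
  qed
  then show ?thesis using assms(5) by (auto simp: Q_carrier)
qed

end

section \<open>The Steinberg Leibniz superalgebra and its map to \<open>sl\<close>\<close>

context steinberg
begin

abbreviation "T \<equiv> stl R m n D"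
abbreviation "F \<equiv> stl_F R m n D"
abbreviation "gens \<equiv> stl_gens m n D"
abbreviation "rels \<equiv> stl_rels R m n D"

lemma gens_iff: "(i, j, a) \<in> gens p \<longleftrightarrow> i \<in> I \<and> j \<in> I \<and> i \<noteq> j \<and> a \<in> hpart D (dg i + dg j + p)"
  by (simp add: stl_gens_def)

lemma gens_lprod:
  assumes "(i, j, a) \<in> gens p" "(j, l, b) \<in> gens q" "i \<noteq> l"
  shows "(i, l, a \<stileturn>\<^bsub>D\<^esub> b) \<in> gens (p + q)"
proof -
  have "a \<stileturn>\<^bsub>D\<^esub> b \<in> hpart D (dg i + dg j + p + (dg j + dg l + q))"
    using assms by (intro l.hpart) (auto simp: gens_iff)
  moreover have "dg i + dg j + p + (dg j + dg l + q) = dg i + dg l + (p + q)" by (simp add: ac_simps)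
  ultimately show ?thesis using assms by (auto simp: gens_iff)
qed

lemma gens_rprod:
  assumes "(i, j, a) \<in> gens p" "(k, i, b) \<in> gens q" "j \<noteq> k"
  shows "(k, j, b \<turnstile>\<^bsub>D\<^esub> a) \<in> gens (p + q)"
proof -
  have "b \<turnstile>\<^bsub>D\<^esub> a \<in> hpart D (dg k + dg i + q + (dg i + dg j + p))"
    using assms by (intro r.hpart) (auto simp: gens_iff)
  moreover have "dg k + dg i + q + (dg i + dg j + p) = dg k + dg j + (p + q)" by (simp add: ac_simps)
  ultimately show ?thesis using assms by (auto simp: gens_iff)
qed

sublocale P: leibniz_presentation R gens rels
proof -
  interpret P0: leibniz_terms R gens rels by unfold_locales
  show "leibniz_presentation R gens rels"
  proof (intro leibniz_presentation.intro leibniz_presentation_axioms.intro P0.leibniz_terms_axioms)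
    fix s t assume "(s, t) \<in> rels"
    then show "\<exists>p. hom_lterm R gens p s \<and> hom_lterm R gens p t"
    proof (cases rule: stl_rels.cases)
      case (F_add i j a p b)
      then have "(i, j, a \<oplus>\<^bsub>D\<^esub> b) \<in> gens p" by (auto simp: gens_iff hpart_add)
      then show ?thesis using F_add by (auto intro!: exI[of _ p] hom_lterm.intros)
    next
      case (F_smul r i j a p)
      then have "(i, j, r \<odot>\<^bsub>D\<^esub> a) \<in> gens p" by (auto simp: gens_iff hpart_smult)
      then show ?thesis using F_smul by (auto intro!: exI[of _ p] hom_lterm.intros)
    next
      case (F_left i j a p k l b q)
      then show ?thesis
        using gens_lprod by (intro exI[of _ "p + q"]) (auto intro!: hom_lterm.intros)
    next
      case (F_right i j a p k l b q)
      then show ?thesis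
        using gens_rprod by (intro exI[of _ "p + q"]) (auto intro!: hom_lterm.intros)
    next
      case (F_zero i j a p k l b q)
      then show ?thesis by (intro exI[of _ "p + q"]) (auto intro!: hom_lterm.intros)
    qed
  next
    fix x assume x: "x \<in> gens 0" "x \<in> gens 1"
    obtain i j a where ija: "x = (i, j, a)" by (cases x)
    have "dg i + dg j \<noteq> dg i + dg j + 1" by (cases "dg i + dg j") simp_all
    then have a: "a = \<zero>\<^bsub>D\<^esub>"
      using x hpart_disjoint[of a "dg i + dg j" "dg i + dg j + 1"] by (simp add: ija gens_iff)
    have tm: "Gen x \<in> lterms R gens" using x by (intro lterms.intros)
    have "(Gen (i, j, \<zero> \<odot>\<^bsub>D\<^esub> a), Smul \<zero> (Gen (i, j, a))) \<in> rels"
      using x by (intro stl_rels.F_smul) (auto simp: ija)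
    then have "(Gen x, Smul \<zero> (Gen x)) \<in> rels" by (simp add: ija a)
    then have "lcong R gens rels (Gen x) (Smul \<zero> (Gen x))"
      by (rule lcong.rel) (use tm in \<open>auto intro: lterms.intros\<close>)
    then have "lclass R gens rels (Gen x) = lclass R gens rels (Smul \<zero> (Gen x))"
      by (rule P0.lclass_eqI)
    then show "lclass R gens rels (Gen x) = \<zero>\<^bsub>presented_leibniz R gens rels\<^esub>"
      using tm by (simp add: P0.cl_Smul)
  qed
qed

sublocale T: leibniz_superalgebra R T
  unfolding stl_def by (rule P.presented_leibniz_superalgebra)

lemma F_eq: "lclass R gens rels (Gen (i, j, a)) = F i j a"
  by (simp add: stl_F_def)

lemma rel_eq:
  assumes "(s, t) \<in> rels" "s \<in> P.Tm" "t \<in> P.Tm"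
  shows "P.cl s = P.cl t"
  using assms by (intro P.lclass_eqI lcong.rel)

lemma F_hpart: "(i, j, a) \<in> gens p \<Longrightarrow> F i j a \<in> hpart T p"
  unfolding stl_def F_eq[symmetric] by (simp add: P.Q_hpart hom_lterm.intros)

lemma F_closed: "(i, j, a) \<in> gens p \<Longrightarrow> F i j a \<in> carrier T"
  by (rule T.hpart_closed) (rule F_hpart)

lemma F_add:
  assumes "(i, j, a) \<in> gens p" "(i, j, b) \<in> gens p"
  shows "F i j (a \<oplus>\<^bsub>D\<^esub> b) = F i j a \<oplus>\<^bsub>T\<^esub> F i j b"
proof -
  have "(i, j, a \<oplus>\<^bsub>D\<^esub> b) \<in> gens p" using assms by (auto simp: gens_iff hpart_add)
  then show ?thesis
    unfolding stl_def F_eq[symmetric]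
    using rel_eq[OF stl_rels.F_add[OF assms]] assms by (simp add: lterms.intros P.cl_Add)
qed

lemma F_smult:
  assumes "r \<in> carrier R" "(i, j, a) \<in> gens p"
  shows "F i j (r \<odot>\<^bsub>D\<^esub> a) = r \<odot>\<^bsub>T\<^esub> F i j a"
proof -
  have "(i, j, r \<odot>\<^bsub>D\<^esub> a) \<in> gens p" using assms by (auto simp: gens_iff hpart_smult)
  then show ?thesis
    unfolding stl_def F_eq[symmetric]
    using rel_eq[OF stl_rels.F_smul[OF assms]] assms by (simp add: lterms.intros P.cl_Smul)
qed

lemma F_left:
  assumes "(i, j, a) \<in> gens p" "(j, l, b) \<in> gens q" "i \<noteq> l"
  shows "bracket T (F i j a) (F j l b) = F i l (a \<stileturn>\<^bsub>D\<^esub> b)"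
  unfolding stl_def F_eq[symmetric]
  using rel_eq[OF stl_rels.F_left[OF assms HOL.refl]] assms gens_lprod[OF assms]
  by (simp add: lterms.intros P.cl_Brk)

lemma F_right:
  assumes "(i, j, a) \<in> gens p" "(k, i, b) \<in> gens q" "j \<noteq> k"
  shows "bracket T (F i j a) (F k i b) = (\<ominus> sgn_of R (p * q)) \<odot>\<^bsub>T\<^esub> F k j (b \<turnstile>\<^bsub>D\<^esub> a)"
  unfolding stl_def F_eq[symmetric]
  using rel_eq[OF stl_rels.F_right[OF assms(1,2) HOL.refl assms(3)]] assms gens_rprod[OF assms]
  by (simp add: lterms.intros P.cl_Brk P.cl_Smul)

lemma F_commute:
  assumes "(i, j, a) \<in> gens p" "(k, l, b) \<in> gens q" "i \<noteq> l" "j \<noteq> k"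
  shows "bracket T (F i j a) (F k l b) = \<zero>\<^bsub>T\<^esub>"
  unfolding stl_def F_eq[symmetric]
  using rel_eq[OF stl_rels.F_zero[OF assms]] assms
  by (simp add: lterms.intros P.cl_Brk P.cl_Zero)

lemma third_index:
  assumes "i \<in> I" "j \<in> I"
  obtains k where "k \<in> I" "k \<noteq> i" "k \<noteq> j"
proof -
  have "card {i, j} \<le> 2" by (simp add: card_insert_if)
  then have "card {i, j} < card I" using rank by simp
  then have "\<not> I \<subseteq> {i, j}" using card_mono[of "{i, j}" I] by auto
  then show thesis using that by blast
qed

lemma one_gens: "\<lbrakk>i \<in> I; j \<in> I; i \<noteq> j\<rbrakk> \<Longrightarrow> (i, j, \<one>\<^bsub>D\<^esub>) \<in> gens (dg i + dg j)"
  by (simp add: gens_iff bar_unit_even)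

lemma gens_shift: "\<lbrakk>(i, j, a) \<in> gens p; k \<in> I; k \<noteq> i\<rbrakk> \<Longrightarrow> (i, k, a) \<in> gens (dg k + dg j + p)"
  by (auto simp: gens_iff ac_simps)

text \<open>This is what makes \<open>stl\<close> perfect, by the law \<open>a \<stileturn> 1 = a\<close>.\<close>

lemma F_factor:
  assumes "(i, j, a) \<in> gens p" "k \<in> I" "k \<noteq> i" "k \<noteq> j"
  shows "F i j a = bracket T (F i k a) (F k j \<one>\<^bsub>D\<^esub>)"
proof -
  have "a \<in> carrier D" "i \<noteq> j" "j \<in> I" using assms hpart_closed by (auto simp: gens_iff)
  then show ?thesis
    using F_left[OF gens_shift[OF assms(1-3)] one_gens[of k j]] assms by (simp add: bar_unit_right)
qed

lemma gensD: "(i, j, a) \<in> gens p \<Longrightarrow> i \<in> I \<and> j \<in> I \<and> i \<noteq> j \<and> a \<in> hpart D (dg i + dg j + p) \<and> a \<in> carrier D"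
  using hpart_closed by (auto simp: gens_iff)

text \<open>
  Right multiplication by \<open>E k k 1\<close> is diagonal on off-diagonal matrix units: the bar-unit laws
  \<open>a \<stileturn> 1 = a\<close> and \<open>1 \<turnstile> a = a\<close> are the ones that a right action involves.
\<close>

lemma E_bracket_diag:
  assumes "i \<in> I" "j \<in> I" "i \<noteq> j" "a \<in> hpart D p" "k \<in> I"
  shows "bracket G (E i j a) (E k k \<one>\<^bsub>D\<^esub>) =
    (if k = j then E i j a else if k = i then \<ominus>\<^bsub>G\<^esub> E i j a else \<zero>\<^bsub>G\<^esub>)"
proof -
  have a: "a \<in> carrier D" using assms hpart_closed by blast
  have "bracket G (E i j a) (E k k \<one>\<^bsub>D\<^esub>) =
    (if j = k then E i k (a \<stileturn>\<^bsub>D\<^esub> \<one>\<^bsub>D\<^esub>) else \<zero>\<^bsub>G\<^esub>) \<ominus>\<^bsub>G\<^esub>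
    (if k = i then sgn_of R ((dg i + dg j + p) * 0) \<odot>\<^bsub>G\<^esub> E k j (\<one>\<^bsub>D\<^esub> \<turnstile>\<^bsub>D\<^esub> a) else \<zero>\<^bsub>G\<^esub>)"
    using assms bar_unit_even by (intro bracket_E) (simp_all add: ac_simps)
  then show ?thesis
    using assms a by (auto simp: bar_unit_left bar_unit_right G.M.minus_eq)
qed

lemma E_derived:
  assumes "(i, j, a) \<in> gens p"
  shows "E i j a \<in> derived_set R G"
  using gensD[OF assms] E_bracket_diag[of i j a "dg i + dg j + p" j]
    G.derived_set_bracket[of "E i j a" "E j j \<one>\<^bsub>D\<^esub>"] by simp

lemma E_hpart_S: "(i, j, a) \<in> gens p \<Longrightarrow> E i j a \<in> hpart S p"
  using E_hpart[of a _ i j p] E_derived[of i j a p] gensD[of i j a p] by simp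

lemma E_left:
  assumes "(i, j, a) \<in> gens p" "(j, l, b) \<in> gens q" "i \<noteq> l"
  shows "bracket G (E i j a) (E j l b) = E i l (a \<stileturn>\<^bsub>D\<^esub> b)"
  using gensD[OF assms(1)] gensD[OF assms(2)] assms(3) bracket_E[of a i j p b j l q]
  by (simp add: G.M.minus_eq)

lemma E_right:
  assumes "(i, j, a) \<in> gens p" "(k, i, b) \<in> gens q" "j \<noteq> k"
  shows "bracket G (E i j a) (E k i b) = (\<ominus> sgn_of R (p * q)) \<odot>\<^bsub>G\<^esub> E k j (b \<turnstile>\<^bsub>D\<^esub> a)"
  using gensD[OF assms(1)] gensD[OF assms(2)] assms(3) bracket_E[of a i j p b k i q]
  by (simp add: G.M.minus_eq G.smult_l_minus)

lemma E_commute: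
  assumes "(i, j, a) \<in> gens p" "(k, l, b) \<in> gens q" "i \<noteq> l" "j \<noteq> k"
  shows "bracket G (E i j a) (E k l b) = \<zero>\<^bsub>G\<^esub>"
  using gensD[OF assms(1)] gensD[OF assms(2)] assms(3,4) bracket_E[of a i j p b k l q]
  by (simp add: G.M.minus_eq)

lemma canonical_hom_exists: "\<exists>\<phi>. canonical_hom R m n D \<phi>"
proof -
  define g where "g = (\<lambda>(i, j, a). E i j a)"
  have g: "g x \<in> hpart S p" if "x \<in> gens p" for x p
    using that E_hpart_S by (cases x) (auto simp: g_def simp del: S_simps)
  have rel: "leval S g s = leval S g t" if "(s, t) \<in> rels" for s t
    using that
  proof (cases rule: stl_rels.cases)
    case (F_add i j a p b)
    then show ?thesis using gensD[OF F_add(3)] gensD[OF F_add(4)] by (simp add: g_def E_add)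
  next
    case (F_smul r i j a p)
    then show ?thesis using gensD[OF F_smul(4)] by (simp add: g_def E_smult)
  next
    case (F_left i j a p k l b q)
    then show ?thesis using E_left by (simp add: g_def)
  next
    case (F_right i j a p k l b q)
    then show ?thesis using E_right by (simp add: g_def)
  next
    case (F_zero i j a p k l b q)
    then show ?thesis using E_commute by (simp add: g_def)
  qed
  obtain f where f: "f \<in> leibniz_hom R T S" "\<And>x p. x \<in> gens p \<Longrightarrow> f (P.cl (Gen x)) = g x"
    using P.presented_hom_exists[OF S.leibniz_superalgebra_axioms g rel, folded stl_def] by blast
  have "f (F i j a) = E i j a" if ij: "i \<in> I" "j \<in> I" "i \<noteq> j" "a \<in> hpart D 0 \<union> hpart D 1" for i j a
  proof -
    obtain p where "a \<in> hpart D p" using ij(4) by blast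
    then have "(i, j, a) \<in> gens (dg i + dg j + p)" using ij by (simp add: gens_iff)
    from f(2)[OF this] show ?thesis by (simp add: F_eq g_def)
  qed
  then show ?thesis using f(1) unfolding canonical_hom_def by blast
qed

end

locale steinberg_hom = steinberg +
  fixes \<phi>
  assumes canonical: "canonical_hom R m n D \<phi>"
begin

lemma phi: "\<phi> \<in> leibniz_hom R T S"
  using canonical by (simp add: canonical_hom_def)

lemma phi_F: "(i, j, a) \<in> gens p \<Longrightarrow> \<phi> (F i j a) = E i j a"
proof -
  assume g: "(i, j, a) \<in> gens p"
  have "a \<in> hpart D 0 \<union> hpart D 1"
    using g by (cases "dg i + dg j + p") (auto simp: gens_iff)
  then show ?thesis using g canonical by (auto simp: canonical_hom_def gens_iff)
qed

lemmas phi_closed = leibniz_hom_closed[OF phi, unfolded S_simps]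
  and phi_add = leibniz_hom_add[OF phi, unfolded S_simps]
  and phi_smult = leibniz_hom_smult[OF phi, unfolded S_simps]
  and phi_bracket = leibniz_hom_bracket[OF phi, unfolded S_simps]
  and phi_zero = leibniz_hom_zero[OF phi T.supermodule_axioms S.supermodule_axioms, unfolded S_simps]

abbreviation "N \<equiv> \<phi> ` carrier T"

lemma N_submodule: "submodule N R G"
proof (rule G.submoduleI')
  show "N \<subseteq> carrier G" using phi_closed G.derived_set_closed by blast
  show "\<zero>\<^bsub>G\<^esub> \<in> N" using phi_zero[symmetric] T.M.zero_closed by blast
  show "x \<oplus>\<^bsub>G\<^esub> y \<in> N" if "x \<in> N" "y \<in> N" for x y
    using that phi_add[symmetric] by auto
  show "r \<odot>\<^bsub>G\<^esub> x \<in> N" if "r \<in> carrier R" "x \<in> N" for r x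
    using that phi_smult[symmetric] by auto
qed

lemma E_in_N: "(i, j, a) \<in> gens p \<Longrightarrow> E i j a \<in> N"
  using phi_F[of i j a p] F_closed[of i j a p] by (metis image_eqI)

lemma E_bracket_in_N:
  assumes "(i, j, a) \<in> gens p" "(k, l, b) \<in> gens q"
  shows "bracket G (E i j a) (E k l b) \<in> N"
  using phi_bracket[of "F i j a" "F k l b"] F_closed[OF assms(1)] F_closed[OF assms(2)]
    phi_F[OF assms(1)] phi_F[OF assms(2)] T.brk.closed
  by (metis image_eqI)

text \<open>
  The element is the bracket of \<open>E i i a\<close> and \<open>E i i b\<close>.  For another index \<open>j\<close>, the bracket of
  \<open>E j i a\<close> and \<open>E i j b\<close> and that of \<open>E j i (a \<stileturn> b)\<close> and \<open>E i j 1\<close> have the same entry in position \<open>(j, j)\<close>, and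
  their difference is the element up to sign.
\<close>

lemma diagonal_in_N:
  assumes i: "i \<in> I" and a: "a \<in> hpart D p" and b: "b \<in> hpart D q"
  shows "E i i (a \<stileturn>\<^bsub>D\<^esub> b) \<ominus>\<^bsub>G\<^esub> sgn_of R (p * q) \<odot>\<^bsub>G\<^esub> E i i (b \<turnstile>\<^bsub>D\<^esub> a) \<in> N"
proof -
  obtain j where j: "j \<in> I" "j \<noteq> i" using third_index[OF i i] by blast
  have c: "a \<in> carrier D" "b \<in> carrier D" using a b hpart_closed by auto
  define d where "d = dg i + dg j"
  have ab: "a \<stileturn>\<^bsub>D\<^esub> b \<in> hpart D (p + q)" using a b by (rule l.hpart)
  have g: "(j, i, a) \<in> gens (d + p)" "(i, j, b) \<in> gens (d + q)"
    "(j, i, a \<stileturn>\<^bsub>D\<^esub> b) \<in> gens (d + (p + q))" "(i, j, \<one>\<^bsub>D\<^esub>) \<in> gens d"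
    using i j a b ab bar_unit_even by (auto simp: gens_iff d_def ac_simps)
  define X Y Z where "X = E j j (a \<stileturn>\<^bsub>D\<^esub> b)" and "Y = E i i (b \<turnstile>\<^bsub>D\<^esub> a)" and "Z = E i i (a \<stileturn>\<^bsub>D\<^esub> b)"
  have XYZ: "X \<in> carrier G" "Y \<in> carrier G" "Z \<in> carrier G"
    using i j c by (simp_all add: X_def Y_def Z_def)
  have u: "bracket G (E j i a) (E i j b) = X \<ominus>\<^bsub>G\<^esub> sgn_of R ((d + p) * (d + q)) \<odot>\<^bsub>G\<^esub> Y"
    using bracket_E[of a j i "d + p" b i j "d + q"] gensD[OF g(1)] gensD[OF g(2)]
    by (simp add: X_def Y_def)
  have v: "bracket G (E j i (a \<stileturn>\<^bsub>D\<^esub> b)) (E i j \<one>\<^bsub>D\<^esub>) = X \<ominus>\<^bsub>G\<^esub> sgn_of R ((d + (p + q)) * d) \<odot>\<^bsub>G\<^esub> Z"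
    using bracket_E[of "a \<stileturn>\<^bsub>D\<^esub> b" j i "d + (p + q)" "\<one>\<^bsub>D\<^esub>" i j d] gensD[OF g(3)] gensD[OF g(4)]
    by (simp add: X_def Z_def bar_unit_left bar_unit_right)
  note sub = G.submoduleE[OF N_submodule]
  have "(X \<ominus>\<^bsub>G\<^esub> sgn_of R ((d + p) * (d + q)) \<odot>\<^bsub>G\<^esub> Y) \<ominus>\<^bsub>G\<^esub> (X \<ominus>\<^bsub>G\<^esub> sgn_of R ((d + (p + q)) * d) \<odot>\<^bsub>G\<^esub> Z) \<in> N"
    using E_bracket_in_N[OF g(1,2)] E_bracket_in_N[OF g(3,4)] unfolding u v
    by (simp add: a_minus_def[of G "X \<ominus>\<^bsub>G\<^esub> _"] sub)
  then have "sgn_of R ((d + (p + q)) * d) \<odot>\<^bsub>G\<^esub> (sgn_of R ((d + (p + q)) * d) \<odot>\<^bsub>G\<^esub> Z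
      \<ominus>\<^bsub>G\<^esub> sgn_of R ((d + p) * (d + q)) \<odot>\<^bsub>G\<^esub> Y) \<in> N"
    using XYZ by (intro sub(4)) (simp_all add: G.M.diff_diff_cancel)
  moreover have "sgn_of R ((d + (p + q)) * d) \<odot>\<^bsub>G\<^esub> (sgn_of R ((d + (p + q)) * d) \<odot>\<^bsub>G\<^esub> Z
      \<ominus>\<^bsub>G\<^esub> sgn_of R ((d + p) * (d + q)) \<odot>\<^bsub>G\<^esub> Y) = Z \<ominus>\<^bsub>G\<^esub> sgn_of R (p * q) \<odot>\<^bsub>G\<^esub> Y"
    using XYZ by (cases d; cases p; cases q)
      (simp_all add: G.smult_neg_one G.M.minus_eq G.M.minus_add G.smult_r_minus)
  ultimately show ?thesis by (simp add: Y_def Z_def)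
qed

lemma bracket_units_in_N:
  assumes ij: "i \<in> I" "j \<in> I" and a: "a \<in> hpart D (dg i + dg j + p)"
    and kl: "k \<in> I" "l \<in> I" and b: "b \<in> hpart D (dg k + dg l + q)"
  shows "bracket G (E i j a) (E k l b) \<in> N"
proof -
  have c: "a \<in> carrier D" "b \<in> carrier D" using a b hpart_closed by auto
  note sub = G.submoduleE[OF N_submodule] subgroup.one_closed[OF submodule.axioms(1)[OF N_submodule], simplified]
  note br = bracket_E[OF a b ij kl]
  show ?thesis
  proof (cases "j = k \<and> l = i")
    case True
    show ?thesis
    proof (cases "i = j")
      case True
      then show ?thesis
        using \<open>j = k \<and> l = i\<close> diagonal_in_N[OF ij(1), of a p b q] a b br by simp
    next
      case False
      then show ?thesis using E_bracket_in_N[of i j a p k l b q] a b ij kl \<open>j = k \<and> l = i\<close> by (auto simp: gens_iff)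
    qed
  next
    case False
    have 1: "E i l (a \<stileturn>\<^bsub>D\<^esub> b) \<in> N" if "j = k"
    proof -
      have "a \<stileturn>\<^bsub>D\<^esub> b \<in> hpart D (dg i + dg j + p + (dg k + dg l + q))" by (rule l.hpart[OF a b])
      then have "(i, l, a \<stileturn>\<^bsub>D\<^esub> b) \<in> gens (p + q)"
        using that False ij kl by (auto simp: gens_iff ac_simps)
      then show ?thesis by (rule E_in_N)
    qed
    have 2: "E k j (b \<turnstile>\<^bsub>D\<^esub> a) \<in> N" if "l = i"
    proof -
      have "b \<turnstile>\<^bsub>D\<^esub> a \<in> hpart D (dg k + dg l + q + (dg i + dg j + p))" by (rule r.hpart[OF b a])
      then have "(k, j, b \<turnstile>\<^bsub>D\<^esub> a) \<in> gens (p + q)"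
        using that False ij kl by (auto simp: gens_iff ac_simps)
      then show ?thesis by (rule E_in_N)
    qed
    show ?thesis unfolding br a_minus_def using 1 2 by (auto intro!: sub(3,4,5) simp: sub)
  qed
qed

lemma phi_surjective: "\<phi> ` carrier T = carrier S"
proof
  show "N \<subseteq> carrier S" using phi_closed by auto
  note sub = G.submoduleE[OF N_submodule] subgroup.one_closed[OF submodule.axioms(1)[OF N_submodule], simplified]
  have "bracket G x y \<in> N" if x: "x \<in> carrier G" and y: "y \<in> carrier G" for x y
    using x
  proof (induction rule: gl_induct)
    case (unit p i j a)
    then have E: "E i j a \<in> carrier G" using hpart_closed by simp
    from y show ?case
    proof (induction rule: gl_induct)
      case (unit q k l b)
      then show ?case using \<open>i \<in> I\<close> \<open>j \<in> I\<close> \<open>a \<in> _\<close> by (intro bracket_units_in_N)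
    next
      case (add u v)
      then show ?case using E G.brk.add_r[of u v "E i j a"] sub(5) by simp
    next
      case zero
      show ?case using E G.brk.zero_r[of "E i j a"] sub(7) by simp
    qed
  next
    case (add u v)
    then show ?case using y G.brk.add_l[of u v y] sub(5) by simp
  next
    case zero
    show ?case using y G.brk.zero_l[of y] sub(7) by simp
  qed
  then have "derived_set R G \<subseteq> N" by (intro G.derived_set_least N_submodule)
  then show "carrier S \<subseteq> N" by simp
qed

end

section \<open>The kernel of the canonical map is central\<close>

lemma (in leibniz_superalgebra) leibniz_left:
  assumes "x \<in> carrier L" "y \<in> hpart L p" "z \<in> hpart L q"
  shows "bracket L (bracket L x y) z =
    bracket L x (bracket L y z) \<oplus>\<^bsub>L\<^esub> sgn_of R (p * q) \<odot>\<^bsub>L\<^esub> bracket L (bracket L x z) y"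
proof -
  have c: "y \<in> carrier L" "z \<in> carrier L" using assms hpart_closed by auto
  let ?u = "bracket L (bracket L x y) z" and ?v = "sgn_of R (p * q) \<odot>\<^bsub>L\<^esub> bracket L (bracket L x z) y"
  have "?u \<in> carrier L" "?v \<in> carrier L" using assms c by simp_all
  then show ?thesis
    unfolding leibniz[OF assms] by (simp add: M.minus_eq M.a_assoc M.l_neg)
qed

context steinberg
begin

abbreviation "off i j \<equiv> i \<in> I \<and> j \<in> I \<and> i \<noteq> j"

text \<open>Generators exist for homogeneous \<open>a\<close> only; \<open>Fl\<close> is their linear extension, and its values form the
  root space \<open>V i j\<close>.\<close>

definition Fl :: "nat \<Rightarrow> nat \<Rightarrow> 'a \<Rightarrow> ('r, nat \<times> nat \<times> 'a) lterm set" where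
  "Fl i j a = F i j (hcomp D 0 a) \<oplus>\<^bsub>T\<^esub> F i j (hcomp D 1 a)"

definition V :: "nat \<Rightarrow> nat \<Rightarrow> ('r, nat \<times> nat \<times> 'a) lterm set set" where
  "V i j = Fl i j ` carrier D"

lemma hpart_gens: "\<lbrakk>off i j; a \<in> hpart D p\<rbrakk> \<Longrightarrow> (i, j, a) \<in> gens (dg i + dg j + p)"
  by (simp add: gens_iff)

lemma hcomp_gens: "\<lbrakk>off i j; a \<in> carrier D\<rbrakk> \<Longrightarrow> (i, j, hcomp D p a) \<in> gens (dg i + dg j + p)"
  by (simp add: hpart_gens)

lemma F_zero: "off i j \<Longrightarrow> F i j \<zero>\<^bsub>D\<^esub> = \<zero>\<^bsub>T\<^esub>"
  using F_smult[of \<zero> i j "\<zero>\<^bsub>D\<^esub>" 0] F_closed[of i j "\<zero>\<^bsub>D\<^esub>" 0] by (simp add: gens_iff)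

lemma Fl_closed [simp]: "\<lbrakk>off i j; a \<in> carrier D\<rbrakk> \<Longrightarrow> Fl i j a \<in> carrier T"
  unfolding Fl_def by (intro T.M.a_closed F_closed[OF hcomp_gens])

lemma Fl_add:
  assumes "off i j" "a \<in> carrier D" "b \<in> carrier D"
  shows "Fl i j (a \<oplus>\<^bsub>D\<^esub> b) = Fl i j a \<oplus>\<^bsub>T\<^esub> Fl i j b"
  using assms F_closed[OF hcomp_gens]
  by (simp add: Fl_def hcomp_add F_add[OF hcomp_gens hcomp_gens] T.M.a_ac)

lemma Fl_smult:
  assumes "off i j" "r \<in> carrier R" "a \<in> carrier D"
  shows "Fl i j (r \<odot>\<^bsub>D\<^esub> a) = r \<odot>\<^bsub>T\<^esub> Fl i j a"
  using assms F_closed[OF hcomp_gens]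
  by (simp add: Fl_def hcomp_smult F_smult[OF _ hcomp_gens] T.smult_r_distr)

lemma Fl_homogeneous: "(i, j, a) \<in> gens p \<Longrightarrow> Fl i j a = F i j a"
proof -
  assume g: "(i, j, a) \<in> gens p"
  then have o: "off i j" and a: "a \<in> hpart D (dg i + dg j + p)" by (auto simp: gens_iff)
  show ?thesis
    using F_closed[OF g] F_zero[OF o] unfolding Fl_def hcomp_hpart[OF a]
    by (cases "dg i + dg j + p") simp_all
qed

lemma Fl_zero: "off i j \<Longrightarrow> Fl i j \<zero>\<^bsub>D\<^esub> = \<zero>\<^bsub>T\<^esub>"
  using Fl_smult[of i j \<zero> "\<zero>\<^bsub>D\<^esub>"] by simp

lemma V_submodule:
  assumes "off i j"
  shows "submodule (V i j) R T"
proof (rule T.submoduleI')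
  show "V i j \<subseteq> carrier T" using assms by (auto simp: V_def)
  show "\<zero>\<^bsub>T\<^esub> \<in> V i j" using Fl_zero[OF assms] unfolding V_def by (metis M.zero_closed image_eqI)
  show "x \<oplus>\<^bsub>T\<^esub> y \<in> V i j" if "x \<in> V i j" "y \<in> V i j" for x y
    using that assms by (auto simp: V_def simp flip: Fl_add)
  show "r \<odot>\<^bsub>T\<^esub> x \<in> V i j" if "r \<in> carrier R" "x \<in> V i j" for r x
    using that assms by (auto simp: V_def simp flip: Fl_smult)
qed

lemma V_closed: "\<lbrakk>off i j; x \<in> V i j\<rbrakk> \<Longrightarrow> x \<in> carrier T"
  by (auto simp: V_def)

lemma F_in_V: "(i, j, a) \<in> gens p \<Longrightarrow> F i j a \<in> V i j"
  unfolding V_def using Fl_homogeneous[of i j a p] gensD[of i j a p] by (metis image_eqI)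

lemma V_bracket_in:
  assumes N: "submodule N R T" and o: "off i j" "off k l"
    and hom: "\<And>a b p q. \<lbrakk>(i, j, a) \<in> gens p; (k, l, b) \<in> gens q\<rbrakk> \<Longrightarrow> bracket T (F i j a) (F k l b) \<in> N"
    and x: "x \<in> V i j" and y: "y \<in> V k l"
  shows "bracket T x y \<in> N"
proof -
  obtain a b where ab: "x = Fl i j a" "y = Fl k l b" "a \<in> carrier D" "b \<in> carrier D"
    using x y by (auto simp: V_def)
  note sub = T.submoduleE[OF N]
  note g = hcomp_gens[OF o(1) ab(3)] and g' = hcomp_gens[OF o(2) ab(4)]
  show ?thesis
    using hom[OF g g'] F_closed[OF g] F_closed[OF g'] unfolding ab Fl_def
    by (simp add: T.brk.add_l T.brk.add_r sub)
qed

lemma V_left: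
  assumes "off i j" "off j l" "i \<noteq> l" "x \<in> V i j" "y \<in> V j l"
  shows "bracket T x y \<in> V i l"
proof (rule V_bracket_in[OF V_submodule _ _ _ assms(4,5)])
  fix a b p q assume g: "(i, j, a) \<in> gens p" "(j, l, b) \<in> gens q"
  show "bracket T (F i j a) (F j l b) \<in> V i l"
    using F_in_V[OF gens_lprod[OF g assms(3)]] by (simp add: F_left[OF g assms(3)])
qed (use assms in auto)

lemma V_right:
  assumes "off i j" "off k i" "j \<noteq> k" "x \<in> V i j" "y \<in> V k i"
  shows "bracket T x y \<in> V k j"
proof (rule V_bracket_in[OF V_submodule _ _ _ assms(4,5)])
  fix a b p q assume g: "(i, j, a) \<in> gens p" "(k, i, b) \<in> gens q"
  show "bracket T (F i j a) (F k i b) \<in> V k j"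
    unfolding F_right[OF g assms(3)] using F_in_V[OF gens_rprod[OF g assms(3)]] assms
    by (intro T.submoduleE(4)[OF V_submodule]) auto
qed (use assms in auto)

lemma zero_submodule: "submodule {\<zero>\<^bsub>T\<^esub>} R T"
  by (rule T.submoduleI') auto

lemma V_commute:
  assumes "off i j" "off k l" "i \<noteq> l" "j \<noteq> k" "x \<in> V i j" "y \<in> V k l"
  shows "bracket T x y = \<zero>\<^bsub>T\<^esub>"
proof -
  have "bracket T x y \<in> {\<zero>\<^bsub>T\<^esub>}"
    by (rule V_bracket_in[OF zero_submodule assms(1,2) _ assms(5,6)]) (use assms in \<open>auto simp: F_commute\<close>)
  then show ?thesis by simp
qed

lemma V_zero: "off i j \<Longrightarrow> \<zero>\<^bsub>T\<^esub> \<in> V i j"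
  using Fl_zero[of i j] unfolding V_def by (metis M.zero_closed image_eqI)

text \<open>
  Brackets add the weights \<open>\<alpha>\<close>, \<open>-\<alpha>\<close> and \<open>\<beta>\<close> of the three factors.  For \<open>\<beta> = \<plusminus>\<alpha>\<close> an intermediate bracket could have
  weight zero, about which the relations say nothing; these two cases are therefore excluded.
\<close>

lemma V_triple:
  assumes o: "off i j" "off k l" and ne: "(k, l) \<noteq> (i, j)" "(k, l) \<noteq> (j, i)"
    and x: "x \<in> V i j" and y: "y \<in> V j i" and z: "z \<in> V k l"
  shows "bracket T (bracket T z x) y \<in> V k l"
    and "bracket T x (bracket T y z) \<in> V k l"
    and "bracket T (bracket T x z) y \<in> V k l"
proof -
  have o': "off j i" using o by auto
  have c: "x \<in> carrier T" "y \<in> carrier T" "z \<in> carrier T" using V_closed o o' x y z by auto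
  note zero = V_zero[OF o(2)]
  show "bracket T (bracket T z x) y \<in> V k l"
  proof (cases "l = i")
    case True
    then have "bracket T z x \<in> V k j" using V_left[OF o(2)] o ne x z by auto
    then show ?thesis using V_left[of k j i _ y] True o ne y by auto
  next
    case l: False
    show ?thesis
    proof (cases "k = j")
      case True
      then have "bracket T z x \<in> V i l" using V_right[OF o(2)] l o ne x z by auto
      then show ?thesis using V_right[of i l j _ y] True l o ne y by auto
    next
      case False
      then show ?thesis using V_commute[OF o(2,1)] l o x z c zero by auto
    qed
  qed
  show "bracket T x (bracket T y z) \<in> V k l"
  proof (cases "k = i")
    case True
    then have "bracket T y z \<in> V j l" using V_left[OF o'] o ne y z by auto
    then show ?thesis using V_left[of i j l x] True o ne x by auto
  next
    case k: False
    show ?thesis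
    proof (cases "l = j")
      case True
      then have "bracket T y z \<in> V k i" using V_right[OF o'] k o ne y z by auto
      then show ?thesis using V_right[of i j k x] True k o ne x by auto
    next
      case False
      then show ?thesis using V_commute[OF o' o(2)] k o y z c zero by auto
    qed
  qed
  show "bracket T (bracket T x z) y \<in> V k l"
  proof (cases "j = k")
    case True
    then have "bracket T x z \<in> V i l" using V_left[OF o(1)] o ne x z by auto
    then show ?thesis using V_right[of i l j _ y] True o ne y by auto
  next
    case k: False
    show ?thesis
    proof (cases "i = l")
      case True
      then have "bracket T x z \<in> V k j" using V_right[OF o(1)] k o ne x z by auto
      then show ?thesis using V_left[of k j i _ y] True k o ne y by auto
    next
      case False
      then show ?thesis using V_commute[OF o] k o x z c zero by auto
    qed
  qed
qed

text \<open>
  The part of weight zero is defined by what it does, not by generators, so that an element of the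
  kernel can be recognised as belonging to it.
\<close>

definition stabilises :: "('r, nat \<times> nat \<times> 'a) lterm set \<Rightarrow> nat \<Rightarrow> nat \<Rightarrow> bool" where
  "stabilises h k l \<longleftrightarrow> (\<forall>z \<in> V k l. bracket T h z \<in> V k l \<and> bracket T z h \<in> V k l)"

definition H :: "('r, nat \<times> nat \<times> 'a) lterm set set" where
  "H = {h \<in> carrier T. \<forall>k l. off k l \<longrightarrow> stabilises h k l}"

lemma H_submodule: "submodule H R T"
proof (rule T.submoduleI')
  show "H \<subseteq> carrier T" by (auto simp: H_def)
  show "\<zero>\<^bsub>T\<^esub> \<in> H" by (auto simp: H_def stabilises_def V_closed V_zero)
  show "x \<oplus>\<^bsub>T\<^esub> y \<in> H" if "x \<in> H" "y \<in> H" for x y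
    using that T.submoduleE(5)[OF V_submodule]
    by (auto simp: H_def stabilises_def T.brk.add_l T.brk.add_r V_closed)
  show "r \<odot>\<^bsub>T\<^esub> x \<in> H" if "r \<in> carrier R" "x \<in> H" for r x
    using that T.submoduleE(4)[OF V_submodule]
    by (auto simp: H_def stabilises_def T.brk.smult_l T.brk.smult_r V_closed)
qed

lemma stabilisesI:
  assumes h: "h \<in> carrier T" and o: "off k l"
    and hom: "\<And>c s. (k, l, c) \<in> gens s \<Longrightarrow> bracket T h (F k l c) \<in> V k l \<and> bracket T (F k l c) h \<in> V k l"
  shows "stabilises h k l"
  unfolding stabilises_def
proof
  fix z assume "z \<in> V k l"
  then obtain c where c: "z = Fl k l c" "c \<in> carrier D" by (auto simp: V_def)
  note g = hcomp_gens[OF o c(2)]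
  show "bracket T h z \<in> V k l \<and> bracket T z h \<in> V k l"
    using hom[OF g] F_closed[OF g] h T.submoduleE(5)[OF V_submodule[OF o]] unfolding c(1) Fl_def
    by (simp add: T.brk.add_l T.brk.add_r)
qed

text \<open>
  The root space in position \<open>(k, l)\<close> is spanned by brackets \<open>[F k r c, F r l 1]\<close>, on which \<open>h\<close> acts through its factors by the
  Leibniz identity.
\<close>

lemma stabilises_trans:
  assumes h: "h \<in> hpart T p" and o: "off k r" "off r l" "k \<noteq> l"
    and s: "stabilises h k r" "stabilises h r l"
  shows "stabilises h k l"
proof (rule stabilisesI)
  show hc: "h \<in> carrier T" using h T.hpart_closed by blast
  show o': "off k l" using o by auto
  fix c s assume g: "(k, l, c) \<in> gens s"
  let ?x = "F k r c" and ?y = "F r l \<one>\<^bsub>D\<^esub>"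
  have gx: "(k, r, c) \<in> gens (dg r + dg l + s)" using gens_shift[OF g] o by auto
  have gy: "(r, l, \<one>\<^bsub>D\<^esub>) \<in> gens (dg r + dg l)" using one_gens o by auto
  have F: "F k l c = bracket T ?x ?y" using F_factor[OF g, of r] o by auto
  note hp = F_hpart[OF gx] F_hpart[OF gy]
  note cl = F_closed[OF gx] F_closed[OF gy]
  have hx: "bracket T h ?x \<in> V k r" "bracket T ?x h \<in> V k r"
    using s(1) F_in_V[OF gx] by (auto simp: stabilises_def)
  have hy: "bracket T h ?y \<in> V r l" "bracket T ?y h \<in> V r l"
    using s(2) F_in_V[OF gy] by (auto simp: stabilises_def)
  have vx: "\<And>u. u \<in> V k r \<Longrightarrow> bracket T u ?y \<in> V k l" and vy: "\<And>u. u \<in> V r l \<Longrightarrow> bracket T u ?x \<in> V k l"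
    and vx': "\<And>u. u \<in> V r l \<Longrightarrow> bracket T ?x u \<in> V k l"
    using V_left[OF o(1,2)] V_right[of r l k] o F_in_V[OF gx] F_in_V[OF gy] by auto
  note sub = T.submoduleE[OF V_submodule[OF o']]
  show "bracket T h (F k l c) \<in> V k l \<and> bracket T (F k l c) h \<in> V k l"
    unfolding F T.leibniz[OF hc hp] T.leibniz_left[OF cl(1) hp(2) h]
    using hx hy vx vy vx' by (auto simp: T.M.minus_eq intro!: sub)
qed

text \<open>
  The only root spaces not covered by the computation with triples are those in positions \<open>(i, j)\<close> and \<open>(j, i)\<close>, and these are generated by root spaces
  in positions that involve a third index.
\<close>

lemma opposite_bracket_in_H:
  assumes x: "(i, j, a) \<in> gens p" and y: "(j, i, b) \<in> gens q"
  shows "bracket T (F i j a) (F j i b) \<in> H"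
proof -
  let ?x = "F i j a" and ?y = "F j i b"
  let ?h = "bracket T ?x ?y"
  have o: "off i j" "off j i" using x by (auto simp: gens_iff)
  note v = F_in_V[OF x] F_in_V[OF y]
  note hp = F_hpart[OF x] F_hpart[OF y]
  note cl = F_closed[OF x] F_closed[OF y]
  have h: "?h \<in> hpart T (p + q)" by (rule T.brk.hpart[OF hp])
  then have hc: "?h \<in> carrier T" by (rule T.hpart_closed)
  have generic: "stabilises ?h k l" if kl: "off k l" "(k, l) \<noteq> (i, j)" "(k, l) \<noteq> (j, i)" for k l
  proof (rule stabilisesI[OF hc kl(1)])
    fix c s assume z: "(k, l, c) \<in> gens s"
    note sub = T.submoduleE[OF V_submodule[OF kl(1)]]
    note 1 = V_triple[OF o(1) kl v F_in_V[OF z]]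
    note 2 = V_triple[OF o(2) kl(1) kl(3) kl(2) v(2,1) F_in_V[OF z]]
    have "bracket T (F k l c) ?h \<in> V k l"
      unfolding T.leibniz[OF F_closed[OF z] hp] using 1(1) 2(1) by (auto simp: T.M.minus_eq intro!: sub)
    moreover have "bracket T ?h (F k l c) \<in> V k l"
      unfolding T.leibniz_left[OF cl(1) hp(2) F_hpart[OF z]] using 1(2,3) by (auto intro!: sub)
    ultimately show "bracket T ?h (F k l c) \<in> V k l \<and> bracket T (F k l c) ?h \<in> V k l" by simp
  qed
  obtain k where k: "k \<in> I" "k \<noteq> i" "k \<noteq> j" using third_index o by blast
  have "stabilises ?h i j" using o k by (intro stabilises_trans[OF h, of i k j] generic) auto
  moreover have "stabilises ?h j i" using o k by (intro stabilises_trans[OF h, of j k i] generic) auto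
  ultimately show ?thesis using generic hc unfolding H_def by blast
qed

end

context steinberg_hom
begin

lemma phi_Fl:
  assumes "off i j" "a \<in> carrier D"
  shows "\<phi> (Fl i j a) = E i j a"
proof -
  note g = hcomp_gens[OF assms]
  have "\<phi> (Fl i j a) = E i j (hcomp D 0 a) \<oplus>\<^bsub>G\<^esub> E i j (hcomp D 1 a)"
    unfolding Fl_def using F_closed[OF g] by (simp add: phi_add phi_F[OF g])
  then show ?thesis using assms by (simp add: hcomp_sum flip: E_add)
qed

definition "Off = {(i, j). off i j}"

lemma finite_Off [simp]: "finite Off"
  by (rule finite_subset[of _ "I \<times> I"]) (auto simp: Off_def)

lemma Off_iff [simp]: "ij \<in> Off \<longleftrightarrow> off (fst ij) (snd ij)"
  by (auto simp: Off_def)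

text \<open>
  The sum of the root components of \<open>w\<close>.  Reading them off the matrix \<open>\<phi> w\<close> makes this well defined and linear.
\<close>

definition proj where
  "proj w = (\<Oplus>\<^bsub>T\<^esub>ij\<in>Off. Fl (fst ij) (snd ij) (\<phi> w (fst ij) (snd ij)))"

lemma phi_entry [simp]: "w \<in> carrier T \<Longrightarrow> \<phi> w i j \<in> carrier D"
  using phi_closed[of w] G.derived_set_closed[of "\<phi> w"] mat_entry[of "\<phi> w" m n] by (simp add: G_simps)

lemma proj_closed [simp]: "w \<in> carrier T \<Longrightarrow> proj w \<in> carrier T"
  unfolding proj_def by (intro T.M.finsum_closed) auto

lemma proj_add:
  assumes "v \<in> carrier T" "w \<in> carrier T"
  shows "proj (v \<oplus>\<^bsub>T\<^esub> w) = proj v \<oplus>\<^bsub>T\<^esub> proj w"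
proof -
  have "proj (v \<oplus>\<^bsub>T\<^esub> w) = (\<Oplus>\<^bsub>T\<^esub>ij\<in>Off. Fl (fst ij) (snd ij) (\<phi> v (fst ij) (snd ij))
      \<oplus>\<^bsub>T\<^esub> Fl (fst ij) (snd ij) (\<phi> w (fst ij) (snd ij)))"
    unfolding proj_def by (rule T.M.finsum_cong') (use assms in \<open>simp_all add: phi_add G_simps Fl_add\<close>)
  then show ?thesis unfolding proj_def using assms by (simp add: T.M.finsum_addf Pi_def)
qed

lemma proj_smult:
  assumes "r \<in> carrier R" "w \<in> carrier T"
  shows "proj (r \<odot>\<^bsub>T\<^esub> w) = r \<odot>\<^bsub>T\<^esub> proj w"
proof -
  have "proj (r \<odot>\<^bsub>T\<^esub> w) = (\<Oplus>\<^bsub>T\<^esub>ij\<in>Off. r \<odot>\<^bsub>T\<^esub> Fl (fst ij) (snd ij) (\<phi> w (fst ij) (snd ij)))"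
    unfolding proj_def by (rule T.M.finsum_cong') (use assms in \<open>simp_all add: phi_smult G_simps Fl_smult\<close>)
  then show ?thesis unfolding proj_def using assms by (simp add: T.finsum_smult_ldistr Pi_def)
qed

lemma proj_eq_zero:
  assumes "\<And>i j. off i j \<Longrightarrow> \<phi> w i j = \<zero>\<^bsub>D\<^esub>"
  shows "proj w = \<zero>\<^bsub>T\<^esub>"
  unfolding proj_def by (rule T.M.add.finprod_one_eqI) (simp add: assms Fl_zero)

lemma proj_Fl:
  assumes o: "off i j" and a: "a \<in> carrier D"
  shows "proj (Fl i j a) = Fl i j a"
proof -
  have "proj (Fl i j a) = (\<Oplus>\<^bsub>T\<^esub>kl\<in>Off. if (i, j) = kl then Fl i j a else \<zero>\<^bsub>T\<^esub>)"
    unfolding proj_def phi_Fl[OF assms] mat_unit_def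
    by (rule T.M.finsum_cong') (use o a in \<open>auto simp: Fl_zero prod_eq_iff\<close>)
  also have "\<dots> = Fl i j a"
    by (rule T.M.finsum_singleton[of "(i, j)" Off "\<lambda>_. Fl i j a"]) (use o a in simp_all)
  finally show ?thesis .
qed

text \<open>
  The decomposition \<open>stl = H + \<Sum> V i j\<close>: the set of all \<open>w\<close> with \<open>w - proj w\<close> in \<open>H\<close> contains the
  generators and is closed under right multiplication by them.
\<close>

lemma minus_proj_in_H:
  assumes "w \<in> carrier T"
  shows "w \<ominus>\<^bsub>T\<^esub> proj w \<in> H"
proof -
  define W where "W = {w \<in> carrier T. w \<ominus>\<^bsub>T\<^esub> proj w \<in> H}"
  note Hsub = T.submoduleE[OF H_submodule] subgroup.one_closed[OF submodule.axioms(1)[OF H_submodule], simplified]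
  have W: "submodule W R T"
  proof (rule T.submoduleI')
    show "W \<subseteq> carrier T" by (auto simp: W_def)
    have "\<phi> \<zero>\<^bsub>T\<^esub> i j = \<zero>\<^bsub>D\<^esub>" for i j by (simp add: phi_zero G_simps)
    then have "proj \<zero>\<^bsub>T\<^esub> = \<zero>\<^bsub>T\<^esub>" by (intro proj_eq_zero)
    then show "\<zero>\<^bsub>T\<^esub> \<in> W" using Hsub by (simp add: W_def T.M.minus_eq)
    show "x \<oplus>\<^bsub>T\<^esub> y \<in> W" if "x \<in> W" "y \<in> W" for x y
    proof -
      have "(x \<oplus>\<^bsub>T\<^esub> y) \<ominus>\<^bsub>T\<^esub> proj (x \<oplus>\<^bsub>T\<^esub> y) = (x \<ominus>\<^bsub>T\<^esub> proj x) \<oplus>\<^bsub>T\<^esub> (y \<ominus>\<^bsub>T\<^esub> proj y)"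
        using that by (simp add: W_def proj_add T.M.minus_eq T.M.minus_add T.M.a_ac)
      then show ?thesis using that Hsub(5) by (simp add: W_def)
    qed
    show "r \<odot>\<^bsub>T\<^esub> x \<in> W" if "r \<in> carrier R" "x \<in> W" for r x
    proof -
      have "r \<odot>\<^bsub>T\<^esub> x \<ominus>\<^bsub>T\<^esub> proj (r \<odot>\<^bsub>T\<^esub> x) = r \<odot>\<^bsub>T\<^esub> (x \<ominus>\<^bsub>T\<^esub> proj x)"
        using that by (simp add: W_def proj_smult T.M.minus_eq T.smult_r_distr T.smult_r_minus)
      then show ?thesis using that Hsub(4) by (simp add: W_def)
    qed
  qed
  note sub = T.submoduleE[OF W] subgroup.one_closed[OF submodule.axioms(1)[OF W], simplified]
  have V: "x \<in> W" if "off i j" "x \<in> V i j" for i j x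
    using that proj_Fl Hsub(7) by (auto simp: W_def V_def T.M.minus_eq T.M.r_neg)
  have opp: "bracket T (F i j a) (F j i b) \<in> W" if g: "(i, j, a) \<in> gens p" "(j, i, b) \<in> gens q" for i j a b p q
  proof -
    let ?h = "bracket T (F i j a) (F j i b)"
    have "\<phi> ?h = bracket G (E i j a) (E j i b)"
      using F_closed[OF g(1)] F_closed[OF g(2)] by (simp add: phi_bracket phi_F[OF g(1)] phi_F[OF g(2)])
    also have "\<dots> = E i i (a \<stileturn>\<^bsub>D\<^esub> b) \<ominus>\<^bsub>G\<^esub> sgn_of R (p * q) \<odot>\<^bsub>G\<^esub> E j j (b \<turnstile>\<^bsub>D\<^esub> a)"
      using bracket_E[of a i j p b j i q] gensD[OF g(1)] gensD[OF g(2)] by simp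
    finally have phi_h: "\<phi> ?h = E i i (a \<stileturn>\<^bsub>D\<^esub> b) \<ominus>\<^bsub>G\<^esub> sgn_of R (p * q) \<odot>\<^bsub>G\<^esub> E j j (b \<turnstile>\<^bsub>D\<^esub> a)" .
    have "(\<lambda>k l. sgn_of R (p * q) \<odot>\<^bsub>D\<^esub> E j j (b \<turnstile>\<^bsub>D\<^esub> a) k l) \<in> mat_carrier D m n"
      using gensD[OF g(1)] gensD[OF g(2)] by (intro mat_carrier_closed E_closed) auto
    then have "\<phi> ?h k l = \<zero>\<^bsub>D\<^esub>" if "k \<noteq> l" for k l
      using that unfolding phi_h by (auto simp: G_simps G_inv a_minus_def mat_unit_def)
    then have "proj ?h = \<zero>\<^bsub>T\<^esub>" by (intro proj_eq_zero) auto
    then show ?thesis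
      using opposite_bracket_in_H[OF g] Hsub(1) by (auto simp: W_def T.M.minus_eq)
  qed
  have VV: "bracket T x y \<in> W" if o: "off i j" "off k l" and x: "x \<in> V i j" and y: "y \<in> V k l" for i j k l x y
  proof (cases "j = k")
    case j: True
    show ?thesis
    proof (cases "i = l")
      case True
      then show ?thesis using V_bracket_in[OF W o _ x y] opp j by blast
    next
      case False
      then have "bracket T x y \<in> V i l" using V_left[of i j l x y] j o x y by auto
      then show ?thesis using V False o by blast
    qed
  next
    case j: False
    show ?thesis
    proof (cases "i = l")
      case True
      then have "bracket T x y \<in> V k j" using V_right[of i j k x y] j o x y by auto
      then show ?thesis using V j o by blast
    next
      case False
      then show ?thesis using V_commute[OF o _ j x y] sub(7) by simp
    qed
  qed
  have right: "bracket T w (F k l c) \<in> W" if w: "w \<in> W" and g: "(k, l, c) \<in> gens s" for w k l c s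
  proof -
    have wc: "w \<in> carrier T" using w by (simp add: W_def)
    have o: "off k l" using g by (auto simp: gens_iff)
    have "w = (w \<ominus>\<^bsub>T\<^esub> proj w) \<oplus>\<^bsub>T\<^esub> proj w"
      using wc by (simp add: T.M.minus_eq T.M.a_assoc T.M.l_neg)
    then have "bracket T w (F k l c) = bracket T (w \<ominus>\<^bsub>T\<^esub> proj w) (F k l c) \<oplus>\<^bsub>T\<^esub> bracket T (proj w) (F k l c)"
      using wc F_closed[OF g] T.brk.add_l[of "w \<ominus>\<^bsub>T\<^esub> proj w" "proj w" "F k l c"] by simp
    moreover have "bracket T (w \<ominus>\<^bsub>T\<^esub> proj w) (F k l c) \<in> W"
      using w o F_in_V[OF g] V by (auto simp: W_def H_def stabilises_def)
    moreover have "bracket T (proj w) (F k l c) \<in> W"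
    proof -
      let ?f = "\<lambda>ij. bracket T (Fl (fst ij) (snd ij) (\<phi> w (fst ij) (snd ij))) (F k l c)"
      have f: "?f ij \<in> W" if "ij \<in> Off" for ij
        using that o wc F_in_V[OF g] by (intro VV[of "fst ij" "snd ij" k l]) (auto simp: V_def)
      have "bracket T (proj w) (F k l c) = (\<Oplus>\<^bsub>T\<^esub>ij\<in>Off. ?f ij)"
        unfolding proj_def using wc F_closed[OF g] by (intro T.brk.finsum_l) auto
      moreover have "(\<Oplus>\<^bsub>T\<^esub>ij\<in>A. ?f ij) \<in> W" if "finite A" "A \<subseteq> Off" for A
        using that
      proof (induction A rule: finite_induct)
        case empty
        then show ?case using sub(7) by (simp add: T.M.finsum_empty)
      next
        case (insert ij A)
        then have "?f \<in> A \<rightarrow> carrier T" "?f ij \<in> carrier T" using f sub(1) by blast+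
        then show ?case using insert f sub(5) by (simp add: T.M.finsum_insert)
      qed
      ultimately show ?thesis by simp
    qed
    ultimately show ?thesis using sub(5) by simp
  qed
  have "carrier T \<subseteq> W"
  proof (rule P.presented_right_span[folded stl_def, OF W])
    fix g p assume "g \<in> gens p"
    then show "P.cl (Gen g) \<in> W" using V F_in_V by (cases g) (auto simp: F_eq gens_iff)
  next
    fix w g p assume "w \<in> W" "g \<in> gens p"
    then show "bracket T w (P.cl (Gen g)) \<in> W" using right by (cases g) (auto simp: F_eq)
  qed
  then show ?thesis using assms by (auto simp: W_def)
qed

text \<open>
  An element \<open>w\<close> of the kernel has no root components, so it preserves root spaces; and \<open>\<phi>\<close> is
  injective on each of them but maps the brackets with \<open>w\<close> to zero.
\<close>

lemma kernel_annihilates_generators: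
  assumes w: "w \<in> carrier T" "\<phi> w = \<zero>\<^bsub>G\<^esub>" and g: "(k, l, c) \<in> gens s"
  shows "bracket T w (F k l c) = \<zero>\<^bsub>T\<^esub>" and "bracket T (F k l c) w = \<zero>\<^bsub>T\<^esub>"
proof -
  have o: "off k l" using g by (auto simp: gens_iff)
  have "proj w = \<zero>\<^bsub>T\<^esub>" using w by (intro proj_eq_zero) (simp add: G_simps)
  then have "w \<in> H" using minus_proj_in_H[OF w(1)] w(1) by (simp add: T.M.minus_eq)
  then have V: "bracket T w (F k l c) \<in> V k l" "bracket T (F k l c) w \<in> V k l"
    using o F_in_V[OF g] by (auto simp: H_def stabilises_def)
  have E: "E k l c \<in> carrier G" using gensD[OF g] by simp
  have phi0: "\<phi> (bracket T w (F k l c)) = \<zero>\<^bsub>G\<^esub>" "\<phi> (bracket T (F k l c) w) = \<zero>\<^bsub>G\<^esub>"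
    using w F_closed[OF g] E by (simp_all add: phi_bracket phi_F[OF g])
  have inj: "v = \<zero>\<^bsub>T\<^esub>" if v: "v \<in> V k l" "\<phi> v = \<zero>\<^bsub>G\<^esub>" for v
  proof -
    obtain d where d: "v = Fl k l d" "d \<in> carrier D" using v by (auto simp: V_def)
    then have "E k l d = \<zero>\<^bsub>G\<^esub>" using phi_Fl[OF o] v by simp
    then have "d = \<zero>\<^bsub>D\<^esub>" by (auto simp: mat_unit_def G_simps fun_eq_iff dest: spec[of _ k] split: if_splits)
    then show ?thesis using d Fl_zero[OF o] by simp
  qed
  show "bracket T w (F k l c) = \<zero>\<^bsub>T\<^esub>" "bracket T (F k l c) w = \<zero>\<^bsub>T\<^esub>"
    by (rule inj[OF V(1) phi0(1)], rule inj[OF V(2) phi0(2)])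
qed

lemmas T_homogeneous_induct [consumes 1, case_names gen zero add smult bracket] =
  P.presented_homogeneous_induct[folded stl_def]

text \<open>
  By the Leibniz identity, the elements annihilated by \<open>w\<close> from both sides are closed under brackets.  For brackets on
  the left of \<open>w\<close> this requires homogeneous \<open>w\<close>, and the kernel contains the components of its elements.
\<close>

lemma kernel_central:
  assumes w: "w \<in> carrier T" "\<phi> w = \<zero>\<^bsub>G\<^esub>"
  shows "w \<in> leibniz_centre T"
proof -
  have homogeneous: "bracket T v x = \<zero>\<^bsub>T\<^esub> \<and> bracket T x v = \<zero>\<^bsub>T\<^esub>"
    if v: "v \<in> hpart T r" "\<phi> v = \<zero>\<^bsub>G\<^esub>" and x: "x \<in> hpart T p" for v r x p
  proof -
    have vc: "v \<in> carrier T" using v T.hpart_closed by blast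
    show ?thesis
      using x
    proof (induction rule: T_homogeneous_induct)
      case (gen g p)
      then show ?case using kernel_annihilates_generators[OF vc v(2)] by (cases g) (auto simp: F_eq)
    next
      case (bracket p q x y)
      note c = bracket(1,2)[THEN T.hpart_closed]
      show ?case
        unfolding T.leibniz[OF vc bracket(1,2)] T.leibniz_left[OF c(1) bracket(2) v(1)]
        using bracket c by (simp add: T.M.minus_eq)
    qed (simp_all add: vc T.brk.add_l T.brk.add_r T.brk.smult_l T.brk.smult_r T.hpart_closed)
  qed
  have homv: "bracket T v x = \<zero>\<^bsub>T\<^esub> \<and> bracket T x v = \<zero>\<^bsub>T\<^esub>"
    if v: "v \<in> hpart T r" "\<phi> v = \<zero>\<^bsub>G\<^esub>" and x: "x \<in> carrier T" for v r x
    using x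
  proof (induction rule: T.homogeneous_induct)
    case (hom p x)
    then show ?case by (rule homogeneous[OF v])
  qed (use v T.hpart_closed in \<open>simp_all add: T.brk.add_l T.brk.add_r\<close>)
  have comp: "\<phi> (hcomp T p w) = \<zero>\<^bsub>G\<^esub>" for p
  proof -
    have h: "\<phi> (hcomp T q w) \<in> hpart S q" for q using w by (intro leibniz_hom_hpart[OF phi]) auto
    have "\<phi> (hcomp T 0 w) \<oplus>\<^bsub>S\<^esub> \<phi> (hcomp T 1 w) = \<zero>\<^bsub>S\<^esub>"
      using w leibniz_hom_add[OF phi, of "hcomp T 0 w" "hcomp T 1 w"] by (simp add: T.hcomp_sum)
    then have "hcomp S p (\<phi> (hcomp T 0 w) \<oplus>\<^bsub>S\<^esub> \<phi> (hcomp T 1 w)) = \<zero>\<^bsub>S\<^esub>"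
      using S.hcomp_hpart[OF S.hpart_zero, of p p] by metis
    then show ?thesis
      using S.hcomp_hpart[OF h] S.hcomp_add[OF h[THEN S.hpart_closed] h[THEN S.hpart_closed]] h[THEN S.hpart_closed]
      by (cases p) (simp_all add: G.derived_set_closed)
  qed
  have "bracket T w x = \<zero>\<^bsub>T\<^esub> \<and> bracket T x w = \<zero>\<^bsub>T\<^esub>" if x: "x \<in> carrier T" for x
    using homv[OF T.hcomp_in[OF w(1)] comp x] w x T.brk.add_l[of "hcomp T 0 w" "hcomp T 1 w" x]
      T.brk.add_r[of "hcomp T 0 w" "hcomp T 1 w" x] by (simp add: T.hcomp_sum)
  then show ?thesis using w by (simp add: leibniz_centre_def)
qed

lemma canonical_central_extension: "central_extension R T S \<phi>"
  unfolding central_extension_def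
  using T.leibniz_superalgebra_axioms S.leibniz_superalgebra_axioms phi phi_surjective kernel_central
  by auto

end

section \<open>Central extensions\<close>

text \<open>
  The sign in the Leibniz identity involves the degrees of the last two entries only.  It disappears for even \<open>u\<close>, and then
  linearity removes homogeneity.
\<close>

lemma (in leibniz_superalgebra) bracket_even_derivation:
  assumes x: "x \<in> carrier L" and y: "y \<in> carrier L" and u: "u \<in> hpart L 0"
  shows "bracket L (bracket L x y) u = bracket L x (bracket L y u) \<oplus>\<^bsub>L\<^esub> bracket L (bracket L x u) y"
  using y
proof (induction rule: homogeneous_induct)
  case (hom p y)
  then show ?case using leibniz_left[OF x hom u] x u by (simp add: hpart_closed)
next
  case (add y z)
  then show ?case using x u by (simp add: brk.add_l brk.add_r hpart_closed M.a_ac)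
qed

lemma (in abelian_group) diff_add_diff:
  assumes "x \<in> carrier G" "y \<in> carrier G" "z \<in> carrier G"
  shows "(y \<ominus> x) \<oplus> (z \<ominus> y) = z \<ominus> x"
proof -
  have "(y \<ominus> x) \<oplus> (z \<ominus> y) = (y \<oplus> \<ominus> y) \<oplus> (z \<ominus> x)"
    using assms by (simp add: minus_eq a_ac)
  then show ?thesis using assms by (simp add: r_neg)
qed

locale central_ext =
  fixes R (structure) and M and L and \<psi>
  assumes ext: "central_extension R M L \<psi>"
begin

sublocale M: leibniz_superalgebra R M
  using ext by (simp add: central_extension_def)

sublocale L: leibniz_superalgebra R L
  using ext by (simp add: central_extension_def)

lemma psi: "\<psi> \<in> leibniz_hom R M L"
  using ext by (simp add: central_extension_def)

lemmas psi_closed = leibniz_hom_closed[OF psi]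
  and psi_add = leibniz_hom_add[OF psi]
  and psi_smult = leibniz_hom_smult[OF psi]
  and psi_bracket = leibniz_hom_bracket[OF psi]
  and psi_hpart = leibniz_hom_hpart[OF psi]
  and psi_inv = leibniz_hom_inv[OF psi M.supermodule_axioms L.supermodule_axioms]

lemma kernel_bracket:
  assumes "x \<in> carrier M" "\<psi> x = \<zero>\<^bsub>L\<^esub>" "y \<in> carrier M"
  shows "bracket M x y = \<zero>\<^bsub>M\<^esub>" "bracket M y x = \<zero>\<^bsub>M\<^esub>"
proof -
  have "x \<in> leibniz_centre M" using ext assms(1,2) unfolding central_extension_def by blast
  then show "bracket M x y = \<zero>\<^bsub>M\<^esub>" "bracket M y x = \<zero>\<^bsub>M\<^esub>"
    using assms(3) by (simp_all add: leibniz_centre_def)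
qed

text \<open>
  Since the kernel is central, a bracket in \<open>M\<close> depends only on the images of its arguments in \<open>L\<close>.
\<close>

lemma bracket_cong:
  assumes c: "x \<in> carrier M" "x' \<in> carrier M" "y \<in> carrier M" "y' \<in> carrier M"
    and e: "\<psi> x = \<psi> x'" "\<psi> y = \<psi> y'"
  shows "bracket M x y = bracket M x' y'"
proof -
  have z: "\<psi> (u \<ominus>\<^bsub>M\<^esub> v) = \<zero>\<^bsub>L\<^esub>" if "u \<in> carrier M" "v \<in> carrier M" "\<psi> u = \<psi> v" for u v
    using that psi_closed[of v] by (simp add: M.M.minus_eq psi_add psi_inv L.M.r_neg)
  have eq: "u = v" if "u \<in> carrier M" "v \<in> carrier M" "u \<ominus>\<^bsub>M\<^esub> v = \<zero>\<^bsub>M\<^esub>" for u v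
    using that by (metis M.M.add.inv_closed M.M.minus_equality M.M.minus_eq M.M.minus_minus)
  have "bracket M x y \<ominus>\<^bsub>M\<^esub> bracket M x' y = \<zero>\<^bsub>M\<^esub>"
    using c kernel_bracket(1)[of "x \<ominus>\<^bsub>M\<^esub> x'" y] z[of x x'] e by (simp add: M.brk.minus_l)
  moreover have "bracket M x' y \<ominus>\<^bsub>M\<^esub> bracket M x' y' = \<zero>\<^bsub>M\<^esub>"
    using c kernel_bracket(2)[of "y \<ominus>\<^bsub>M\<^esub> y'" x'] z[of y y'] e by (simp add: M.brk.minus_r)
  ultimately show ?thesis using c eq M.brk.closed by metis
qed

lemma homogeneous_lift:
  assumes s: "s \<in> hpart L p"
  obtains x where "x \<in> hpart M p" "\<psi> x = s"
proof -
  have "s \<in> \<psi> ` carrier M" using ext L.hpart_closed[OF s] unfolding central_extension_def by blast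
  then obtain y where y: "y \<in> carrier M" "\<psi> y = s" by blast
  obtain u v where uv: "u \<in> hpart M p" "v \<in> hpart M (p + 1)" "y = u \<oplus>\<^bsub>M\<^esub> v"
    using M.hpart_decomp[OF y(1)] by metis
  have "hcomp L p s = \<psi> u"
    using L.hcomp_eqI[OF psi_hpart[OF uv(1)] psi_hpart[OF uv(2)]] y uv M.hpart_closed by (auto simp: psi_add)
  then have "\<psi> u = s" using L.hcomp_hpart[OF s] by simp
  with uv(1) show thesis by (rule that)
qed

text \<open>
  If the images of \<open>x\<close> and \<open>y\<close> are weight vectors for the right action of \<open>\<psi> u\<close>, then \<open>[x, u]\<close> and \<open>\<alpha> x\<close> differ by a
  central element only, which disappears in the derivation rule for \<open>[[x, y], u]\<close>.  So \<open>[x, y]\<close> has the expected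
  weight even if it lies in the kernel.
\<close>

lemma bracket_weight:
  assumes c: "x \<in> carrier M" "y \<in> carrier M" and u: "u \<in> hpart M 0"
    and r: "\<alpha> \<in> carrier R" "\<beta> \<in> carrier R"
    and wx: "bracket L (\<psi> x) (\<psi> u) = \<alpha> \<odot>\<^bsub>L\<^esub> \<psi> x" and wy: "bracket L (\<psi> y) (\<psi> u) = \<beta> \<odot>\<^bsub>L\<^esub> \<psi> y"
  shows "bracket M (bracket M x y) u = (\<alpha> \<oplus> \<beta>) \<odot>\<^bsub>M\<^esub> bracket M x y"
proof -
  have uc: "u \<in> carrier M" using u by (rule M.hpart_closed)
  have "bracket M x (bracket M y u) = bracket M x (\<beta> \<odot>\<^bsub>M\<^esub> y)"
    using c uc r wy by (intro bracket_cong) (simp_all add: psi_bracket psi_smult)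
  moreover have "bracket M (bracket M x u) y = bracket M (\<alpha> \<odot>\<^bsub>M\<^esub> x) y"
    using c uc r wx by (intro bracket_cong) (simp_all add: psi_bracket psi_smult)
  ultimately show ?thesis
    using c r by (simp add: M.bracket_even_derivation[OF c u] M.brk.smult_l M.brk.smult_r M.smult_l_distr M.M.a_comm)
qed

end

text \<open>
  A generator of \<open>stl\<close> is a bracket, and the two homomorphisms agree on brackets because their values in \<open>M\<close> have
  the same images in \<open>sl\<close>.
\<close>

lemma (in steinberg_hom) lift_unique:
  assumes ext: "central_extension R M S \<psi>"
    and f: "f \<in> leibniz_hom R T M" "\<And>x. x \<in> carrier T \<Longrightarrow> \<phi> x = \<psi> (f x)"
    and f': "f' \<in> leibniz_hom R T M" "\<And>x. x \<in> carrier T \<Longrightarrow> \<phi> x = \<psi> (f' x)"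
    and x: "x \<in> carrier T"
  shows "f x = f' x"
proof -
  interpret X: central_ext R M S \<psi> by unfold_locales (rule ext)
  have "f (P.cl (Gen g)) = f' (P.cl (Gen g))" if g: "g \<in> gens p" for g p
  proof -
    obtain i j a where ija: "g = (i, j, a)" by (cases g)
    note g = g[unfolded ija]
    have o: "off i j" using g by (auto simp: gens_iff)
    obtain k where k: "k \<in> I" "k \<noteq> i" "k \<noteq> j" using third_index o by blast
    have c: "F i k a \<in> carrier T" "F k j \<one>\<^bsub>D\<^esub> \<in> carrier T"
      using F_closed[OF gens_shift[OF g k(1,2)]] F_closed[OF one_gens[of k j]] o k by auto
    note cl = leibniz_hom_closed[OF f(1) c(1)] leibniz_hom_closed[OF f'(1) c(1)]
      leibniz_hom_closed[OF f(1) c(2)] leibniz_hom_closed[OF f'(1) c(2)]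
    have "bracket M (f (F i k a)) (f (F k j \<one>\<^bsub>D\<^esub>)) = bracket M (f' (F i k a)) (f' (F k j \<one>\<^bsub>D\<^esub>))"
      by (rule X.bracket_cong[OF cl]) (simp_all add: c flip: f(2) f'(2))
    then show ?thesis
      using c leibniz_hom_bracket[OF f(1)] leibniz_hom_bracket[OF f'(1)]
      by (simp add: ija F_eq F_factor[OF g k])
  qed
  then show ?thesis
    using P.presented_hom_unique[folded stl_def, OF X.M.leibniz_superalgebra_axioms f(1) f'(1) _ x] by blast
qed

section \<open>The universal property for \<open>m = 2\<close>, \<open>n = 1\<close>\<close>

text \<open>
  The values of \<open>m\<close> and \<open>n\<close> enter as equations, so that simplification does not rewrite the numerals inside
  the names of the superalgebras.
\<close>

locale steinberg21 = steinberg_hom R D m n \<phi> + X: central_ext R M "sl R m n D" \<psi>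
  for R (structure) and D :: "('r, 'a, 'z) superdialgebra_scheme" (structure) and m n and \<phi> and M and \<psi> +
  assumes m2: "m = 2" and n1: "n = 1"
begin

lemma rank3 [simp]: "m + n = 3"
  by (simp add: m2 n1)

lemma index_cases: "i \<in> I \<Longrightarrow> i = 1 \<or> i = 2 \<or> i = 3"
  by auto

lemma dg_simps: "k = 1 \<or> k = 2 \<Longrightarrow> dg k = 0" "dg 3 = 1"
  by (auto simp: idx_deg_def m2)

text \<open>
  \<open>eps k i\<close> is the \<open>i\<close>-th diagonal entry of the even matrix \<open>U k\<close>, and \<open>wt k i j\<close> the value on \<open>U k\<close> of
  the root in position \<open>(i, j)\<close>.
\<close>

definition eps :: "nat \<Rightarrow> nat \<Rightarrow> 'r" where
  "eps k i = (if i = k \<or> i = 3 then \<one> else \<zero>)"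

definition wt :: "nat \<Rightarrow> nat \<Rightarrow> nat \<Rightarrow> 'r" where
  "wt k i j = eps k j \<ominus> eps k i"

definition U :: "nat \<Rightarrow> nat \<Rightarrow> nat \<Rightarrow> 'a" where
  "U k = E k k \<one>\<^bsub>D\<^esub> \<oplus>\<^bsub>G\<^esub> E 3 3 \<one>\<^bsub>D\<^esub>"

lemma eps_closed [simp]: "eps k i \<in> carrier R"
  by (simp add: eps_def)

lemma wt_closed [simp]: "wt k i j \<in> carrier R"
  by (simp add: wt_def)

lemma wt_left: "wt k i j \<oplus> wt k j l = wt k i l"
  by (simp add: wt_def R.diff_add_diff)

lemma wt_right: "wt k i j \<oplus> wt k l i = wt k l j"
  by (simp add: wt_def R.diff_add_diff R.a_comm[of "eps k j \<ominus> eps k i"])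

lemma U_hpart:
  assumes k: "k = 1 \<or> k = 2"
  shows "U k \<in> hpart S 0"
proof -
  have g: "(k, 3, \<one>\<^bsub>D\<^esub>) \<in> gens 1" "(3, k, \<one>\<^bsub>D\<^esub>) \<in> gens 1"
    using k bar_unit_even dg_simps(1)[OF k] by (auto simp: gens_iff dg_simps(2))
  have "bracket G (E k 3 \<one>\<^bsub>D\<^esub>) (E 3 k \<one>\<^bsub>D\<^esub>) = U k"
    using k gensD[OF g(1)] gensD[OF g(2)] bracket_E[of "\<one>\<^bsub>D\<^esub>" k 3 1 "\<one>\<^bsub>D\<^esub>" 3 k 1]
    by (simp add: U_def bar_unit_left bar_unit_right G.smult_neg_one G.M.minus_eq)
  then have "U k \<in> derived_set R G"
    using k G.derived_set_bracket[of "E k 3 \<one>\<^bsub>D\<^esub>" "E 3 k \<one>\<^bsub>D\<^esub>"] by auto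
  moreover have "U k \<in> hpart G 0"
    unfolding U_def using k by (intro G.hpart_add E_hpart[OF bar_unit_even]) auto
  ultimately show ?thesis by simp
qed

lemma E_weight:
  assumes g: "(i, j, a) \<in> gens p" and k: "k = 1 \<or> k = 2"
  shows "bracket G (E i j a) (U k) = wt k i j \<odot>\<^bsub>G\<^esub> E i j a"
proof -
  have ij: "i \<in> I" "j \<in> I" "i \<noteq> j" and a: "a \<in> hpart D (dg i + dg j + p)" and ac: "a \<in> carrier D"
    using gensD[OF g] by auto
  have c: "E i j a \<in> carrier G" "E k k \<one>\<^bsub>D\<^esub> \<in> carrier G" "E 3 3 \<one>\<^bsub>D\<^esub> \<in> carrier G"
    using ij ac k by auto
  have "bracket G (E i j a) (U k) = bracket G (E i j a) (E k k \<one>\<^bsub>D\<^esub>) \<oplus>\<^bsub>G\<^esub> bracket G (E i j a) (E 3 3 \<one>\<^bsub>D\<^esub>)"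
    unfolding U_def using c by (intro G.brk.add_r)
  also have "\<dots> = (if k = j then E i j a else if k = i then \<ominus>\<^bsub>G\<^esub> E i j a else \<zero>\<^bsub>G\<^esub>) \<oplus>\<^bsub>G\<^esub>
      (if 3 = j then E i j a else if 3 = i then \<ominus>\<^bsub>G\<^esub> E i j a else \<zero>\<^bsub>G\<^esub>)"
    using E_bracket_diag[OF ij a, of k] E_bracket_diag[OF ij a, of 3] k by auto
  also have "\<dots> = wt k i j \<odot>\<^bsub>G\<^esub> E i j a"
    using c(1) ij k
    by (auto simp: wt_def eps_def R.minus_eq R.r_neg R.l_neg G.M.r_neg G.M.l_neg G.smult_neg_one)
  finally show ?thesis .
qed

text \<open>A choice of an element \<open>U (cartan i j)\<close> on which the root in position \<open>(i, j)\<close> has the value \<open>1\<close> or \<open>-1\<close>.\<close>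

definition cartan :: "nat \<Rightarrow> nat \<Rightarrow> nat" where
  "cartan i j = (if i = 2 \<or> j = 2 then 1 else 2)"

lemma cartan_cases: "cartan i j = 1 \<or> cartan i j = 2"
  by (simp add: cartan_def)

lemma wt_cartan_square:
  assumes "off i j"
  shows "wt (cartan i j) i j \<otimes> wt (cartan i j) i j = \<one>"
proof -
  have "i = 1 \<or> i = 2 \<or> i = 3" "j = 1 \<or> j = 2 \<or> j = 3" "i \<noteq> j"
    using assms index_cases by blast+
  then show ?thesis
    by (elim disjE) (simp_all add: wt_def eps_def cartan_def R.minus_eq R.l_minus R.r_minus)
qed

text \<open>
  This is the step that is special to \<open>m = 2\<close>, \<open>n = 1\<close>: a sum of two different roots that is neither zero nor a root takes the
  value \<open>1\<close> or \<open>-1\<close> on \<open>U 1\<close> or \<open>U 2\<close>.  For \<open>sl(3)\<close> the values on diagonal matrices of trace zero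
  would be divisible by \<open>3\<close>.
\<close>

lemma wt_sum_square:
  assumes "off i j" "off k l" "i \<noteq> l" "j \<noteq> k" "(i, j) \<noteq> (k, l)"
  shows "\<exists>c. (c = 1 \<or> c = 2) \<and> (wt c i j \<oplus> wt c k l) \<otimes> (wt c i j \<oplus> wt c k l) = \<one>"
proof -
  have idx: "i = 1 \<or> i = 2 \<or> i = 3" "j = 1 \<or> j = 2 \<or> j = 3" "k = 1 \<or> k = 2 \<or> k = 3" "l = 1 \<or> l = 2 \<or> l = 3"
    using assms(1,2) index_cases by blast+
  \<comment> \<open>On \<open>U 1\<close> the value can be \<open>2\<close> or \<open>-2\<close>, namely if both roots start or both end at \<open>2\<close>.\<close>
  let ?c = "if i = k \<and> i = 2 \<or> j = l \<and> j = 2 then 2 else 1 :: nat"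
  have "(wt ?c i j \<oplus> wt ?c k l) \<otimes> (wt ?c i j \<oplus> wt ?c k l) = \<one>"
    using idx assms
    by (elim disjE) (simp_all add: wt_def eps_def R.minus_eq R.l_minus R.r_minus R.l_neg R.r_neg)
  then show ?thesis by (intro exI[of _ ?c]) auto
qed

definition lift where
  "lift s = (SOME x. x \<in> carrier M \<and> \<psi> x = s)"

definition u where
  "u k = (SOME x. x \<in> hpart M 0 \<and> \<psi> x = U k)"

lemma lift:
  assumes "s \<in> carrier S"
  shows "lift s \<in> carrier M" "\<psi> (lift s) = s"
proof -
  have "s \<in> \<psi> ` carrier M" using X.ext assms unfolding central_extension_def by blast
  then have "\<exists>x. x \<in> carrier M \<and> \<psi> x = s" by blast
  then have "lift s \<in> carrier M \<and> \<psi> (lift s) = s" unfolding lift_def by (rule someI_ex)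
  then show "lift s \<in> carrier M" "\<psi> (lift s) = s" by auto
qed

lemma u:
  assumes "k = 1 \<or> k = 2"
  shows "u k \<in> hpart M 0" "\<psi> (u k) = U k"
proof -
  have "\<exists>x. x \<in> hpart M 0 \<and> \<psi> x = U k" using X.homogeneous_lift[OF U_hpart[OF assms]] by blast
  then have "u k \<in> hpart M 0 \<and> \<psi> (u k) = U k" unfolding u_def by (rule someI_ex)
  then show "u k \<in> hpart M 0" "\<psi> (u k) = U k" by auto
qed

lemma u_closed: "k = 1 \<or> k = 2 \<Longrightarrow> u k \<in> carrier M"
  using u(1) by (rule X.M.hpart_closed)

text \<open>
  The image of a generator in the extension.  Bracketing with \<open>u (cartan i j)\<close> makes the result independent
  of the chosen lift of \<open>E i j a\<close>, and the scalar \<open>1\<close> or \<open>-1\<close> in front cancels the weight.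
\<close>

definition gen_lift where
  "gen_lift = (\<lambda>(i, j, a). wt (cartan i j) i j \<odot>\<^bsub>M\<^esub> bracket M (lift (E i j a)) (u (cartan i j)))"

lemma gen_lift_eq:
  assumes g: "(i, j, a) \<in> gens p" and x: "x \<in> carrier M" "\<psi> x = E i j a"
  shows "gen_lift (i, j, a) = wt (cartan i j) i j \<odot>\<^bsub>M\<^esub> bracket M x (u (cartan i j))"
proof -
  have "E i j a \<in> carrier S" using E_derived[OF g] by simp
  from lift[OF this] show ?thesis
    unfolding gen_lift_def using x u_closed[OF cartan_cases[of i j]]
    by (simp add: X.bracket_cong[of "lift (E i j a)" x "u (cartan i j)" "u (cartan i j)"])
qed

lemma gen_lift_hpart:
  assumes g: "(i, j, a) \<in> gens p"
  shows "gen_lift (i, j, a) \<in> hpart M p"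
proof -
  obtain x where x: "x \<in> hpart M p" "\<psi> x = E i j a"
    using X.homogeneous_lift[OF E_hpart_S[OF g]] by blast
  then have "bracket M x (u (cartan i j)) \<in> hpart M (p + 0)"
    by (intro X.M.brk.hpart u(1) cartan_cases)
  then show ?thesis
    using gen_lift_eq[OF g _ x(2)] x(1) X.M.hpart_closed by (auto intro!: X.M.hpart_smult)
qed

lemma gen_lift_closed: "(i, j, a) \<in> gens p \<Longrightarrow> gen_lift (i, j, a) \<in> carrier M"
  by (rule X.M.hpart_closed) (rule gen_lift_hpart)

lemma psi_gen_lift:
  assumes g: "(i, j, a) \<in> gens p"
  shows "\<psi> (gen_lift (i, j, a)) = E i j a"
proof -
  let ?w = "wt (cartan i j) i j"
  have E: "E i j a \<in> carrier S" "E i j a \<in> carrier G" and o: "off i j"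
    using E_derived[OF g] gensD[OF g] by auto
  have "\<psi> (gen_lift (i, j, a)) = ?w \<odot>\<^bsub>S\<^esub> bracket S (E i j a) (U (cartan i j))"
    using lift[OF E(1)] u[OF cartan_cases[of i j]] u_closed[OF cartan_cases[of i j]]
    by (simp add: gen_lift_def X.psi_smult X.psi_bracket del: S_simps)
  also have "\<dots> = (?w \<otimes> ?w) \<odot>\<^bsub>G\<^esub> E i j a"
    using E(2) by (simp add: E_weight[OF g cartan_cases] G.smult_assoc1)
  finally show ?thesis using E(2) by (simp add: wt_cartan_square[OF o])
qed

text \<open>
  A bracket whose weight under \<open>U c\<close> is \<open>1\<close> or \<open>-1\<close> is recovered from its bracket with \<open>u c\<close>, and hence from its
  image in \<open>sl\<close>.
\<close>

lemma bracket_recover: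
  assumes g: "(i, j, a) \<in> gens p" and g': "(k, l, b) \<in> gens q" and c: "c = 1 \<or> c = 2"
    and sq: "(wt c i j \<oplus> wt c k l) \<otimes> (wt c i j \<oplus> wt c k l) = \<one>"
  defines "z \<equiv> bracket M (gen_lift (i, j, a)) (gen_lift (k, l, b))"
  shows "z = (wt c i j \<oplus> wt c k l) \<odot>\<^bsub>M\<^esub> bracket M z (u c)"
proof -
  let ?w = "wt c i j \<oplus> wt c k l"
  note cl = gen_lift_closed[OF g] gen_lift_closed[OF g']
  have zc: "z \<in> carrier M" using cl by (simp add: z_def)
  have "bracket M z (u c) = ?w \<odot>\<^bsub>M\<^esub> z"
    unfolding z_def using cl u[OF c]
    by (intro X.bracket_weight) (simp_all add: psi_gen_lift[OF g] psi_gen_lift[OF g'] E_weight[OF g c] E_weight[OF g' c])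
  then have "?w \<odot>\<^bsub>M\<^esub> bracket M z (u c) = (?w \<otimes> ?w) \<odot>\<^bsub>M\<^esub> z"
    using zc by (simp add: X.M.smult_assoc1)
  then show ?thesis using zc by (simp add: sq)
qed

lemma gen_lift_left:
  assumes g: "(i, j, a) \<in> gens p" and g': "(j, l, b) \<in> gens q" and ne: "i \<noteq> l"
  shows "bracket M (gen_lift (i, j, a)) (gen_lift (j, l, b)) = gen_lift (i, l, a \<stileturn>\<^bsub>D\<^esub> b)" (is "?z = _")
proof -
  note gl = gens_lprod[OF g g' ne]
  let ?c = "cartan i l"
  have o: "off i l" using gl by (auto simp: gens_iff)
  have zc: "?z \<in> carrier M" using gen_lift_closed[OF g] gen_lift_closed[OF g'] by simp
  have psi_z: "\<psi> ?z = E i l (a \<stileturn>\<^bsub>D\<^esub> b)"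
    using gen_lift_closed[OF g] gen_lift_closed[OF g'] E_left[OF g g' ne]
    by (simp add: X.psi_bracket psi_gen_lift[OF g] psi_gen_lift[OF g'])
  have "?z = wt ?c i l \<odot>\<^bsub>M\<^esub> bracket M ?z (u ?c)"
    using bracket_recover[OF g g' cartan_cases[of i l]] wt_cartan_square[OF o] by (simp add: wt_left)
  then show ?thesis using gen_lift_eq[OF gl zc psi_z] by simp
qed

lemma gen_lift_right:
  assumes g: "(i, j, a) \<in> gens p" and g': "(k, i, b) \<in> gens q" and ne: "j \<noteq> k"
  shows "bracket M (gen_lift (i, j, a)) (gen_lift (k, i, b)) =
    (\<ominus> sgn_of R (p * q)) \<odot>\<^bsub>M\<^esub> gen_lift (k, j, b \<turnstile>\<^bsub>D\<^esub> a)" (is "?z = ?s \<odot>\<^bsub>M\<^esub> _")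
proof -
  note gr = gens_rprod[OF g g' ne]
  let ?c = "cartan k j" and ?y = "gen_lift (k, j, b \<turnstile>\<^bsub>D\<^esub> a)"
  have o: "off k j" using gr ne by (auto simp: gens_iff)
  note cl = gen_lift_closed[OF g] gen_lift_closed[OF g'] gen_lift_closed[OF gr] u_closed[OF cartan_cases[of k j]]
  have s: "?s \<in> carrier R" by simp
  have psi_z: "\<psi> ?z = \<psi> (?s \<odot>\<^bsub>M\<^esub> ?y)"
    using cl E_right[OF g g' ne] X.psi_smult[OF s cl(3)]
    by (simp add: X.psi_bracket psi_gen_lift[OF g] psi_gen_lift[OF g'] psi_gen_lift[OF gr])
  have "?z = wt ?c k j \<odot>\<^bsub>M\<^esub> bracket M ?z (u ?c)"
    using bracket_recover[OF g g' cartan_cases[of k j]] wt_cartan_square[OF o] by (simp add: wt_right)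
  also have "bracket M ?z (u ?c) = ?s \<odot>\<^bsub>M\<^esub> bracket M ?y (u ?c)"
    using X.bracket_cong[of ?z "?s \<odot>\<^bsub>M\<^esub> ?y" "u ?c" "u ?c"] cl s psi_z X.M.brk.smult_l[OF s cl(3,4)] by simp
  also have "wt ?c k j \<odot>\<^bsub>M\<^esub> (?s \<odot>\<^bsub>M\<^esub> bracket M ?y (u ?c)) = ?s \<odot>\<^bsub>M\<^esub> (wt ?c k j \<odot>\<^bsub>M\<^esub> bracket M ?y (u ?c))"
    using cl s R.m_comm[of "wt ?c k j" ?s] by (simp flip: X.M.smult_assoc1 del: R.l_minus)
  also have "wt ?c k j \<odot>\<^bsub>M\<^esub> bracket M ?y (u ?c) = ?y"
    using gen_lift_eq[OF gr cl(3) psi_gen_lift[OF gr]] by simp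
  finally show ?thesis .
qed

text \<open>
  Two root vectors for the same root have a total weight with values in \<open>2R\<close>, which says nothing if \<open>2 = 0\<close>.
  But the second one is a bracket of two root vectors that both commute with the first one in \<open>sl\<close>.
\<close>

lemma gen_lift_same:
  assumes g: "(i, j, a) \<in> gens p" and g': "(i, j, b) \<in> gens q"
  shows "bracket M (gen_lift (i, j, a)) (gen_lift (i, j, b)) = \<zero>\<^bsub>M\<^esub>"
proof -
  have o: "off i j" using g by (auto simp: gens_iff)
  obtain k where k: "k \<in> I" "k \<noteq> i" "k \<noteq> j" using third_index o by blast
  have h: "(i, k, b) \<in> gens (dg k + dg j + q)" "(k, j, \<one>\<^bsub>D\<^esub>) \<in> gens (dg k + dg j)"
    using gens_shift[OF g' k(1,2)] one_gens[of k j] o k by auto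
  have "b \<in> carrier D" using gensD[OF g'] by simp
  then have e: "gen_lift (i, j, b) = bracket M (gen_lift (i, k, b)) (gen_lift (k, j, \<one>\<^bsub>D\<^esub>))"
    using gen_lift_left[OF h] o by (simp add: bar_unit_right)
  note cl = gen_lift_closed[OF g] gen_lift_closed[OF h(1)] gen_lift_closed[OF h(2)]
  have "\<psi> (bracket M (gen_lift (i, j, a)) (gen_lift (i, k, b))) = \<zero>\<^bsub>S\<^esub>"
    using cl E_commute[OF g h(1)] o k
    by (simp add: X.psi_bracket psi_gen_lift[OF g] psi_gen_lift[OF h(1)])
  moreover have "\<psi> (bracket M (gen_lift (i, j, a)) (gen_lift (k, j, \<one>\<^bsub>D\<^esub>))) = \<zero>\<^bsub>S\<^esub>"
    using cl E_commute[OF g h(2)] o k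
    by (simp add: X.psi_bracket psi_gen_lift[OF g] psi_gen_lift[OF h(2)])
  ultimately show ?thesis
    unfolding e X.M.leibniz[OF cl(1) gen_lift_hpart[OF h(1)] gen_lift_hpart[OF h(2)]]
    using cl by (simp add: X.kernel_bracket X.M.M.minus_eq)
qed

lemma gen_lift_commute:
  assumes g: "(i, j, a) \<in> gens p" and g': "(k, l, b) \<in> gens q" and ne: "i \<noteq> l" "j \<noteq> k"
  shows "bracket M (gen_lift (i, j, a)) (gen_lift (k, l, b)) = \<zero>\<^bsub>M\<^esub>" (is "?z = _")
proof (cases "(i, j) = (k, l)")
  case True
  then show ?thesis using gen_lift_same[OF g] g' by simp
next
  case False
  have o: "off i j" "off k l" using g g' by (auto simp: gens_iff)
  obtain c where c: "c = 1 \<or> c = 2" "(wt c i j \<oplus> wt c k l) \<otimes> (wt c i j \<oplus> wt c k l) = \<one>"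
    using wt_sum_square[OF o ne False] by blast
  note cl = gen_lift_closed[OF g] gen_lift_closed[OF g']
  have "\<psi> ?z = \<zero>\<^bsub>S\<^esub>"
    using cl E_commute[OF g g' ne] by (simp add: X.psi_bracket psi_gen_lift[OF g] psi_gen_lift[OF g'])
  then have "bracket M ?z (u c) = \<zero>\<^bsub>M\<^esub>" using cl u_closed[OF c(1)] by (simp add: X.kernel_bracket)
  then show ?thesis using bracket_recover[OF g g' c] by simp
qed

lemma lift_hom_exists: "\<exists>f \<in> leibniz_hom R T M. \<forall>x \<in> carrier T. \<phi> x = \<psi> (f x)"
proof -
  have g: "gen_lift x \<in> hpart M p" if "x \<in> gens p" for x p
    using that gen_lift_hpart by (cases x) auto
  have rel: "leval M gen_lift s = leval M gen_lift t" if "(s, t) \<in> rels" for s t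
    using that
  proof (cases rule: stl_rels.cases)
    case (F_add i j a p b)
    have h: "(i, j, a \<oplus>\<^bsub>D\<^esub> b) \<in> gens p" using F_add by (auto simp: gens_iff hpart_add)
    note cl = gen_lift_closed[OF F_add(3)] gen_lift_closed[OF F_add(4)] u_closed[OF cartan_cases[of i j]]
    have "gen_lift (i, j, a \<oplus>\<^bsub>D\<^esub> b) = wt (cartan i j) i j \<odot>\<^bsub>M\<^esub>
        bracket M (gen_lift (i, j, a) \<oplus>\<^bsub>M\<^esub> gen_lift (i, j, b)) (u (cartan i j))"
      using gensD[OF F_add(3)] gensD[OF F_add(4)] cl
      by (intro gen_lift_eq[OF h]) (simp_all add: X.psi_add psi_gen_lift[OF F_add(3)] psi_gen_lift[OF F_add(4)] E_add)
    also have "\<dots> = gen_lift (i, j, a) \<oplus>\<^bsub>M\<^esub> gen_lift (i, j, b)"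
      using cl gen_lift_eq[OF F_add(3) cl(1) psi_gen_lift[OF F_add(3)]]
        gen_lift_eq[OF F_add(4) cl(2) psi_gen_lift[OF F_add(4)]]
      by (simp add: X.M.brk.add_l X.M.smult_r_distr)
    finally show ?thesis using F_add by simp
  next
    case (F_smul r i j a p)
    have h: "(i, j, r \<odot>\<^bsub>D\<^esub> a) \<in> gens p" using F_smul by (auto simp: gens_iff hpart_smult)
    note cl = gen_lift_closed[OF F_smul(4)] u_closed[OF cartan_cases[of i j]]
    have "gen_lift (i, j, r \<odot>\<^bsub>D\<^esub> a) = wt (cartan i j) i j \<odot>\<^bsub>M\<^esub>
        bracket M (r \<odot>\<^bsub>M\<^esub> gen_lift (i, j, a)) (u (cartan i j))"
      using gensD[OF F_smul(4)] cl F_smul(3)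
      by (intro gen_lift_eq[OF h]) (simp_all add: X.psi_smult psi_gen_lift[OF F_smul(4)] E_smult)
    also have "\<dots> = r \<odot>\<^bsub>M\<^esub> (wt (cartan i j) i j \<odot>\<^bsub>M\<^esub> bracket M (gen_lift (i, j, a)) (u (cartan i j)))"
      using cl F_smul(3) R.m_comm[of r "wt (cartan i j) i j"]
      by (simp add: X.M.brk.smult_l flip: X.M.smult_assoc1)
    also have "\<dots> = r \<odot>\<^bsub>M\<^esub> gen_lift (i, j, a)"
      using gen_lift_eq[OF F_smul(4) cl(1) psi_gen_lift[OF F_smul(4)]] by simp
    finally show ?thesis using F_smul by simp
  next
    case (F_left i j a p k l b q)
    then show ?thesis using gen_lift_left by simp
  next
    case (F_right i j a p k l b q)
    then show ?thesis using gen_lift_right by simp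
  next
    case (F_zero i j a p k l b q)
    then show ?thesis using gen_lift_commute by simp
  qed
  obtain f where f: "f \<in> leibniz_hom R T M" "\<And>x p. x \<in> gens p \<Longrightarrow> f (P.cl (Gen x)) = gen_lift x"
    using P.presented_hom_exists[OF X.M.leibniz_superalgebra_axioms g rel, folded stl_def] by blast
  have comp: "\<psi> \<circ> f \<in> leibniz_hom R T S"
    unfolding leibniz_hom_def
    using leibniz_homD[OF f(1)] leibniz_homD[OF X.psi] by (auto simp del: S_simps)
  have "\<phi> (P.cl (Gen x)) = (\<psi> \<circ> f) (P.cl (Gen x))" if "x \<in> gens p" for x p
    using that phi_F psi_gen_lift f(2)[OF that] by (cases x) (auto simp: F_eq)
  then have "\<phi> x = (\<psi> \<circ> f) x" if "x \<in> carrier T" for x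
    using P.presented_hom_unique[folded stl_def, OF S.leibniz_superalgebra_axioms phi comp _ that] by blast
  then show ?thesis using f(1) by auto
qed

end

theorem theorem4p7:
  fixes R :: "('r, 'x) ring_scheme"
    and D :: "('r, 'd, 'z) superdialgebra_scheme"
  assumes "cring R"
    and "unital_superdialgebra R D"
  shows "(\<exists>\<phi>. canonical_hom R 2 1 D \<phi>) \<and>
         (\<forall>\<phi>. canonical_hom R 2 1 D \<phi> \<longrightarrow>
            universal_central_extension TYPE('m) R (stl R 2 1 D) (sl R 2 1 D) \<phi>)"
proof (intro conjI allI impI)
  interpret unital_superdialgebra R D by fact
  interpret steinberg R D 2 1 by unfold_locales simp
  show "\<exists>\<phi>. canonical_hom R 2 1 D \<phi>" by (rule canonical_hom_exists)
  fix \<phi> assume "canonical_hom R 2 1 D \<phi>"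
  then interpret steinberg_hom R D 2 1 \<phi> by unfold_locales
  show "universal_central_extension TYPE('m) R T S \<phi>"
    unfolding universal_central_extension_def
  proof (intro conjI allI impI canonical_central_extension)
    fix M :: "('r, 'm) supermodule" and \<psi>
    assume ext: "central_extension R M S \<psi>"
    interpret steinberg21 R D 2 1 \<phi> M \<psi>
      by (intro steinberg21.intro steinberg_hom_axioms central_ext.intro steinberg21_axioms.intro ext HOL.refl)
    obtain f where f: "f \<in> leibniz_hom R T M" "\<forall>x \<in> carrier T. \<phi> x = \<psi> (f x)"
      using lift_hom_exists by blast
    show "\<exists>!f. f \<in> leibniz_hom R T M \<and> f \<in> extensional (carrier T) \<and> (\<forall>x \<in> carrier T. \<phi> x = \<psi> (f x))"
    proof (rule ex1I[of _ "restrict f (carrier T)"], intro conjI)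
      show "restrict f (carrier T) \<in> leibniz_hom R T M"
        by (rule T.restrict_hom[OF f(1)])
      show "restrict f (carrier T) \<in> extensional (carrier T)" by simp
      show "\<forall>x \<in> carrier T. \<phi> x = \<psi> (restrict f (carrier T) x)" using f(2) by simp
    next
      fix h assume h: "h \<in> leibniz_hom R T M \<and> h \<in> extensional (carrier T) \<and> (\<forall>x \<in> carrier T. \<phi> x = \<psi> (h x))"
      show "h = restrict f (carrier T)"
      proof (rule extensionalityI[of _ "carrier T"])
        show "h x = restrict f (carrier T) x" if "x \<in> carrier T" for x
          using lift_unique[OF ext _ _ f(1) _ that, of h] h f(2) that by simp
      qed (use h in auto)
    qed
  qed
qed

end
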